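(* Let $\Omega\subset\mathbb{R}^3$ be a bounded, smooth domain and let $m\in\mathbb{N}$, $m\ge2$. If $\mathsf{B}\in H^m(\Omega)^{3\times3}$ and $\det\mathsf{B}=1$ almost everywhere on $\Omega$, then $\mathsf{B}^{-1}\in H^m(\Omega)^{3\times3}$. If, moreover, $\mu_1,\mu_2,\mu_3\in W^{1,\infty}(\Omega)\cap H^m(\Omega)$, then $\mathcal{A}(\mathsf{B})\in H^m(\Omega)^{3\times3}$.
   Context: $\mathsf{B}$ is a $3\times3$-matrix-valued function on $\Omega$, $\mathsf{B}^{-1}$ is its pointwise matrix inverse, and $\mathcal{A}(\mathsf{B})=\mu_1\mathsf{I}+\mu_2\mathsf{B}+\mu_3\mathsf{B}^{-1}$, where $\mathsf{I}$ is the identity matrix and $\mu_1,\mu_2,\mu_3$ are scalar fields on $\Omega$. $H^m(\Omega)=W^{m,2}(\Omega)$. *)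

theory Defs
  imports "HOL-Analysis.Analysis"
begin

definition partial_deriv :: "'n::finite \<Rightarrow> (real^'n \<Rightarrow> real) \<Rightarrow> real^'n \<Rightarrow> real" where
  "partial_deriv i f x = frechet_derivative f (at x) (axis i 1)"

fun C_k :: "nat \<Rightarrow> (real^'n::finite \<Rightarrow> real) \<Rightarrow> bool" where
  "C_k 0 f \<longleftrightarrow> continuous_on UNIV f"
| "C_k (Suc k) f \<longleftrightarrow> f differentiable_on UNIV \<and> (\<forall>i. C_k k (partial_deriv i f))"

definition C_infinity :: "(real^'n::finite \<Rightarrow> real) \<Rightarrow> bool" where
  "C_infinity f \<longleftrightarrow> (\<forall>k. C_k k f)"

text \<open>A bounded domain is smooth if, near each boundary point and in suitably rotated or reflected
  Cartesian coordinates, it is the region above the graph of a smooth function.\<close>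

definition bounded_smooth_domain :: "(real^3) set \<Rightarrow> bool" where
  "bounded_smooth_domain \<Omega> \<longleftrightarrow>
     open \<Omega> \<and> connected \<Omega> \<and> \<Omega> \<noteq> {} \<and> bounded \<Omega> \<and>
     (\<forall>p \<in> frontier \<Omega>. \<exists>r>0. \<exists>(T :: real^3 \<Rightarrow> real^3) (\<gamma> :: real^2 \<Rightarrow> real).
        orthogonal_transformation T \<and> C_infinity \<gamma> \<and>
        \<Omega> \<inter> ball p r = {x \<in> ball p r. T x $ 3 > \<gamma> (vector [T x $ 1, T x $ 2])})"

definition test_function :: "(real^3) set \<Rightarrow> (real^3 \<Rightarrow> real) \<Rightarrow> bool" where
  "test_function \<Omega> \<phi> \<longleftrightarrow>
     C_infinity \<phi> \<and> compact (closure {x. \<phi> x \<noteq> 0}) \<and> closure {x. \<phi> x \<noteq> 0} \<subseteq> \<Omega>"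

definition multi_order :: "nat^3 \<Rightarrow> nat" where
  "multi_order \<alpha> = (\<Sum>i\<in>UNIV. \<alpha> $ i)"

definition multi_deriv :: "nat^3 \<Rightarrow> (real^3 \<Rightarrow> real) \<Rightarrow> real^3 \<Rightarrow> real" where
  "multi_deriv \<alpha> f =
     (partial_deriv 1 ^^ (\<alpha> $ 1)) ((partial_deriv 2 ^^ (\<alpha> $ 2)) ((partial_deriv 3 ^^ (\<alpha> $ 3)) f))"

definition locally_integrable :: "(real^3) set \<Rightarrow> (real^3 \<Rightarrow> real) \<Rightarrow> bool" where
  "locally_integrable \<Omega> u \<longleftrightarrow> (\<forall>K. compact K \<and> K \<subseteq> \<Omega> \<longrightarrow> integrable (lebesgue_on K) u)"

definition weak_deriv :: "(real^3) set \<Rightarrow> nat^3 \<Rightarrow> (real^3 \<Rightarrow> real) \<Rightarrow> (real^3 \<Rightarrow> real) \<Rightarrow> bool" where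
  "weak_deriv \<Omega> \<alpha> u v \<longleftrightarrow>
     locally_integrable \<Omega> u \<and> locally_integrable \<Omega> v \<and>
     (\<forall>\<phi>. test_function \<Omega> \<phi> \<longrightarrow>
        (LINT x|lebesgue_on \<Omega>. u x * multi_deriv \<alpha> \<phi> x) =
        (-1) ^ multi_order \<alpha> * (LINT x|lebesgue_on \<Omega>. v x * \<phi> x))"

text \<open>Elements of Lebesgue and Sobolev spaces are represented by functions rather than by classes
  modulo equality almost everywhere; membership is invariant under changes on null sets, and
  values outside \<open>\<Omega>\<close> are irrelevant. The exponent \<open>p\<close> is meant to satisfy \<open>1 \<le> p \<le> \<infinity>\<close>.\<close>

definition Lp_space :: "ennreal \<Rightarrow> (real^3) set \<Rightarrow> (real^3 \<Rightarrow> real) set" where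
  "Lp_space p \<Omega> = {u \<in> borel_measurable (lebesgue_on \<Omega>).
     if p = \<infinity> then (\<exists>C. AE x in lebesgue_on \<Omega>. \<bar>u x\<bar> \<le> C)
     else integrable (lebesgue_on \<Omega>) (\<lambda>x. \<bar>u x\<bar> powr enn2real p)}"

definition Sobolev :: "nat \<Rightarrow> ennreal \<Rightarrow> (real^3) set \<Rightarrow> (real^3 \<Rightarrow> real) set" where
  "Sobolev k p \<Omega> = {u \<in> Lp_space p \<Omega>.
     \<forall>\<alpha>. multi_order \<alpha> \<le> k \<longrightarrow> (\<exists>v \<in> Lp_space p \<Omega>. weak_deriv \<Omega> \<alpha> u v)}"

definition H_space :: "nat \<Rightarrow> (real^3) set \<Rightarrow> (real^3 \<Rightarrow> real) set" where
  "H_space m \<Omega> = Sobolev m 2 \<Omega>"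

definition H_matrix :: "nat \<Rightarrow> (real^3) set \<Rightarrow> (real^3 \<Rightarrow> real^3^3) set" where
  "H_matrix m \<Omega> = {B. \<forall>i j. (\<lambda>x. B x $ i $ j) \<in> H_space m \<Omega>}"

text \<open>Where \<open>B x\<close> is singular, \<open>matrix_inv (B x)\<close> is unspecified; if \<open>det B = 1\<close> almost everywhere,
  this concerns a null set only.\<close>

definition matrix_field_inv :: "(real^3 \<Rightarrow> real^3^3) \<Rightarrow> real^3 \<Rightarrow> real^3^3" where
  "matrix_field_inv B = (\<lambda>x. matrix_inv (B x))"

definition response ::
  "(real^3 \<Rightarrow> real) \<Rightarrow> (real^3 \<Rightarrow> real) \<Rightarrow> (real^3 \<Rightarrow> real) \<Rightarrow> (real^3 \<Rightarrow> real^3^3) \<Rightarrow> real^3 \<Rightarrow> real^3^3"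
where
  "response \<mu>1 \<mu>2 \<mu>3 B =
     (\<lambda>x. \<mu>1 x *\<^sub>R mat 1 + \<mu>2 x *\<^sub>R B x + \<mu>3 x *\<^sub>R matrix_field_inv B x)"

end

theory Submission
  imports Defs
begin

text \<open>
  By Cramer's rule the inverse of a matrix of determinant one is its adjugate, whose entries are quadratic
  polynomials in the entries of the matrix. The products of the coefficients \<open>\<mu>\<close> with the entries are again
  products of two functions in \<open>H^m\<close>. Hence everything follows from the fact that \<open>H^m(\<Omega>)\<close> is an algebra for
  \<open>m \<ge> 2\<close> in three dimensions (\<open>H_space_mult\<close>).

  The algebra property is proved by induction on the order (\<open>H_zero_mult\<close>). Leibniz' rule
  \<open>\<partial>(u v) = (\<partial>u) v + u (\<partial>v)\<close> lowers the order by one, and the induction rests on two embeddings: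
  \<open>H^1(\<Omega>)\<close> into \<open>L^4(\<Omega>)\<close>, by which the product of two functions in \<open>H^1\<close> is square integrable, and \<open>H^2(\<Omega>)\<close>
  into \<open>L^\<infinity>(\<Omega>)\<close>, by which a factor in \<open>H^2\<close> preserves square integrability. The second embedding follows
  from the first one, applied to the gradient, and from the embedding of \<open>W^{1,4}\<close> into \<open>L^\<infinity>\<close>.

  Leibniz' rule and the embeddings are drawn from one description of weak derivatives. The function \<open>g\<close> is the
  weak derivative of \<open>u\<close> in direction \<open>w\<close> if and only if, for every \<open>h\<close> and almost every \<open>x\<close> for which the segment
  from \<open>x\<close> to \<open>x + h w\<close> lies in \<open>\<Omega>\<close>, the difference \<open>u (x + h w) - u x\<close> is the integral of \<open>g (x + t w)\<close> over
  \<open>0 \<le> t \<le> h\<close> (\<open>weak_dir_difference\<close>, \<open>weak_dir_if_difference\<close>). One direction is the fundamental lemma of the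
  calculus of variations, the other one a differentiation at \<open>h = 0\<close>. In this form the product rule is the
  one-dimensional rule for absolutely continuous functions, that is, Fubini's theorem on a triangle
  (\<open>weak_dir_square\<close>, \<open>weak_dir_mult\<close>).

  For the embeddings, the smoothness of the boundary yields cones of uniform size and shape with vertices at the
  points of a small piece of \<open>\<Omega>\<close> (\<open>cone_property\<close>). Averaging the difference formula over the cone at \<open>x\<close> bounds
  \<open>\<bar>u x\<bar>\<close> by the \<open>L^1\<close> norm of \<open>u\<close> and a potential of its gradient (\<open>cone_representation\<close>), which is estimated by
  the Cauchy--Schwarz inequality (\<open>cone_potential_L4\<close>, \<open>cone_potential_bounded\<close>). Finitely many pieces cover
  \<open>\<Omega>\<close>.
\<close>

section \<open>Smooth functions and test functions\<close>

lemma C_k_Suc_imp: "C_k (Suc k) f \<Longrightarrow> C_k k f"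
proof (induction k arbitrary: f)
  case 0
  then show ?case by (simp add: differentiable_imp_continuous_on)
next
  case (Suc k)
  then show ?case by (metis C_k.simps(2))
qed

lemma partial_deriv_eqI: "(f has_derivative D) (at x) \<Longrightarrow> partial_deriv i f x = D (axis i 1)"
  unfolding partial_deriv_def by (metis frechet_derivative_at)

lemma has_derivative_partial:
  fixes f :: "real^'n::finite \<Rightarrow> real"
  assumes "f differentiable (at x)"
  shows "(f has_derivative (\<lambda>h. \<Sum>i\<in>UNIV. h $ i * partial_deriv i f x)) (at x)"
proof -
  let ?D = "frechet_derivative f (at x)"
  have D: "(f has_derivative ?D) (at x)"
    using assms frechet_derivative_works by blast
  then have lin: "linear ?D"
    by (rule has_derivative_linear)
  have "?D h = (\<Sum>i\<in>UNIV. h $ i * partial_deriv i f x)" for h :: "real^'n"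
  proof -
    have "?D h = ?D (\<Sum>i\<in>UNIV. h $ i *s axis i 1)"
      by (simp add: basis_expansion)
    also have "\<dots> = (\<Sum>i\<in>UNIV. h $ i * partial_deriv i f x)"
      using lin by (simp add: linear_sum linear_scale partial_deriv_def scalar_mult_eq_scaleR)
    finally show ?thesis .
  qed
  then show ?thesis using D by (metis (no_types, lifting) ext)
qed

lemma sum_axis_mult: "(\<Sum>j\<in>UNIV. (axis i 1 :: real^'n::finite) $ j * c j) = c i"
proof -
  have "(\<Sum>j\<in>UNIV. (axis i 1 :: real^'n) $ j * c j) = (\<Sum>j\<in>UNIV. if j = i then c j else 0)"
    by (intro sum.cong) (auto simp: axis_def)
  then show ?thesis by simp
qed

lemma C_infinity_differentiable: "C_infinity f \<Longrightarrow> f differentiable (at x)"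
  unfolding C_infinity_def by (metis C_k.simps(2) UNIV_I differentiable_on_def)

lemma C_infinity_continuous: "C_infinity f \<Longrightarrow> continuous_on UNIV f"
  unfolding C_infinity_def by (metis C_k.simps(1))

lemma C_infinity_partial: "C_infinity f \<Longrightarrow> C_infinity (partial_deriv i f)"
  unfolding C_infinity_def by (metis C_k.simps(2))

lemma C_k_const: "C_k k (\<lambda>x. c)"
proof (induction k arbitrary: c)
  case (Suc k)
  have "partial_deriv i (\<lambda>x. c) = (\<lambda>x. 0)" for i :: 'a
    by (rule ext) (simp add: partial_deriv_eqI[OF has_derivative_const])
  then show ?case using Suc by simp
qed simp

lemma C_k_add:
  assumes "C_k k f" "C_k k g"
  shows "C_k k (\<lambda>x. f x + g x)"
  using assms
proof (induction k arbitrary: f g)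
  case 0
  then show ?case by (simp add: continuous_on_add)
next
  case (Suc k)
  have "partial_deriv i (\<lambda>x. f x + g x) = (\<lambda>x. partial_deriv i f x + partial_deriv i g x)" for i
  proof
    fix x
    have "f differentiable (at x)" "g differentiable (at x)"
      using Suc.prems by (simp_all add: differentiable_on_def)
    then show "partial_deriv i (\<lambda>x. f x + g x) x = partial_deriv i f x + partial_deriv i g x"
      by (subst partial_deriv_eqI[OF has_derivative_add[OF has_derivative_partial has_derivative_partial]])
        (simp_all add: sum_axis_mult)
  qed
  with Suc show ?case
    by (simp add: differentiable_on_def differentiable_add)
qed

lemma C_k_mult:
  assumes "C_k k f" "C_k k g"
  shows "C_k k (\<lambda>x. f x * g x)"
  using assms
proof (induction k arbitrary: f g)
  case 0
  then show ?case by (simp add: continuous_on_mult)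
next
  case (Suc k)
  have "partial_deriv i (\<lambda>x. f x * g x) = (\<lambda>x. f x * partial_deriv i g x + partial_deriv i f x * g x)" for i
  proof
    fix x
    have "f differentiable (at x)" "g differentiable (at x)"
      using Suc.prems by (simp_all add: differentiable_on_def)
    then show "partial_deriv i (\<lambda>x. f x * g x) x = f x * partial_deriv i g x + partial_deriv i f x * g x"
      by (subst partial_deriv_eqI[OF has_derivative_mult[OF has_derivative_partial has_derivative_partial]])
        (simp_all add: sum_axis_mult)
  qed
  moreover have "C_k k f" "C_k k g"
    using Suc.prems by (blast intro: C_k_Suc_imp)+
  ultimately show ?case using Suc.prems
    by (simp add: differentiable_on_def differentiable_mult C_k_add Suc.IH)
qed

lemma C_k_prod: "finite S \<Longrightarrow> (\<And>i. i \<in> S \<Longrightarrow> C_k k (f i)) \<Longrightarrow> C_k k (\<lambda>x. \<Prod>i\<in>S. f i x)"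
  by (induction S rule: finite_induct) (simp_all add: C_k_const C_k_mult)

lemma C_k_exp:
  assumes "C_k k f"
  shows "C_k k (\<lambda>x. exp (f x))"
  using assms
proof (induction k arbitrary: f)
  case 0
  then show ?case by (simp add: continuous_on_exp)
next
  case (Suc k)
  have D: "((\<lambda>x. exp (f x)) has_derivative
      (\<lambda>h. (\<Sum>i\<in>UNIV. h $ i * partial_deriv i f x) * exp (f x))) (at x)" for x
    using Suc.prems by (auto intro!: derivative_eq_intros has_derivative_partial simp: differentiable_on_def)
  have "partial_deriv i (\<lambda>x. exp (f x)) = (\<lambda>x. partial_deriv i f x * exp (f x))" for i
    by (rule ext, subst partial_deriv_eqI[OF D]) (simp_all add: sum_axis_mult)
  moreover have "C_k k f"
    using Suc.prems by (blast intro: C_k_Suc_imp)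
  ultimately show ?case using Suc.prems D
    by (auto simp: differentiable_on_def differentiable_def C_k_mult Suc.IH)
qed

lemma C_k_translate:
  assumes "C_k k f"
  shows "C_k k (\<lambda>x. f (x + a))"
    and "k > 0 \<Longrightarrow> partial_deriv i (\<lambda>x. f (x + a)) = (\<lambda>x. partial_deriv i f (x + a))"
proof -
  have D: "((\<lambda>x. f (x + a)) has_derivative
      (\<lambda>h. \<Sum>i\<in>UNIV. h $ i * partial_deriv i f (x + a))) (at x)"
    if "f differentiable (at (x + a))" for x f
  proof -
    have "((\<lambda>x. x + a) has_derivative (\<lambda>h. h)) (at x)"
      by (auto intro!: derivative_eq_intros)
    from has_derivative_compose[OF this has_derivative_partial[OF that]] show ?thesis .
  qed
  have P: "partial_deriv i (\<lambda>x. f (x + a)) = (\<lambda>x. partial_deriv i f (x + a))"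
    if "f differentiable_on UNIV" for i f
    using that by (intro ext, subst partial_deriv_eqI[OF D])
      (simp_all add: sum_axis_mult differentiable_on_def)
  show "C_k k (\<lambda>x. f (x + a))"
    using assms
  proof (induction k arbitrary: f)
    case 0
    then have "continuous_on UNIV f" by simp
    then have "continuous_on UNIV (f \<circ> (\<lambda>x. x + a))"
      by (intro continuous_on_compose) (auto intro: continuous_intros continuous_on_subset)
    then show ?case by (simp add: o_def)
  next
    case (Suc k)
    then have "(\<lambda>x. f (x + a)) differentiable_on UNIV"
      using D by (fastforce simp: differentiable_on_def differentiable_def[of "\<lambda>x. f (x + a)"])
    with Suc P[of f] show ?case by simp
  qed
  show "partial_deriv i (\<lambda>x. f (x + a)) = (\<lambda>x. partial_deriv i f (x + a))" if "k > 0"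
    using P[of f] assms that by (cases k) auto
qed

lemma has_real_derivative_line:
  fixes f :: "real^'n::finite \<Rightarrow> real"
  assumes "f differentiable (at (x + t *\<^sub>R w))"
  shows "((\<lambda>t. f (x + t *\<^sub>R w)) has_real_derivative
           (\<Sum>i\<in>UNIV. w $ i * partial_deriv i f (x + t *\<^sub>R w))) (at t)"
proof -
  have "((\<lambda>t. x + t *\<^sub>R w) has_derivative (\<lambda>s. s *\<^sub>R w)) (at t)"
    by (auto intro!: derivative_eq_intros)
  from has_derivative_compose[OF this has_derivative_partial[OF assms]]
  have "((\<lambda>t. f (x + t *\<^sub>R w)) has_derivative
      (\<lambda>s. \<Sum>i\<in>UNIV. (s *\<^sub>R w) $ i * partial_deriv i f (x + t *\<^sub>R w))) (at t)" .
  moreover have "(\<lambda>s. \<Sum>i\<in>UNIV. (s *\<^sub>R w) $ i * partial_deriv i f (x + t *\<^sub>R w))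
      = (*) (\<Sum>i\<in>UNIV. w $ i * partial_deriv i f (x + t *\<^sub>R w))"
    by (simp add: fun_eq_iff sum_distrib_left mult_ac)
  ultimately show ?thesis
    by (simp only: has_field_derivative_def)
qed

lemma has_real_derivative_axis:
  fixes f :: "real^'n::finite \<Rightarrow> real"
  assumes "f differentiable (at (x + t *\<^sub>R axis i 1))"
  shows "((\<lambda>t. f (x + t *\<^sub>R axis i 1)) has_real_derivative partial_deriv i f (x + t *\<^sub>R axis i 1)) (at t)"
  using has_real_derivative_line[OF assms] by (simp add: sum_axis_mult)

text \<open>Two applications of the mean value theorem turn the mixed second difference of \<open>f\<close>, which is
  symmetric in \<open>i\<close> and \<open>j\<close>, into a mixed second derivative at a nearby point.\<close>

lemma second_difference_eq:
  fixes f :: "real^'n::finite \<Rightarrow> real"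
  assumes "C_k (Suc (Suc 0)) f" "h > 0"
  shows "\<exists>y. dist y x \<le> 2 * h \<and>
    f (x + h *\<^sub>R axis i 1 + h *\<^sub>R axis j 1) - f (x + h *\<^sub>R axis i 1) - f (x + h *\<^sub>R axis j 1) + f x
      = h * h * partial_deriv j (partial_deriv i f) y"
proof -
  let ?ei = "axis i 1 :: real^'n" and ?ej = "axis j 1 :: real^'n"
  have diff: "f differentiable (at x)" "partial_deriv i f differentiable (at x)" for x
    using assms(1) by (simp_all add: differentiable_on_def)
  define g where "g s = f (x + h *\<^sub>R ?ej + s *\<^sub>R ?ei) - f (x + s *\<^sub>R ?ei)" for s
  have "(g has_real_derivative
      partial_deriv i f (x + h *\<^sub>R ?ej + s *\<^sub>R ?ei) - partial_deriv i f (x + s *\<^sub>R ?ei)) (at s)" for s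
    unfolding g_def by (intro derivative_intros has_real_derivative_axis diff)
  then obtain \<xi> where \<xi>: "0 < \<xi>" "\<xi> < h" "g h - g 0 = h *
      (partial_deriv i f (x + h *\<^sub>R ?ej + \<xi> *\<^sub>R ?ei) - partial_deriv i f (x + \<xi> *\<^sub>R ?ei))"
    using MVT2[OF assms(2), of g "\<lambda>s. partial_deriv i f (x + h *\<^sub>R ?ej + s *\<^sub>R ?ei) - partial_deriv i f (x + s *\<^sub>R ?ei)"]
    by auto
  define k where "k t = partial_deriv i f (x + \<xi> *\<^sub>R ?ei + t *\<^sub>R ?ej)" for t
  have "(k has_real_derivative partial_deriv j (partial_deriv i f) (x + \<xi> *\<^sub>R ?ei + t *\<^sub>R ?ej)) (at t)" for t
    unfolding k_def by (intro has_real_derivative_axis diff)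
  then obtain \<eta> where \<eta>: "0 < \<eta>" "\<eta> < h"
      "k h - k 0 = h * partial_deriv j (partial_deriv i f) (x + \<xi> *\<^sub>R ?ei + \<eta> *\<^sub>R ?ej)"
    using MVT2[OF assms(2), of k "\<lambda>t. partial_deriv j (partial_deriv i f) (x + \<xi> *\<^sub>R ?ei + t *\<^sub>R ?ej)"]
    by auto
  have "norm (\<xi> *\<^sub>R ?ei + \<eta> *\<^sub>R ?ej) \<le> \<bar>\<xi>\<bar> + \<bar>\<eta>\<bar>"
    by (rule order_trans[OF norm_triangle_ineq]) simp
  then have "dist (x + \<xi> *\<^sub>R ?ei + \<eta> *\<^sub>R ?ej) x \<le> 2 * h"
    using \<xi> \<eta> by (simp add: dist_norm add.assoc)
  moreover have "f (x + h *\<^sub>R ?ei + h *\<^sub>R ?ej) - f (x + h *\<^sub>R ?ei) - f (x + h *\<^sub>R ?ej) + f x = g h - g 0"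
    by (simp add: g_def add_ac)
  moreover have "g h - g 0 = h * (k h - k 0)"
    using \<xi>(3) by (simp add: k_def add_ac)
  ultimately show ?thesis
    using \<eta>(3) by (metis mult.assoc)
qed

lemma partial_deriv_commute:
  fixes f :: "real^'n::finite \<Rightarrow> real"
  assumes "C_k (Suc (Suc 0)) f"
  shows "partial_deriv i (partial_deriv j f) = partial_deriv j (partial_deriv i f)"
proof
  fix x :: "real^'n"
  define h where "h n = inverse (real (Suc n))" for n
  have h: "h n > 0" for n by (simp add: h_def)
  have h0: "(\<lambda>n. 2 * h n) \<longlonglongrightarrow> 0"
    unfolding h_def by (intro tendsto_mult_right_zero LIMSEQ_inverse_real_of_nat)
  have "\<exists>y z. dist y x \<le> 2 * h n \<and> dist z x \<le> 2 * h n \<and>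
      partial_deriv j (partial_deriv i f) y = partial_deriv i (partial_deriv j f) z" for n
  proof -
    obtain y where y: "dist y x \<le> 2 * h n"
      "f (x + h n *\<^sub>R axis i 1 + h n *\<^sub>R axis j 1) - f (x + h n *\<^sub>R axis i 1) - f (x + h n *\<^sub>R axis j 1) + f x
      = h n * h n * partial_deriv j (partial_deriv i f) y"
      using second_difference_eq[OF assms h] by blast
    obtain z where z: "dist z x \<le> 2 * h n"
      "f (x + h n *\<^sub>R axis j 1 + h n *\<^sub>R axis i 1) - f (x + h n *\<^sub>R axis j 1) - f (x + h n *\<^sub>R axis i 1) + f x
      = h n * h n * partial_deriv i (partial_deriv j f) z"
      using second_difference_eq[OF assms h] by blast
    have "h n * h n * partial_deriv j (partial_deriv i f) y = h n * h n * partial_deriv i (partial_deriv j f) z"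
      unfolding y(2)[symmetric] z(2)[symmetric] by (simp add: add_ac)
    then show ?thesis using y(1) z(1) h[of n] by auto
  qed
  then obtain Y Z where YZ: "\<And>n. dist (Y n) x \<le> 2 * h n" "\<And>n. dist (Z n) x \<le> 2 * h n"
      "\<And>n. partial_deriv j (partial_deriv i f) (Y n) = partial_deriv i (partial_deriv j f) (Z n)"
    by metis
  have lim: "W \<longlonglongrightarrow> x" if "\<And>n. dist (W n) x \<le> 2 * h n" for W
    unfolding tendsto_dist_iff[of W]
    by (rule tendsto_sandwich[OF _ _ tendsto_const h0]) (simp_all add: that)
  have "Y \<longlonglongrightarrow> x" "Z \<longlonglongrightarrow> x"
    using YZ(1,2) lim by blast+
  moreover have "isCont (partial_deriv j (partial_deriv i f)) x" "isCont (partial_deriv i (partial_deriv j f)) x"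
    using assms by (simp_all add: continuous_on_eq_continuous_at)
  ultimately have "(\<lambda>n. partial_deriv j (partial_deriv i f) (Y n)) \<longlonglongrightarrow> partial_deriv j (partial_deriv i f) x"
      "(\<lambda>n. partial_deriv i (partial_deriv j f) (Z n)) \<longlonglongrightarrow> partial_deriv i (partial_deriv j f) x"
    by (auto intro: isCont_tendsto_compose)
  then show "partial_deriv i (partial_deriv j f) x = partial_deriv j (partial_deriv i f) x"
    using YZ(3) LIMSEQ_unique by simp
qed

lemma partial_deriv_funpow_commute:
  assumes "C_infinity f"
  shows "partial_deriv i ((partial_deriv j ^^ n) f) = (partial_deriv j ^^ n) (partial_deriv i f)"
    and "C_infinity ((partial_deriv j ^^ n) f)"
proof (induction n)
  case (Suc n)
  case 1
  have "C_k (Suc (Suc 0)) ((partial_deriv j ^^ n) f)"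
    using Suc(2) unfolding C_infinity_def by blast
  from partial_deriv_commute[OF this, of i j] show ?case using Suc(1) by simp
  case 2
  then show ?case using Suc(2) by (simp add: C_infinity_partial)
qed (use assms in simp_all)

lemma multi_deriv_add_axis:
  assumes "C_infinity f"
  shows "multi_deriv (\<alpha> + axis i 1) f = multi_deriv \<alpha> (partial_deriv i f)"
    and "multi_deriv (\<alpha> + axis i 1) f = partial_deriv i (multi_deriv \<alpha> f)"
proof -
  show 1: "multi_deriv (\<alpha> + axis i 1) f = multi_deriv \<alpha> (partial_deriv i f)"
  proof -
    consider "i = 1" | "i = 2" | "i = 3" using exhaust_3 by blast
    then show ?thesis
      using assms by cases (simp_all add: multi_deriv_def axis_def funpow_Suc_right
          partial_deriv_funpow_commute del: funpow.simps)
  qed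
  show "multi_deriv (\<alpha> + axis i 1) f = partial_deriv i (multi_deriv \<alpha> f)"
    unfolding 1 using assms by (simp add: multi_deriv_def partial_deriv_funpow_commute)
qed

lemma multi_deriv_zero: "multi_deriv 0 f = f"
  by (simp add: multi_deriv_def)

lemma multi_deriv_axis: "multi_deriv (axis i 1) f = partial_deriv i f"
proof -
  consider "i = 1" | "i = 2" | "i = 3" using exhaust_3 by blast
  then show ?thesis by cases (simp_all add: multi_deriv_def axis_def)
qed

lemma multi_order_add_axis: "multi_order (\<alpha> + axis i 1) = Suc (multi_order \<alpha>)"
  by (simp add: multi_order_def axis_def sum.distrib)

lemma multi_order_eq_0: "multi_order \<alpha> = 0 \<longleftrightarrow> \<alpha> = 0"
  by (auto simp: multi_order_def vec_eq_iff)

lemma multi_order_Suc_decomp: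
  fixes \<alpha> :: "nat^3"
  assumes "\<alpha> \<noteq> 0"
  obtains \<beta> i where "\<alpha> = \<beta> + axis i 1"
proof -
  obtain i where i: "\<alpha> $ i \<noteq> 0" using assms by (auto simp: vec_eq_iff)
  have "\<alpha> = (\<chi> j. if j = i then \<alpha> $ i - 1 else \<alpha> $ j) + axis i 1"
    using i by (auto simp: vec_eq_iff axis_def)
  then show ?thesis using that by blast
qed

text \<open>The classical function \<open>exp (- 1 / t)\<close> and its derivatives: each has the form
  \<open>p (1 / t) * exp (- 1 / t)\<close> for a polynomial \<open>p\<close>, extended by zero to \<open>t \<le> 0\<close>.\<close>

primrec flat_poly :: "nat \<Rightarrow> real poly" where
  "flat_poly 0 = 1"
| "flat_poly (Suc n) = [:0, 0, 1:] * (flat_poly n - pderiv (flat_poly n))"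

definition flat :: "nat \<Rightarrow> real \<Rightarrow> real" where
  "flat n t = (if t > 0 then poly (flat_poly n) (1 / t) * exp (- (1 / t)) else 0)"

lemma poly_times_exp_minus_tendsto_0:
  fixes q :: "real poly"
  shows "((\<lambda>s. poly q s * exp (- s)) \<longlongrightarrow> 0) at_top"
proof -
  have "((\<lambda>s. \<Sum>i\<le>degree q. coeff q i * (s ^ i / exp s)) \<longlongrightarrow> (\<Sum>i\<le>degree q. coeff q i * 0)) at_top"
    by (intro tendsto_sum tendsto_mult tendsto_const tendsto_power_div_exp_0)
  then show ?thesis
    by (simp add: poly_altdef sum_distrib_right sum_divide_distrib exp_minus field_simps)
qed

lemma has_real_derivative_flat: "(flat n has_real_derivative flat (Suc n) t) (at t)"
proof -
  consider "t > 0" | "t < 0" | "t = 0" by linarith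
  then show ?thesis
  proof cases
    case 1
    have "((\<lambda>t. poly (flat_poly n) (1 / t) * exp (- (1 / t))) has_real_derivative flat (Suc n) t) (at t)"
      using 1 by (auto intro!: derivative_eq_intros simp: flat_def field_simps power2_eq_square)
    then show ?thesis
      by (rule has_field_derivative_transform_within_open[where S="{0<..}"]) (use 1 in \<open>auto simp: flat_def\<close>)
  next
    case 2
    have "((\<lambda>t. 0) has_real_derivative flat (Suc n) t) (at t)"
      using 2 by (simp add: flat_def)
    then show ?thesis
      by (rule has_field_derivative_transform_within_open[where S="{..<0}"]) (use 2 in \<open>auto simp: flat_def\<close>)
  next
    case 3
    have "((\<lambda>h. poly ([:0, 1:] * flat_poly n) (1 / h) * exp (- (1 / h))) \<longlongrightarrow> 0) (at_right 0)"
      using filterlim_compose[OF poly_times_exp_minus_tendsto_0[of "[:0, 1:] * flat_poly n"]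
          filterlim_inverse_at_top_right]
      by (simp add: inverse_eq_divide)
    then have "((\<lambda>h. flat n h / h) \<longlongrightarrow> 0) (at_right 0)"
      by (rule tendsto_cong[THEN iffD1, rotated]) (auto simp: flat_def eventually_at_filter)
    moreover have "((\<lambda>h. flat n h / h) \<longlongrightarrow> 0) (at_left 0)"
      by (rule tendsto_cong[THEN iffD1, OF _ tendsto_const]) (auto simp: flat_def eventually_at_filter)
    ultimately have "((\<lambda>h. flat n h / h) \<longlongrightarrow> 0) (at 0)"
      by (intro filterlim_split_at)
    then show ?thesis
      using 3 by (simp add: DERIV_def flat_def)
  qed
qed

lemma C_k_coordinate:
  assumes d: "\<And>n t. (d n has_real_derivative d (Suc n) t) (at t)"
  shows "C_k k (\<lambda>x::real^'n::finite. d n (c + s * x $ i))"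
proof (induction k arbitrary: n)
  case 0
  have "continuous_on UNIV (d n)"
    using d by (meson DERIV_isCont continuous_at_imp_continuous_on)
  then show ?case
    by (auto intro!: continuous_intros continuous_on_compose2[of UNIV "d n"])
next
  case (Suc k)
  have D: "((\<lambda>x::real^'n. d n (c + s * x $ i)) has_derivative (\<lambda>h. d (Suc n) (c + s * x $ i) * (s * h $ i))) (at x)" for x
  proof -
    have "((\<lambda>x::real^'n. c + s * x $ i) has_derivative (\<lambda>h. s * h $ i)) (at x)"
      by (auto intro!: derivative_eq_intros bounded_linear.has_derivative[OF bounded_linear_vec_nth])
    from has_derivative_compose[OF this d[unfolded has_field_derivative_def]] show ?thesis .
  qed
  have "partial_deriv j (\<lambda>x::real^'n. d n (c + s * x $ i)) =
      (\<lambda>x. (s * axis j 1 $ i) * d (Suc n) (c + s * x $ i))" for j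
    by (rule ext) (simp add: partial_deriv_eqI[OF D])
  moreover have "C_k k (\<lambda>x::real^'n. (s * axis j 1 $ i) * d (Suc n) (c + s * x $ i))" for j
    by (intro C_k_mult C_k_const Suc.IH)
  ultimately show ?case using D
    by (auto simp: differentiable_on_def differentiable_def)
qed

definition box_bump :: "real^'n::finite \<Rightarrow> real^'n \<Rightarrow> real^'n \<Rightarrow> real" where
  "box_bump a b x = (\<Prod>i\<in>UNIV. flat 0 (x $ i - a $ i) * flat 0 (b $ i - x $ i))"

lemma box_bump_pos: "x \<in> box a b \<Longrightarrow> box_bump a b x > 0"
  unfolding box_bump_def by (rule prod_pos) (auto simp: mem_box_cart flat_def)

lemma box_bump_zero: "x \<notin> box a b \<Longrightarrow> box_bump a b x = 0"
  unfolding box_bump_def by (auto simp: mem_box_cart flat_def)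

text \<open>The bump is positive exactly on the open box, so that these test functions increase to its indicator
  function as \<open>n\<close> grows. This is how test functions detect integrals over boxes.\<close>

lemma test_function_box:
  assumes "cbox a b \<subseteq> U"
  shows "test_function U (\<lambda>x. 1 - exp (- real n * box_bump a b x))"
proof -
  have 1: "C_k k (\<lambda>x::real^3. flat 0 (x $ i - a $ i))" for k i
    using C_k_coordinate[of flat, OF has_real_derivative_flat, where s=1 and c="- (a $ i)"] by simp
  have 2: "C_k k (\<lambda>x::real^3. flat 0 (b $ i - x $ i))" for k i
    using C_k_coordinate[of flat, OF has_real_derivative_flat, where s="-1" and c="b $ i"] by simp
  have "C_k k (\<lambda>x. 1 + (-1) * exp (- real n * box_bump a b x))" for k
    unfolding box_bump_def
    by (intro C_k_add C_k_const C_k_mult C_k_exp C_k_prod 1 2) simp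
  then have "C_infinity (\<lambda>x. 1 - exp (- real n * box_bump a b x))"
    by (simp add: C_infinity_def)
  moreover have "{x. 1 - exp (- real n * box_bump a b x) \<noteq> 0} \<subseteq> cbox a b"
  proof
    fix x assume "x \<in> {x. 1 - exp (- real n * box_bump a b x) \<noteq> 0}"
    then have "x \<in> box a b" using box_bump_zero by fastforce
    then show "x \<in> cbox a b" using box_subset_cbox by blast
  qed
  then have *: "closure {x. 1 - exp (- real n * box_bump a b x) \<noteq> 0} \<subseteq> cbox a b"
    by (rule closure_minimal) (rule closed_cbox)
  ultimately show ?thesis
    unfolding test_function_def
    using assms by (meson bounded_cbox bounded_subset closed_closure compact_eq_bounded_closed order_trans)
qed

lemma test_function_bounded:
  assumes "test_function U \<phi>"
  obtains C where "\<And>x. \<bar>\<phi> x\<bar> \<le> C" "C \<ge> 0"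
proof -
  let ?K = "closure {x. \<phi> x \<noteq> 0}"
  have "compact ?K" "continuous_on ?K \<phi>"
    using assms C_infinity_continuous continuous_on_subset unfolding test_function_def by blast+
  then have "bounded (\<phi> ` ?K)"
    using compact_continuous_image compact_imp_bounded by blast
  then obtain C where C: "\<And>x. x \<in> ?K \<Longrightarrow> \<bar>\<phi> x\<bar> \<le> C"
    unfolding bounded_iff by auto
  have "\<bar>\<phi> x\<bar> \<le> \<bar>C\<bar>" for x
  proof (cases "\<phi> x = 0")
    case False
    then have "x \<in> ?K" by (auto intro!: subsetD[OF closure_subset])
    then show ?thesis using C by fastforce
  qed simp
  then show ?thesis using that by (meson abs_ge_zero)
qed

lemma test_function_measurable [measurable_dest]:
  "test_function U \<phi> \<Longrightarrow> \<phi> \<in> borel_measurable borel"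
  unfolding test_function_def using C_infinity_continuous borel_measurable_continuous_onI by blast

lemma test_function_zero: "test_function U \<phi> \<Longrightarrow> x \<notin> U \<Longrightarrow> \<phi> x = 0"
  unfolding test_function_def using closure_subset[of "{x. \<phi> x \<noteq> 0}"] by auto

lemma test_function_partial:
  assumes "test_function U \<phi>"
  shows "test_function U (partial_deriv i \<phi>)"
proof -
  let ?K = "closure {x. \<phi> x \<noteq> 0}"
  have "partial_deriv i \<phi> x = 0" if "x \<notin> ?K" for x
  proof -
    have "((\<lambda>x. 0) has_derivative (\<lambda>h. 0)) (at x)"
      by simp
    then have "(\<phi> has_derivative (\<lambda>h. 0)) (at x)"
      by (rule has_derivative_transform_within_open[where s="- ?K"])
        (use that closure_subset[of "{x. \<phi> x \<noteq> 0}"] in auto)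
    then show ?thesis by (simp add: partial_deriv_eqI)
  qed
  then have "{x. partial_deriv i \<phi> x \<noteq> 0} \<subseteq> ?K" by blast
  then have "closure {x. partial_deriv i \<phi> x \<noteq> 0} \<subseteq> ?K"
    by (simp add: closure_minimal)
  then show ?thesis
    using assms C_infinity_partial unfolding test_function_def
    by (meson bounded_subset closed_closure compact_eq_bounded_closed order_trans)
qed

lemma test_function_multi_deriv:
  assumes "test_function U \<phi>"
  shows "test_function U (multi_deriv \<alpha> \<phi>)"
proof -
  have "test_function U ((partial_deriv j ^^ n) f)" if "test_function U f" for f j n
    using that by (induction n) (auto simp: test_function_partial)
  then show ?thesis using assms by (simp add: multi_deriv_def)
qed

lemma test_function_translate:
  assumes "test_function U \<phi>" "\<And>x. x \<in> U \<Longrightarrow> x + a \<in> V"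
  shows "test_function V (\<lambda>x. \<phi> (x - a))"
proof -
  have eq: "{x. \<phi> (x - a) \<noteq> 0} = (\<lambda>x. x + a) ` {x. \<phi> x \<noteq> 0}"
  proof (intro set_eqI iffI)
    fix x assume "x \<in> {x. \<phi> (x - a) \<noteq> 0}"
    then show "x \<in> (\<lambda>x. x + a) ` {x. \<phi> x \<noteq> 0}"
      by (intro image_eqI[where x="x - a"]) simp_all
  qed auto
  have cl: "closure {x. \<phi> (x - a) \<noteq> 0} = (\<lambda>x. x + a) ` closure {x. \<phi> x \<noteq> 0}"
    unfolding eq using closure_translation[of a "{x. \<phi> x \<noteq> 0}"] by (simp add: add.commute)
  have "C_infinity (\<lambda>x. \<phi> (x + (- a)))"
    using assms(1) C_k_translate(1)[of _ \<phi> "- a"] unfolding test_function_def C_infinity_def by blast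
  moreover have "compact (closure {x. \<phi> (x - a) \<noteq> 0})"
    unfolding cl using assms(1) compact_translation[of "closure {x. \<phi> x \<noteq> 0}" a]
    by (simp add: test_function_def add.commute)
  ultimately show ?thesis
    using assms unfolding test_function_def cl by auto
qed

lemma partial_deriv_translate:
  assumes "C_infinity \<phi>"
  shows "partial_deriv i (\<lambda>x. \<phi> (x - a)) = (\<lambda>x. partial_deriv i \<phi> (x - a))"
proof -
  have "C_k (Suc 0) \<phi>"
    using assms unfolding C_infinity_def by blast
  from C_k_translate(2)[OF this, of i "- a"] show ?thesis by simp
qed

section \<open>The fundamental lemma of the calculus of variations\<close>

lemma integrable_mult_bounded:
  fixes f \<phi> :: "'a \<Rightarrow> real"
  assumes "integrable M f" "\<phi> \<in> borel_measurable M" "\<And>x. \<bar>\<phi> x\<bar> \<le> C"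
  shows "integrable M (\<lambda>x. f x * \<phi> x)"
proof (rule Bochner_Integration.integrable_bound)
  show "integrable M (\<lambda>x. C * f x)"
    using assms(1) by simp
  show "(\<lambda>x. f x * \<phi> x) \<in> borel_measurable M"
    using assms(1,2) by measurable
  have "\<bar>f x\<bar> * \<bar>\<phi> x\<bar> \<le> \<bar>f x\<bar> * \<bar>C\<bar>" for x
    using assms(3)[of x] by (intro mult_left_mono) auto
  then show "AE x in M. norm (f x * \<phi> x) \<le> norm (C * f x)"
    by (simp add: abs_mult mult.commute)
qed

lemma integrable_test_function:
  assumes "integrable lborel u" "test_function U \<phi>"
  shows "integrable lborel (\<lambda>x. u x * \<phi> x)"
  using integrable_mult_bounded[OF assms(1)] assms(2)
  by (metis measurable_lborel2 test_function_bounded test_function_measurable)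

text \<open>Dominated convergence along the smooth approximations of the indicator function.\<close>

lemma integral_box_zero:
  fixes g :: "real^3 \<Rightarrow> real"
  assumes "integrable lborel g" "cbox a b \<subseteq> U"
    and zero: "\<And>\<phi>. test_function U \<phi> \<Longrightarrow> (\<integral>x. g x * \<phi> x \<partial>lborel) = 0"
  shows "(\<integral>x. g x * indicator (box a b) x \<partial>lborel) = 0"
proof -
  let ?\<psi> = "\<lambda>n x. 1 - exp (- real n * box_bump a b x)"
  have m: "?\<psi> n \<in> borel_measurable lborel" for n
    using test_function_measurable[OF test_function_box[OF assms(2)]] by simp
  have nonneg: "box_bump a b x \<ge> 0" for x
    using box_bump_pos box_bump_zero by (cases "x \<in> box a b") (fastforce intro: less_imp_le)+
  have "(\<lambda>n. \<integral>x. g x * ?\<psi> n x \<partial>lborel) \<longlonglongrightarrow> (\<integral>x. g x * indicator (box a b) x \<partial>lborel)"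
  proof (rule integral_dominated_convergence[where w="\<lambda>x. \<bar>g x\<bar>"])
    show "(\<lambda>x. g x * ?\<psi> n x) \<in> borel_measurable lborel" for n
      using assms(1) m[of n] by measurable
    show "(\<lambda>x. g x * indicator (box a b) x) \<in> borel_measurable lborel"
      using assms(1) by measurable
    have "(\<lambda>n. ?\<psi> n x) \<longlonglongrightarrow> indicator (box a b) x" for x
    proof (cases "x \<in> box a b")
      case True
      have "(\<lambda>n. exp (- box_bump a b x) ^ n) \<longlonglongrightarrow> 0"
        using box_bump_pos[OF True] by (intro LIMSEQ_power_zero) simp
      then have "(\<lambda>n. 1 - exp (- box_bump a b x) ^ n) \<longlonglongrightarrow> 1 - 0"
        by (intro tendsto_diff tendsto_const)
      then show ?thesis
        using True by (simp add: exp_of_nat_mult[symmetric])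
    next
      case False
      then show ?thesis by (simp add: box_bump_zero)
    qed
    then show "AE x in lborel. (\<lambda>n. g x * ?\<psi> n x) \<longlonglongrightarrow> g x * indicator (box a b) x"
      by (auto intro!: tendsto_mult)
    have "\<bar>?\<psi> n x\<bar> \<le> 1" for n x
      using nonneg[of x] by (simp add: abs_le_iff)
    then show "AE x in lborel. norm (g x * ?\<psi> n x) \<le> \<bar>g x\<bar>" for n
      by (intro AE_I2) (simp add: abs_mult mult_left_le)
  qed (use assms(1) in simp)
  moreover have "(\<integral>x. g x * ?\<psi> n x \<partial>lborel) = 0" for n
    by (rule zero[OF test_function_box[OF assms(2)]])
  ultimately show ?thesis
    by (simp add: LIMSEQ_const_iff)
qed

text \<open>The open boxes form an intersection-stable generator of the Borel sets, so that the integral of \<open>g\<close>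
  vanishes over every Borel subset of the box. The restriction to a box with closure in \<open>U\<close> makes the
  integral over the whole space available, as the step for complements requires.\<close>

lemma AE_zero_on_box:
  fixes g :: "real^3 \<Rightarrow> real"
  assumes g: "integrable lborel g" and sub: "cbox c d \<subseteq> U"
    and zero: "\<And>\<phi>. test_function U \<phi> \<Longrightarrow> (\<integral>x. g x * \<phi> x \<partial>lborel) = 0"
  shows "AE x in lborel. x \<in> box c d \<longrightarrow> g x = 0"
proof -
  define h where "h x = g x * indicator (box c d) x" for x
  have h: "integrable lborel h"
    unfolding h_def using integrable_mult_indicator[OF _ g, of "box c d"] by (simp add: mult.commute)
  have h0: "(\<integral>x. h x \<partial>lborel) = 0"
    unfolding h_def by (rule integral_box_zero[OF g sub zero])
  let ?G = "range (\<lambda>(a, b). box a b :: (real^3) set)"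
  have "AE x in lborel. h x = 0"
  proof (rule sigma_finite_measure.density_zero[OF sigma_finite_lborel h])
    fix A :: "(real^3) set"
    assume "A \<in> sets lborel"
    then have A: "A \<in> sigma_sets UNIV ?G"
      by (simp add: borel_eq_box)
    have stable: "Int_stable ?G"
      by (auto simp: Int_stable_def box_Int_box)
    have meas: "B \<in> sets lborel" if "B \<in> sigma_sets UNIV ?G" for B
      using that by (simp add: borel_eq_box)
    have si: "set_integrable lborel B h" if "B \<in> sets lborel" for B
      using that h unfolding set_integrable_def by (rule integrable_mult_indicator)
    have pow: "?G \<subseteq> Pow UNIV"
      by simp
    from stable pow A show "set_lebesgue_integral lborel A h = 0"
    proof (induction rule: sigma_sets_induct_disjoint)
      case (basic B)
      then obtain a b where B: "B = box a b" by auto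
      obtain e f where ef: "box a b \<inter> box c d = box e f"
        using box_Int_box by blast
      show ?case
      proof (cases "box e f = {}")
        case True
        have "indicator B x *\<^sub>R h x = 0" for x
          using ef True by (auto simp: B h_def indicator_def)
        then show ?thesis
          unfolding set_lebesgue_integral_def by (simp only: Bochner_Integration.integral_zero)
      next
        case False
        have "cbox e f = closure (box e f)"
          using False by (simp add: closure_box)
        also have "\<dots> \<subseteq> closure (box c d)"
          unfolding ef[symmetric] by (rule closure_mono) blast
        also have "\<dots> \<subseteq> cbox c d"
          by (rule closure_minimal[OF box_subset_cbox closed_cbox])
        finally have "cbox e f \<subseteq> U" using sub by blast
        then have "(\<integral>x. g x * indicator (box e f) x \<partial>lborel) = 0"
          by (rule integral_box_zero[OF g _ zero])
        moreover have "indicator B x *\<^sub>R h x = g x * indicator (box e f) x" for x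
          unfolding ef[symmetric] by (auto simp: B h_def indicator_def)
        ultimately show ?thesis by (simp add: set_lebesgue_integral_def)
      qed
    next
      case empty
      then show ?case by (simp add: set_lebesgue_integral_def)
    next
      case (compl B)
      have "(LINT x:B \<union> (UNIV - B)|lborel. h x) = (LINT x:B|lborel. h x) + (LINT x:UNIV - B|lborel. h x)"
        by (rule set_integral_Un) (use meas[OF compl(1)] in \<open>auto intro!: si\<close>)
      moreover have "(LINT x:B \<union> (UNIV - B)|lborel. h x) = 0"
        using h0 by (simp add: set_lebesgue_integral_def)
      ultimately show ?case using compl(2) by simp
    next
      case (union B)
      have B: "\<And>i. B i \<in> sets lborel"
        using union(2) meas by blast
      then have "(LINT x:(\<Union>i. B i)|lborel. h x) = (\<Sum>i. LINT x:B i|lborel. h x)"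
        by (intro lebesgue_integral_countable_add si)
          (use union(1) in \<open>auto simp: disjoint_family_on_def\<close>)
      then show ?case using union(3) by simp
    qed
  qed
  then show ?thesis by eventually_elim (auto simp: h_def)
qed

lemma fundamental_lemma:
  fixes g :: "real^3 \<Rightarrow> real"
  assumes "open U" and g: "integrable lborel g"
    and zero: "\<And>\<phi>. test_function U \<phi> \<Longrightarrow> (\<integral>x. g x * \<phi> x \<partial>lborel) = 0"
  shows "AE x in lborel. x \<in> U \<longrightarrow> g x = 0"
proof -
  obtain \<D> where \<D>: "countable \<D>" "\<D> \<subseteq> Pow U" "\<And>X. X \<in> \<D> \<Longrightarrow> \<exists>a b. X = cbox a b" "\<Union>\<D> = U"
    using open_countable_Union_open_cbox[OF \<open>open U\<close>] by metis
  have "AE x in lborel. x \<in> X \<longrightarrow> g x = 0" if "X \<in> \<D>" for X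
  proof -
    from \<D>(3)[OF that] obtain a b where X: "X = cbox a b" by blast
    with \<D>(2) that have "cbox a b \<subseteq> U" by auto
    then have "AE x in lborel. x \<in> box a b \<longrightarrow> g x = 0"
      by (rule AE_zero_on_box[OF g _ zero])
    with AE_not_in[OF null_sets_cbox_Diff_box[of a b]]
    show ?thesis unfolding X by eventually_elim auto
  qed
  then have "AE x in lborel. \<forall>X\<in>\<D>. x \<in> X \<longrightarrow> g x = 0"
    unfolding AE_ball_countable[OF \<D>(1)] by blast
  then show ?thesis
    unfolding \<D>(4)[symmetric] by eventually_elim auto
qed

section \<open>Translations and integrals over segments\<close>

lemma lborel_translate:
  fixes f :: "'a::euclidean_space \<Rightarrow> real" and k :: "'a \<Rightarrow> ennreal"
  assumes [measurable]: "f \<in> borel_measurable borel" "k \<in> borel_measurable borel"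
  shows "(\<integral>x. f (x + a) \<partial>lborel) = (\<integral>x. f x \<partial>lborel)"
    and "integrable lborel (\<lambda>x. f (x + a)) \<longleftrightarrow> integrable lborel f"
    and "(\<integral>\<^sup>+x. k (x + a) \<partial>lborel) = (\<integral>\<^sup>+x. k x \<partial>lborel)"
proof -
  have d: "(lborel :: 'a measure) = distr lborel borel (\<lambda>x. x + a)"
    using lborel_distr_plus[of a, symmetric] unfolding add.commute[of a, abs_def] .
  show "(\<integral>x. f (x + a) \<partial>lborel) = (\<integral>x. f x \<partial>lborel)"
    by (subst (2) d) (simp add: integral_distr)
  show "integrable lborel (\<lambda>x. f (x + a)) \<longleftrightarrow> integrable lborel f"
    by (subst (2) d) (simp add: integrable_distr_eq)
  show "(\<integral>\<^sup>+x. k (x + a) \<partial>lborel) = (\<integral>\<^sup>+x. k x \<partial>lborel)"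
    by (subst (2) d) (simp add: nn_integral_distr)
qed

text \<open>Lebesgue measure on the segment \<open>[0, h]\<close>, kept on the Borel sets of the whole line so that
  joint measurability needs no restriction.\<close>

definition seg :: "real \<Rightarrow> real measure" where
  "seg h = density lborel (indicator {0..h})"

lemma sets_seg [simp, measurable_cong]: "sets (seg h) = sets borel"
  by (simp add: seg_def)

lemma space_seg [simp]: "space (seg h) = UNIV"
  by (simp add: seg_def)

lemma finite_measure_seg: "finite_measure (seg h)"
proof (rule finite_measureI)
  have "emeasure (seg h) (space (seg h)) = emeasure lborel {0..h}"
    by (simp add: seg_def emeasure_density)
  then show "emeasure (seg h) (space (seg h)) \<noteq> \<infinity>"
    by (simp add: emeasure_lborel_Icc_eq)
qed

lemma AE_seg: "(AE t in seg h. P t) \<longleftrightarrow> (AE t in lborel. t \<in> {0..h} \<longrightarrow> P t)"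
  unfolding seg_def by (subst AE_density) (auto simp: indicator_def)

lemma AE_segI: "(\<And>t. t \<in> {0..h} \<Longrightarrow> P t) \<Longrightarrow> AE t in seg h. P t"
  by (simp add: AE_seg)

lemma AE_seg_neq: "AE t in seg h. t \<noteq> s"
  unfolding AE_seg using AE_lborel_singleton[of s] by eventually_elim auto

lemma integral_seg:
  fixes f :: "real \<Rightarrow> real"
  assumes "f \<in> borel_measurable borel"
  shows "(\<integral>t. f t \<partial>seg h) = (\<integral>t. indicator {0..h} t *\<^sub>R f t \<partial>lborel)"
  unfolding seg_def using assms
  by (subst integral_density[where g="indicator {0..h}", symmetric]) (auto simp: ennreal_indicator)

lemma integrable_seg:
  fixes f :: "real \<Rightarrow> real"
  assumes "f \<in> borel_measurable borel"
  shows "integrable (seg h) f \<longleftrightarrow> integrable lborel (\<lambda>t. indicator {0..h} t *\<^sub>R f t)"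
proof -
  have "seg h = density lborel (\<lambda>t. ennreal (indicator {0..h} t))"
    by (simp add: seg_def ennreal_indicator)
  then show ?thesis using assms by (simp add: integrable_density)
qed

lemma integral_seg_shorter:
  fixes f :: "real \<Rightarrow> real"
  assumes [measurable]: "f \<in> borel_measurable borel" and "s \<le> h"
  shows "(\<integral>t. f t \<partial>seg s) = (\<integral>t. (if t \<le> s then f t else 0) \<partial>seg h)"
proof -
  have "indicator {0..s} t *\<^sub>R f t = indicator {0..h} t *\<^sub>R (if t \<le> s then f t else 0)" for t
    using assms(2) by (auto simp: indicator_def)
  then show ?thesis by (simp add: integral_seg)
qed

lemma sigma_finite_seg: "sigma_finite_measure (seg h)"
proof -
  interpret finite_measure "seg h" by (rule finite_measure_seg)
  show ?thesis by unfold_locales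
qed

lemma pair_lborel_seg:
  "pair_sigma_finite (lborel :: 'a::euclidean_space measure) (seg h)"
  "pair_sigma_finite (seg h) (lborel :: 'a::euclidean_space measure)"
  "pair_sigma_finite (seg h) (seg k)"
  by (simp_all add: pair_sigma_finite_def sigma_finite_lborel sigma_finite_seg)

lemma integrable_pair_translate:
  fixes G :: "'a::euclidean_space \<Rightarrow> real" and \<psi> :: "'a \<Rightarrow> real \<Rightarrow> real"
  assumes G: "integrable lborel G"
    and [measurable]: "(\<lambda>(x, t). \<psi> x t) \<in> borel_measurable (borel \<Otimes>\<^sub>M borel)"
    and C: "\<And>x t. \<bar>\<psi> x t\<bar> \<le> C"
  shows "integrable (lborel \<Otimes>\<^sub>M seg h) (\<lambda>(x, t). G (x + t *\<^sub>R w) * \<psi> x t)"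
proof -
  interpret pair_sigma_finite "seg h" "lborel :: 'a measure" by (rule pair_lborel_seg)
  interpret N: finite_measure "seg h" by (rule finite_measure_seg)
  have Gm [measurable]: "G \<in> borel_measurable borel"
    using borel_measurable_integrable[OF G] by simp
  have shift: "integrable lborel (\<lambda>x. G (x + t *\<^sub>R w))" for t
    using G lborel_translate(2)[OF Gm, of "\<lambda>_. 0" "t *\<^sub>R w"] by simp
  have "integrable (seg h \<Otimes>\<^sub>M lborel) (\<lambda>(t, x). G (x + t *\<^sub>R w))"
  proof (rule Fubini_integrable)
    have "(\<integral>x. norm (G (x + t *\<^sub>R w)) \<partial>lborel) = (\<integral>x. norm (G x) \<partial>lborel)" for t
      by (rule lborel_translate(1)[where k="\<lambda>_. 0"]) measurable
    then show "integrable (seg h) (\<lambda>t. \<integral>x. norm (case (t, x) of (t, x) \<Rightarrow> G (x + t *\<^sub>R w)) \<partial>lborel)"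
      by simp
  qed (use shift in auto)
  then have "integrable (seg h \<Otimes>\<^sub>M lborel) (\<lambda>z. (case z of (t, x) \<Rightarrow> G (x + t *\<^sub>R w)) * (case z of (t, x) \<Rightarrow> \<psi> x t))"
    by (rule integrable_mult_bounded[where C=C]) (use C in auto)
  from integrable_product_swap[OF this] show ?thesis
    by (simp add: case_prod_unfold)
qed

lemma Fubini_seg:
  fixes f :: "'a::euclidean_space \<Rightarrow> real \<Rightarrow> real"
  assumes "integrable (lborel \<Otimes>\<^sub>M seg h) (\<lambda>(x, t). f x t)"
  shows "(\<integral>x. (\<integral>t. f x t \<partial>seg h) \<partial>lborel) = (\<integral>t. (\<integral>x. f x t \<partial>lborel) \<partial>seg h)"
    and "integrable lborel (\<lambda>x. \<integral>t. f x t \<partial>seg h)"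
    and "AE x in lborel. integrable (seg h) (f x)"
proof -
  interpret pair_sigma_finite "lborel :: 'a measure" "seg h" by (rule pair_lborel_seg)
  show "(\<integral>x. (\<integral>t. f x t \<partial>seg h) \<partial>lborel) = (\<integral>t. (\<integral>x. f x t \<partial>lborel) \<partial>seg h)"
    using Fubini_integral[OF assms] by simp
  show "integrable lborel (\<lambda>x. \<integral>t. f x t \<partial>seg h)"
    using integrable_fst[OF assms] by simp
  show "AE x in lborel. integrable (seg h) (f x)"
    using AE_integrable_fst[OF assms] by simp
qed

section \<open>Weak directional derivatives and difference quotients\<close>

definition dir_deriv :: "real^3 \<Rightarrow> (real^3 \<Rightarrow> real) \<Rightarrow> real^3 \<Rightarrow> real" where
  "dir_deriv w \<phi> x = (\<Sum>i\<in>UNIV. w $ i * partial_deriv i \<phi> x)"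

text \<open>The integrals extend over the whole space: \<open>u\<close> and \<open>g\<close> will be Borel functions that vanish outside
  \<open>\<Omega>\<close>, so that translations need no care for domains of integration.\<close>

definition weak_dir :: "(real^3) set \<Rightarrow> real^3 \<Rightarrow> (real^3 \<Rightarrow> real) \<Rightarrow> (real^3 \<Rightarrow> real) \<Rightarrow> bool" where
  "weak_dir \<Omega> w u g \<longleftrightarrow> (\<forall>\<phi>. test_function \<Omega> \<phi> \<longrightarrow>
     (\<integral>x. u x * dir_deriv w \<phi> x \<partial>lborel) = - (\<integral>x. g x * \<phi> x \<partial>lborel))"

lemma dir_deriv_bounded:
  assumes "test_function U \<phi>"
  obtains C where "\<And>x. \<bar>dir_deriv w \<phi> x\<bar> \<le> C"
proof -
  have "\<exists>C. \<forall>x. \<bar>partial_deriv i \<phi> x\<bar> \<le> C" for i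
    using test_function_bounded[OF test_function_partial[OF assms]] by metis
  then obtain C where C: "\<And>i x. \<bar>partial_deriv i \<phi> x\<bar> \<le> C i" by metis
  have "\<bar>dir_deriv w \<phi> x\<bar> \<le> (\<Sum>i\<in>UNIV. \<bar>w $ i\<bar> * C i)" for x
    unfolding dir_deriv_def using C
    by (intro order_trans[OF sum_abs] sum_mono) (simp add: abs_mult mult_left_mono)
  then show ?thesis using that by blast
qed

lemma dir_deriv_continuous:
  assumes "test_function U \<phi>"
  shows "continuous_on UNIV (dir_deriv w \<phi>)"
  using assms C_infinity_continuous C_infinity_partial unfolding test_function_def dir_deriv_def
  by (intro continuous_intros) blast

lemma dir_deriv_measurable [measurable_dest]:
  "test_function U \<phi> \<Longrightarrow> dir_deriv w \<phi> \<in> borel_measurable borel"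
  using dir_deriv_continuous borel_measurable_continuous_onI by blast

lemma dir_deriv_translate:
  "C_infinity \<phi> \<Longrightarrow> dir_deriv w (\<lambda>x. \<phi> (x - a)) = (\<lambda>x. dir_deriv w \<phi> (x - a))"
  by (simp add: dir_deriv_def partial_deriv_translate fun_eq_iff)

lemma dir_deriv_axis: "dir_deriv (axis i 1) \<phi> = partial_deriv i \<phi>"
  by (simp add: dir_deriv_def sum_axis_mult fun_eq_iff)

lemma segment_integral_dir_deriv:
  assumes "test_function U \<phi>" "h \<ge> 0"
  shows "\<phi> (y - h *\<^sub>R w) - \<phi> y = - (\<integral>t. dir_deriv w \<phi> (y - t *\<^sub>R w) \<partial>seg h)"
proof -
  have D: "((\<lambda>t. \<phi> (y - t *\<^sub>R w)) has_real_derivative - dir_deriv w \<phi> (y - t *\<^sub>R w)) (at t)" for t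
    using has_real_derivative_line[of \<phi> y t "- w", OF C_infinity_differentiable] assms(1)
    by (simp add: test_function_def dir_deriv_def sum_negf)
  have cont: "continuous_on A (\<lambda>t. dir_deriv w \<phi> (y - t *\<^sub>R w))" for A
    by (rule continuous_on_compose2[OF dir_deriv_continuous[OF assms(1)]])
      (auto intro!: continuous_intros)
  have "(\<integral>t. indicator {0..h} t *\<^sub>R (- dir_deriv w \<phi> (y - t *\<^sub>R w)) \<partial>lborel)
      = \<phi> (y - h *\<^sub>R w) - \<phi> (y - 0 *\<^sub>R w)"
    using D cont
    by (intro integral_FTC_atLeastAtMost assms(2) continuous_intros)
      (auto simp: has_real_derivative_iff_has_vector_derivative intro: has_vector_derivative_at_within)
  moreover have "(\<integral>t. dir_deriv w \<phi> (y - t *\<^sub>R w) \<partial>seg h)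
      = (\<integral>t. indicator {0..h} t *\<^sub>R dir_deriv w \<phi> (y - t *\<^sub>R w) \<partial>lborel)"
    using cont by (intro integral_seg borel_measurable_continuous_onI)
  ultimately show ?thesis by simp
qed

lemma integrable_pair_test:
  fixes G \<psi> :: "real^3 \<Rightarrow> real"
  assumes G: "integrable lborel G" and \<psi>: "\<psi> \<in> borel_measurable borel" "\<And>x. \<bar>\<psi> x\<bar> \<le> C"
  shows "integrable (lborel \<Otimes>\<^sub>M seg h) (\<lambda>(x, t). G x * \<psi> (x - t *\<^sub>R w))"
    and "integrable (lborel \<Otimes>\<^sub>M seg h) (\<lambda>(x, t). G (x + t *\<^sub>R w) * \<psi> x)"
proof -
  note [measurable] = \<psi>(1)
  show "integrable (lborel \<Otimes>\<^sub>M seg h) (\<lambda>(x, t). G x * \<psi> (x - t *\<^sub>R w))"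
    using integrable_pair_translate[OF G, of "\<lambda>x t. \<psi> (x - t *\<^sub>R w)" C h 0] \<psi>(2) by simp
  show "integrable (lborel \<Otimes>\<^sub>M seg h) (\<lambda>(x, t). G (x + t *\<^sub>R w) * \<psi> x)"
    using integrable_pair_translate[OF G, of "\<lambda>x t. \<psi> x" C h w] \<psi>(2) by simp
qed

text \<open>Translating the test function instead of \<open>F\<close> turns a difference of \<open>F\<close> into an integral of \<open>F\<close> against
  classical derivatives; the next lemma undoes the translation once the derivative has been moved to \<open>F\<close>.\<close>

lemma integral_difference_test:
  assumes F: "integrable lborel F" and \<phi>: "test_function U \<phi>" and h: "h \<ge> 0"
  shows "(\<integral>x. (F (x + h *\<^sub>R w) - F x) * \<phi> x \<partial>lborel)
       = - (\<integral>t. (\<integral>y. F y * dir_deriv w \<phi> (y - t *\<^sub>R w) \<partial>lborel) \<partial>seg h)"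
proof -
  note [measurable] = borel_measurable_integrable[OF F, simplified] test_function_measurable[OF \<phi>]
  obtain C where C: "\<And>x. \<bar>\<phi> x\<bar> \<le> C" using test_function_bounded[OF \<phi>] by blast
  obtain D where D: "\<And>x. \<bar>dir_deriv w \<phi> x\<bar> \<le> D" using dir_deriv_bounded[OF \<phi>] by blast
  have Fs: "integrable lborel (\<lambda>x. F (x + h *\<^sub>R w))"
    using F lborel_translate(2)[of F "\<lambda>_. 0"] by simp
  have i1: "integrable lborel (\<lambda>x. F (x + h *\<^sub>R w) * \<phi> x)" "integrable lborel (\<lambda>x. F x * \<phi> x)"
    by (rule integrable_test_function[OF Fs \<phi>] integrable_test_function[OF F \<phi>])+
  have i2: "integrable lborel (\<lambda>x. F x * \<phi> (x - h *\<^sub>R w))"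
    by (rule integrable_mult_bounded[OF F _ C]) measurable
  have "(\<integral>x. (F (x + h *\<^sub>R w) - F x) * \<phi> x \<partial>lborel)
      = (\<integral>x. F (x + h *\<^sub>R w) * \<phi> x \<partial>lborel) - (\<integral>x. F x * \<phi> x \<partial>lborel)"
    using i1 by (simp add: left_diff_distrib)
  also have "(\<integral>x. F (x + h *\<^sub>R w) * \<phi> x \<partial>lborel) = (\<integral>x. F x * \<phi> (x - h *\<^sub>R w) \<partial>lborel)"
    using lborel_translate(1)[of "\<lambda>x. F x * \<phi> (x - h *\<^sub>R w)" "\<lambda>_. 0" "h *\<^sub>R w"] by simp
  also have "\<dots> - (\<integral>x. F x * \<phi> x \<partial>lborel) = (\<integral>x. F x * (\<phi> (x - h *\<^sub>R w) - \<phi> x) \<partial>lborel)"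
    using i1 i2 by (simp add: right_diff_distrib)
  also have "\<dots> = - (\<integral>x. (\<integral>t. F x * dir_deriv w \<phi> (x - t *\<^sub>R w) \<partial>seg h) \<partial>lborel)"
    by (simp add: segment_integral_dir_deriv[OF \<phi> h])
  also have "(\<integral>x. (\<integral>t. F x * dir_deriv w \<phi> (x - t *\<^sub>R w) \<partial>seg h) \<partial>lborel)
      = (\<integral>t. (\<integral>x. F x * dir_deriv w \<phi> (x - t *\<^sub>R w) \<partial>lborel) \<partial>seg h)"
    by (rule Fubini_seg(1)[OF integrable_pair_test(1)[OF F dir_deriv_measurable[OF \<phi>] D]])
  finally show ?thesis .
qed

lemma integral_segment_test:
  assumes G: "integrable lborel G" and \<phi>: "test_function U \<phi>"
  shows "(\<integral>t. (\<integral>y. G y * \<phi> (y - t *\<^sub>R w) \<partial>lborel) \<partial>seg h)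
       = (\<integral>x. (\<integral>t. G (x + t *\<^sub>R w) \<partial>seg h) * \<phi> x \<partial>lborel)"
proof -
  note [measurable] = borel_measurable_integrable[OF G, simplified] test_function_measurable[OF \<phi>]
  obtain C where C: "\<And>x. \<bar>\<phi> x\<bar> \<le> C" using test_function_bounded[OF \<phi>] by blast
  have "(\<integral>y. G y * \<phi> (y - t *\<^sub>R w) \<partial>lborel) = (\<integral>x. G (x + t *\<^sub>R w) * \<phi> x \<partial>lborel)" for t
    using lborel_translate(1)[of "\<lambda>x. G x * \<phi> (x - t *\<^sub>R w)" "\<lambda>_. 0" "t *\<^sub>R w"] by simp
  then show ?thesis
    using Fubini_seg(1)[OF integrable_pair_test(2)[OF G test_function_measurable[OF \<phi>] C, of h w]] by simp
qed

lemma integrable_segment_integral: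
  assumes G: "integrable lborel (G :: real^3 \<Rightarrow> real)"
  shows "integrable lborel (\<lambda>x. \<integral>t. G (x + t *\<^sub>R w) \<partial>seg h)"
    and "AE x in lborel. integrable (seg h) (\<lambda>t. G (x + t *\<^sub>R w))"
  using Fubini_seg(2,3)[OF integrable_pair_test(2)[OF G, of "\<lambda>_. 1" 1 h w, simplified]] .

text \<open>Testing the difference \<open>u (x + h w) - u x\<close> against \<open>\<phi>\<close> moves the translation to \<open>\<phi>\<close>, where the
  fundamental theorem of calculus is classical. The translates of \<open>\<phi>\<close> along the segments remain test
  functions on \<open>\<Omega>\<close>, so that the derivative can be moved back to \<open>u\<close>.\<close>

theorem weak_dir_difference:
  assumes u: "integrable lborel u" and g: "integrable lborel g"
    and wd: "weak_dir \<Omega> w u g"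
    and U: "open U" "\<And>x t. x \<in> U \<Longrightarrow> t \<in> {0..h} \<Longrightarrow> x + t *\<^sub>R w \<in> \<Omega>" and h: "h \<ge> 0"
  shows "AE x in lborel. x \<in> U \<longrightarrow> u (x + h *\<^sub>R w) - u x = (\<integral>t. g (x + t *\<^sub>R w) \<partial>seg h)"
proof -
  note [measurable] = borel_measurable_integrable[OF u, simplified] borel_measurable_integrable[OF g, simplified]
  let ?d = "\<lambda>x. (u (x + h *\<^sub>R w) - u x) - (\<integral>t. g (x + t *\<^sub>R w) \<partial>seg h)"
  have us: "integrable lborel (\<lambda>x. u (x + h *\<^sub>R w))"
    using u lborel_translate(2)[of u "\<lambda>_. 0"] by simp
  have i1: "integrable lborel (\<lambda>x. u (x + h *\<^sub>R w) - u x)"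
    using us u by simp
  note i2 = integrable_segment_integral(1)[OF g, of h w]
  have "AE x in lborel. x \<in> U \<longrightarrow> ?d x = 0"
  proof (rule fundamental_lemma[OF U(1)])
    show "integrable lborel ?d" using i1 i2 by simp
    fix \<phi> assume \<phi>: "test_function U \<phi>"
    have "(\<integral>y. u y * dir_deriv w \<phi> (y - t *\<^sub>R w) \<partial>lborel) = - (\<integral>y. g y * \<phi> (y - t *\<^sub>R w) \<partial>lborel)"
      if "t \<in> {0..h}" for t
    proof -
      have "test_function \<Omega> (\<lambda>y. \<phi> (y - t *\<^sub>R w))"
        using test_function_translate[OF \<phi>] U(2) that by blast
      with wd have "(\<integral>y. u y * dir_deriv w (\<lambda>y. \<phi> (y - t *\<^sub>R w)) y \<partial>lborel) = - (\<integral>y. g y * \<phi> (y - t *\<^sub>R w) \<partial>lborel)"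
        unfolding weak_dir_def by blast
      then show ?thesis
        using \<phi> by (simp add: dir_deriv_translate test_function_def)
    qed
    moreover note [measurable] = test_function_measurable[OF \<phi>] dir_deriv_measurable[OF \<phi>, of w]
    ultimately have "(\<integral>t. (\<integral>y. u y * dir_deriv w \<phi> (y - t *\<^sub>R w) \<partial>lborel) \<partial>seg h)
        = (\<integral>t. - (\<integral>y. g y * \<phi> (y - t *\<^sub>R w) \<partial>lborel) \<partial>seg h)"
      by (intro integral_cong_AE AE_segI) auto
    then have "(\<integral>x. (u (x + h *\<^sub>R w) - u x) * \<phi> x \<partial>lborel)
        = (\<integral>x. (\<integral>t. g (x + t *\<^sub>R w) \<partial>seg h) * \<phi> x \<partial>lborel)"
      by (simp add: integral_difference_test[OF u \<phi> h] integral_segment_test[OF g \<phi>])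
    then show "(\<integral>x. ?d x * \<phi> x \<partial>lborel) = 0"
      using integrable_test_function[OF i1 \<phi>] integrable_test_function[OF i2 \<phi>]
      by (simp add: left_diff_distrib[of "u _ - u _"])
  qed
  then show ?thesis by simp
qed

lemma continuous_integral_translate:
  fixes F \<psi> :: "real^3 \<Rightarrow> real"
  assumes F: "integrable lborel F" and \<psi>: "continuous_on UNIV \<psi>" "\<And>x. \<bar>\<psi> x\<bar> \<le> C"
  shows "continuous_on A (\<lambda>t. \<integral>y. F y * \<psi> (y - t *\<^sub>R w) \<partial>lborel)"
  unfolding continuous_on_sequentially
proof (intro allI ballI impI, elim conjE)
  fix T :: "nat \<Rightarrow> real" and t assume "T \<longlonglongrightarrow> t"
  note [measurable] = borel_measurable_integrable[OF F, simplified] borel_measurable_continuous_onI[OF \<psi>(1)]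
  have "(\<lambda>n. \<integral>y. F y * \<psi> (y - T n *\<^sub>R w) \<partial>lborel) \<longlonglongrightarrow> (\<integral>y. F y * \<psi> (y - t *\<^sub>R w) \<partial>lborel)"
  proof (rule integral_dominated_convergence[where w="\<lambda>y. \<bar>F y\<bar> * C"])
    have "isCont \<psi> x" for x
      using \<psi>(1) by (simp add: continuous_on_eq_continuous_at)
    then have "(\<lambda>n. \<psi> (y - T n *\<^sub>R w)) \<longlonglongrightarrow> \<psi> (y - t *\<^sub>R w)" for y
      by (rule isCont_tendsto_compose) (intro tendsto_intros \<open>T \<longlonglongrightarrow> t\<close>)
    then show "AE y in lborel. (\<lambda>n. F y * \<psi> (y - T n *\<^sub>R w)) \<longlonglongrightarrow> F y * \<psi> (y - t *\<^sub>R w)"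
      by (intro AE_I2 tendsto_intros)
    show "AE y in lborel. norm (F y * \<psi> (y - T n *\<^sub>R w)) \<le> \<bar>F y\<bar> * C" for n
      using \<psi>(2) by (intro AE_I2) (simp add: abs_mult mult_left_mono)
  qed (use F in auto)
  then show "((\<lambda>t. \<integral>y. F y * \<psi> (y - t *\<^sub>R w) \<partial>lborel) \<circ> T) \<longlonglongrightarrow> (\<integral>y. F y * \<psi> (y - t *\<^sub>R w) \<partial>lborel)"
    by (simp add: o_def)
qed

text \<open>The value \<open>k 0\<close> is the right derivative at \<open>0\<close> of the indefinite integral, which vanishes near \<open>0\<close>.\<close>

lemma continuous_zero_if_segment_integrals_zero:
  fixes k :: "real \<Rightarrow> real"
  assumes k: "continuous_on UNIV k" and "\<delta> > 0"
    and zero: "\<And>h. 0 \<le> h \<Longrightarrow> h \<le> \<delta> \<Longrightarrow> (\<integral>t. k t \<partial>seg h) = 0"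
  shows "k 0 = 0"
proof -
  have "integral {0..h} k = 0" if "h \<in> {0..\<delta>}" for h
  proof -
    have "set_integrable lborel {0..h} k"
      by (rule borel_integrable_atLeastAtMost') (rule continuous_on_subset[OF k], simp)
    then have "integral {0..h} k = (\<integral>t. indicator {0..h} t *\<^sub>R k t \<partial>lborel)"
      using set_borel_integral_eq_integral(2) unfolding set_lebesgue_integral_def by metis
    then show ?thesis
      using zero[of h] that k by (simp add: integral_seg borel_measurable_continuous_onI)
  qed
  then have zero': "0 = integral {0..h} k" if "h \<in> {0..\<delta>}" for h
    using that by simp
  have "((\<lambda>h. integral {0..h} k) has_vector_derivative k 0) (at 0 within {0..\<delta>})"
    using \<open>\<delta> > 0\<close> by (intro integral_has_vector_derivative continuous_on_subset[OF k]) auto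
  from has_vector_derivative_transform[OF _ zero' this]
  have "((\<lambda>h. 0) has_vector_derivative k 0) (at 0 within {0..\<delta>})"
    using \<open>\<delta> > 0\<close> by simp
  moreover have "((\<lambda>h. 0 :: real) has_vector_derivative 0) (at 0 within {0..\<delta>})"
    by simp
  ultimately show ?thesis
    using \<open>\<delta> > 0\<close> by (intro vector_derivative_unique_within_closed_interval[of 0 \<delta> 0 "\<lambda>h. 0"]) auto
qed

text \<open>The converse: both sides of the integrated identity are integrals over \<open>[0, h]\<close> of continuous
  functions of \<open>t\<close>, whose values at \<open>t = 0\<close> are the two sides of the definition of a weak
  derivative.\<close>

theorem weak_dir_if_difference:
  assumes F: "integrable lborel F" and G: "integrable lborel G" and \<Omega>: "open \<Omega>"
    and diff: "\<And>U h. open U \<Longrightarrow> h \<ge> 0 \<Longrightarrow> (\<And>x t. x \<in> U \<Longrightarrow> t \<in> {0..h} \<Longrightarrow> x + t *\<^sub>R w \<in> \<Omega>) \<Longrightarrow>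
       AE x in lborel. x \<in> U \<longrightarrow> F (x + h *\<^sub>R w) - F x = (\<integral>t. G (x + t *\<^sub>R w) \<partial>seg h)"
  shows "weak_dir \<Omega> w F G"
  unfolding weak_dir_def
proof (intro allI impI)
  fix \<phi> assume \<phi>: "test_function \<Omega> \<phi>"
  note [measurable] = borel_measurable_integrable[OF F, simplified] borel_measurable_integrable[OF G, simplified]
    test_function_measurable[OF \<phi>]
  let ?K = "closure {x. \<phi> x \<noteq> 0}"
  obtain \<epsilon> where \<epsilon>: "\<epsilon> > 0" "(\<Union>x\<in>?K. cball x \<epsilon>) \<subseteq> \<Omega>"
    using compact_subset_open_imp_cball_epsilon_subset[of ?K \<Omega>] \<phi> \<Omega> unfolding test_function_def by blast
  \<comment> \<open>A neighbourhood \<open>U\<close> of the support and a length \<open>\<delta>\<close> for which all segments from \<open>U\<close> stay in \<open>\<Omega>\<close>.\<close>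
  define U where "U = (\<Union>x\<in>?K. ball x (\<epsilon> / 2))"
  define \<delta> where "\<delta> = \<epsilon> / (2 * (norm w + 1))"
  have \<delta>: "\<delta> > 0" "\<delta> * norm w \<le> \<epsilon> / 2"
    using \<epsilon>(1) by (auto simp: \<delta>_def field_simps add_pos_nonneg)
  have U: "open U" by (auto simp: U_def)
  have KU: "?K \<subseteq> U" using \<epsilon>(1) by (auto simp: U_def)
  have test_U: "\<phi> x = 0" if "x \<notin> U" for x
    using that KU closure_subset[of "{x. \<phi> x \<noteq> 0}"] by auto
  have inside: "x + t *\<^sub>R w \<in> \<Omega>" if "x \<in> U" "t \<in> {0..h}" "h \<le> \<delta>" for x t h
  proof -
    obtain y where y: "y \<in> ?K" "dist y x < \<epsilon> / 2" using \<open>x \<in> U\<close> by (auto simp: U_def)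
    have "norm (t *\<^sub>R w) \<le> \<delta> * norm w"
      using that by (auto intro: mult_right_mono)
    then have "dist y (x + t *\<^sub>R w) \<le> \<epsilon>"
      using y(2) \<delta>(2) norm_triangle_ineq4[of "y - x" "t *\<^sub>R w"] by (simp add: dist_norm algebra_simps)
    then have "x + t *\<^sub>R w \<in> (\<Union>x\<in>?K. cball x \<epsilon>)"
      using y(1) by (intro UN_I[of y]) simp_all
    then show ?thesis using \<epsilon>(2) by (rule subsetD[rotated])
  qed
  define m where "m t = (\<integral>y. F y * dir_deriv w \<phi> (y - t *\<^sub>R w) \<partial>lborel)" for t
  define n where "n t = (\<integral>y. G y * \<phi> (y - t *\<^sub>R w) \<partial>lborel)" for t
  obtain C where C: "\<And>x. \<bar>\<phi> x\<bar> \<le> C" using test_function_bounded[OF \<phi>] by blast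
  obtain D where D: "\<And>x. \<bar>dir_deriv w \<phi> x\<bar> \<le> D" using dir_deriv_bounded[OF \<phi>] by blast
  have m: "continuous_on A m" for A
    unfolding m_def[abs_def] by (rule continuous_integral_translate[OF F dir_deriv_continuous[OF \<phi>] D])
  have n: "continuous_on A n" for A
    unfolding n_def[abs_def] using \<phi> C
    by (intro continuous_integral_translate[OF G]) (auto simp: test_function_def intro: C_infinity_continuous)
  have int: "integrable (seg h) k" if "continuous_on UNIV k" for h and k :: "real \<Rightarrow> real"
  proof -
    have "set_integrable lborel {0..h} k"
      by (rule borel_integrable_atLeastAtMost') (rule continuous_on_subset[OF that], simp)
    then show ?thesis
      using that by (simp add: set_integrable_def integrable_seg borel_measurable_continuous_onI)
  qed
  have "(\<integral>t. m t + n t \<partial>seg h) = 0" if h: "0 \<le> h" "h \<le> \<delta>" for h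
  proof -
    have "AE x in lborel. x \<in> U \<longrightarrow> F (x + h *\<^sub>R w) - F x = (\<integral>t. G (x + t *\<^sub>R w) \<partial>seg h)"
      using diff[OF U h(1)] inside h(2) by blast
    then have "AE x in lborel. (F (x + h *\<^sub>R w) - F x) * \<phi> x = (\<integral>t. G (x + t *\<^sub>R w) \<partial>seg h) * \<phi> x"
      by eventually_elim (use test_U in auto)
    then have "(\<integral>x. (F (x + h *\<^sub>R w) - F x) * \<phi> x \<partial>lborel) = (\<integral>x. (\<integral>t. G (x + t *\<^sub>R w) \<partial>seg h) * \<phi> x \<partial>lborel)"
      using borel_measurable_integrable[OF integrable_segment_integral(1)[OF G, of h w]]
      by (intro integral_cong_AE) auto
    then have "(\<integral>t. m t \<partial>seg h) + (\<integral>t. n t \<partial>seg h) = 0"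
      unfolding m_def n_def
      by (simp add: integral_difference_test[OF F \<phi> h(1)] integral_segment_test[OF G \<phi>])
    then show ?thesis
      using int[OF m] int[OF n] by simp
  qed
  then have "m 0 + n 0 = 0"
    using m n \<delta>(1) by (intro continuous_zero_if_segment_integrals_zero[of "\<lambda>t. m t + n t" \<delta>] continuous_intros) auto
  then show "(\<integral>x. F x * dir_deriv w \<phi> x \<partial>lborel) = - (\<integral>x. G x * \<phi> x \<partial>lborel)"
    by (simp add: m_def n_def)
qed

section \<open>The product rule\<close>

text \<open>This is \<open>2 \<integral> F F' = F\<^sup>2\<close> for \<open>F s = \<integral> f\<close> over \<open>[0, s]\<close>, where \<open>F\<close> is merely absolutely continuous. By symmetry
  the integral of \<open>f r * f s\<close> over the triangle \<open>r \<le> s\<close> is half of the integral over the square.\<close>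

lemma triangle_integral:
  fixes f :: "real \<Rightarrow> real"
  assumes f: "integrable (seg h) f"
  shows "2 * (\<integral>s. (\<integral>r. (if r \<le> s then f r else 0) \<partial>seg h) * f s \<partial>seg h) = (\<integral>s. f s \<partial>seg h)\<^sup>2"
    and "integrable (seg h) (\<lambda>s. (\<integral>r. (if r \<le> s then f r else 0) \<partial>seg h) * f s)"
proof -
  interpret pair_sigma_finite "seg h" "seg h" by (rule pair_lborel_seg)
  have [measurable]: "f \<in> borel_measurable borel"
    using borel_measurable_integrable[OF f] by simp
  have "integrable (seg h \<Otimes>\<^sub>M seg h) (\<lambda>(s, r). f s * f r)"
  proof (rule Fubini_integrable)
    show "integrable (seg h) (\<lambda>s. \<integral>r. norm (case (s, r) of (s, r) \<Rightarrow> f s * f r) \<partial>seg h)"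
      using f by (simp add: abs_mult)
  qed (use f in auto)
  then have A: "integrable (seg h \<Otimes>\<^sub>M seg h) (\<lambda>z. (case z of (s, r) \<Rightarrow> f s * f r) * (if P z then 1 else 0))"
    if [measurable]: "Measurable.pred (borel \<Otimes>\<^sub>M borel) P" for P
    by (rule integrable_mult_bounded[where C=1]) auto
  have A1: "integrable (seg h \<Otimes>\<^sub>M seg h) (\<lambda>(s, r). (if r \<le> s then f r else 0) * f s)"
    using A[of "\<lambda>(s, r). r \<le> s"] by (rule Bochner_Integration.integrable_cong[THEN iffD1, rotated -1]) auto
  have A2: "integrable (seg h \<Otimes>\<^sub>M seg h) (\<lambda>(s, r). (if s \<le> r then f r else 0) * f s)"
    using A[of "\<lambda>(s, r). s \<le> r"] by (rule Bochner_Integration.integrable_cong[THEN iffD1, rotated -1]) auto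
  let ?J = "\<integral>s. (\<integral>r. (if r \<le> s then f r else 0) * f s \<partial>seg h) \<partial>seg h"
  have eq: "(\<integral>r. (if r \<le> s then f r else 0) * f s \<partial>seg h) = (\<integral>r. (if r \<le> s then f r else 0) \<partial>seg h) * f s" for s
    by simp
  show "integrable (seg h) (\<lambda>s. (\<integral>r. (if r \<le> s then f r else 0) \<partial>seg h) * f s)"
    using integrable_fst[OF A1] by simp
  have "?J = (\<integral>r. (\<integral>s. (if r \<le> s then f r else 0) * f s \<partial>seg h) \<partial>seg h)"
    using Fubini_integral[of "\<lambda>s r. (if r \<le> s then f r else 0) * f s"] A1 by simp
  also have "\<dots> = (\<integral>s. (\<integral>r. (if s \<le> r then f r else 0) * f s \<partial>seg h) \<partial>seg h)"
    by (intro Bochner_Integration.integral_cong refl) auto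
  finally have "2 * ?J = (\<integral>s. (\<integral>r. (if r \<le> s then f r else 0) * f s \<partial>seg h) \<partial>seg h)
      + (\<integral>s. (\<integral>r. (if s \<le> r then f r else 0) * f s \<partial>seg h) \<partial>seg h)"
    by simp
  also have "\<dots> = (\<integral>z. (case z of (s, r) \<Rightarrow> (if r \<le> s then f r else 0) * f s) \<partial>(seg h \<Otimes>\<^sub>M seg h))
      + (\<integral>z. (case z of (s, r) \<Rightarrow> (if s \<le> r then f r else 0) * f s) \<partial>(seg h \<Otimes>\<^sub>M seg h))"
    using integral_fst[OF A1] integral_fst[OF A2] by simp
  also have "\<dots> = (\<integral>z. (case z of (s, r) \<Rightarrow> (if r \<le> s then f r else 0) * f s + (if s \<le> r then f r else 0) * f s) \<partial>(seg h \<Otimes>\<^sub>M seg h))"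
    using A1 A2 by (subst Bochner_Integration.integral_add[symmetric]) (auto simp: case_prod_unfold)
  also have "\<dots> = (\<integral>s. (\<integral>r. (if r \<le> s then f r else 0) * f s + (if s \<le> r then f r else 0) * f s \<partial>seg h) \<partial>seg h)"
    using A1 A2 by (subst integral_fst) (auto simp: case_prod_unfold)
  also have "\<dots> = (\<integral>s. (\<integral>r. f r * f s \<partial>seg h) \<partial>seg h)"
  proof (rule Bochner_Integration.integral_cong[OF refl], rule integral_cong_AE)
    fix s
    show "AE r in seg h. (if r \<le> s then f r else 0) * f s + (if s \<le> r then f r else 0) * f s = f r * f s"
      using AE_seg_neq[of s h] by eventually_elim auto
  qed auto
  also have "\<dots> = (\<integral>s. f s \<partial>seg h)\<^sup>2"
    by (simp add: power2_eq_square)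
  finally show "2 * (\<integral>s. (\<integral>r. (if r \<le> s then f r else 0) \<partial>seg h) * f s \<partial>seg h) = (\<integral>s. f s \<partial>seg h)\<^sup>2"
    by simp
qed

text \<open>On almost every line \<open>u\<close> is an antiderivative \<open>u x + \<integral> g\<close> of \<open>g\<close>, and the chain rule for the square of
  an antiderivative is the preceding identity. The converse criterion turns the resulting formula for
  the differences of \<open>u * u\<close> into a weak derivative.\<close>

theorem weak_dir_square:
  assumes u: "integrable lborel u" and g: "integrable lborel g"
    and u2: "integrable lborel (\<lambda>x. u x * u x)" and ug: "integrable lborel (\<lambda>x. u x * g x)"
    and wd: "weak_dir \<Omega> w u g" and \<Omega>: "open \<Omega>"
  shows "weak_dir \<Omega> w (\<lambda>x. u x * u x) (\<lambda>x. 2 * (u x * g x))"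
proof (rule weak_dir_if_difference[OF u2 _ \<Omega>])
  show "integrable lborel (\<lambda>x. 2 * (u x * g x))" using ug by simp
  note [measurable] = borel_measurable_integrable[OF u, simplified] borel_measurable_integrable[OF g, simplified]
  fix U h
  assume U: "open U" and h: "0 \<le> h"
    and inside: "\<And>x t. x \<in> U \<Longrightarrow> t \<in> {0..h} \<Longrightarrow> x + t *\<^sub>R w \<in> \<Omega>"
  interpret pair_sigma_finite "lborel :: (real^3) measure" "seg h" by (rule pair_lborel_seg)
  have [measurable]: "U \<in> sets borel" using U by simp
  \<comment> \<open>Two forms of the same fact: at the end point \<open>h\<close> itself, which is a single value of \<open>s\<close>, and, after
    exchanging the quantifiers, at almost every \<open>s\<close> of the segment.\<close>
  have end_pt: "AE x in lborel. x \<in> U \<longrightarrow> u (x + h *\<^sub>R w) - u x = (\<integral>t. g (x + t *\<^sub>R w) \<partial>seg h)"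
    using weak_dir_difference[OF u g wd U inside h] .
  have "AE x in lborel. x \<in> U \<longrightarrow> u (x + s *\<^sub>R w) - u x = (\<integral>r. (if r \<le> s then g (x + r *\<^sub>R w) else 0) \<partial>seg h)"
    if "s \<in> {0..h}" for s
  proof -
    have "(\<integral>t. g (x + t *\<^sub>R w) \<partial>seg s) = (\<integral>r. (if r \<le> s then g (x + r *\<^sub>R w) else 0) \<partial>seg h)" for x
      using that by (intro integral_seg_shorter) auto
    moreover have "AE x in lborel. x \<in> U \<longrightarrow> u (x + s *\<^sub>R w) - u x = (\<integral>t. g (x + t *\<^sub>R w) \<partial>seg s)"
      by (rule weak_dir_difference[OF u g wd U]) (use inside that in auto)
    ultimately show ?thesis by simp
  qed
  then have "AE s in seg h. AE x in lborel. x \<in> U \<longrightarrow>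
      u (x + s *\<^sub>R w) - u x = (\<integral>r. (if r \<le> s then g (x + r *\<^sub>R w) else 0) \<partial>seg h)"
    by (intro AE_segI)
  moreover have "{z \<in> space (lborel \<Otimes>\<^sub>M seg h). fst z \<in> U \<longrightarrow> u (fst z + snd z *\<^sub>R w) - u (fst z)
      = (\<integral>r. (if r \<le> snd z then g (fst z + r *\<^sub>R w) else 0) \<partial>seg h)} \<in> sets (lborel \<Otimes>\<^sub>M seg h)"
    by measurable
  ultimately have mid: "AE x in lborel. AE s in seg h. x \<in> U \<longrightarrow>
      u (x + s *\<^sub>R w) - u x = (\<integral>r. (if r \<le> s then g (x + r *\<^sub>R w) else 0) \<partial>seg h)"
    by (rule AE_commute[THEN iffD2, rotated])
  show "AE x in lborel. x \<in> U \<longrightarrow> u (x + h *\<^sub>R w) * u (x + h *\<^sub>R w) - u x * u x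
      = (\<integral>t. 2 * (u (x + t *\<^sub>R w) * g (x + t *\<^sub>R w)) \<partial>seg h)"
    using end_pt mid integrable_segment_integral(2)[OF g, of h w]
  proof eventually_elim
    fix x
    assume e: "x \<in> U \<longrightarrow> u (x + h *\<^sub>R w) - u x = (\<integral>t. g (x + t *\<^sub>R w) \<partial>seg h)"
      and m: "AE s in seg h. x \<in> U \<longrightarrow>
        u (x + s *\<^sub>R w) - u x = (\<integral>r. (if r \<le> s then g (x + r *\<^sub>R w) else 0) \<partial>seg h)"
      and i: "integrable (seg h) (\<lambda>t. g (x + t *\<^sub>R w))"
    show "x \<in> U \<longrightarrow> u (x + h *\<^sub>R w) * u (x + h *\<^sub>R w) - u x * u x
      = (\<integral>t. 2 * (u (x + t *\<^sub>R w) * g (x + t *\<^sub>R w)) \<partial>seg h)"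
    proof
      assume "x \<in> U"
      define f where "f t = g (x + t *\<^sub>R w)" for t
      define \<Phi> where "\<Phi> s = (\<integral>r. (if r \<le> s then f r else 0) \<partial>seg h)" for s
      have f: "integrable (seg h) f" using i by (simp add: f_def[abs_def])
      have [measurable]: "f \<in> borel_measurable borel" "\<Phi> \<in> borel_measurable borel"
        unfolding f_def[abs_def] \<Phi>_def[abs_def] by measurable
      have \<Phi>: "AE s in seg h. u (x + s *\<^sub>R w) = u x + \<Phi> s"
        unfolding \<Phi>_def f_def using m by eventually_elim (use \<open>x \<in> U\<close> in auto)
      have "(\<integral>t. 2 * (u (x + t *\<^sub>R w) * f t) \<partial>seg h) = (\<integral>t. 2 * (u x * f t) + 2 * (\<Phi> t * f t) \<partial>seg h)"
      proof (rule integral_cong_AE)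
        show "AE t in seg h. 2 * (u (x + t *\<^sub>R w) * f t) = 2 * (u x * f t) + 2 * (\<Phi> t * f t)"
          using \<Phi> by eventually_elim (simp add: algebra_simps)
      qed auto
      also have "\<dots> = 2 * u x * (\<integral>t. f t \<partial>seg h) + (\<integral>t. f t \<partial>seg h)\<^sup>2"
        using f triangle_integral[OF f] by (simp add: \<Phi>_def)
      also have "(\<integral>t. f t \<partial>seg h) = u (x + h *\<^sub>R w) - u x"
        using e \<open>x \<in> U\<close> by (simp add: f_def)
      finally show "u (x + h *\<^sub>R w) * u (x + h *\<^sub>R w) - u x * u x
          = (\<integral>t. 2 * (u (x + t *\<^sub>R w) * g (x + t *\<^sub>R w)) \<partial>seg h)"
        by (simp add: f_def power2_eq_square algebra_simps)
    qed
  qed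
qed

lemma weak_dir_add:
  assumes "integrable lborel u" "integrable lborel g" "integrable lborel v" "integrable lborel k"
    and "weak_dir \<Omega> w u g" "weak_dir \<Omega> w v k"
  shows "weak_dir \<Omega> w (\<lambda>x. a * u x + b * v x) (\<lambda>x. a * g x + b * k x)"
  unfolding weak_dir_def
proof (intro allI impI)
  fix \<phi> assume \<phi>: "test_function \<Omega> \<phi>"
  obtain D where D: "\<And>x. \<bar>dir_deriv w \<phi> x\<bar> \<le> D" using dir_deriv_bounded[OF \<phi>] by blast
  have D': "integrable lborel (\<lambda>x. f x * dir_deriv w \<phi> x)" if "integrable lborel f" for f
    using that dir_deriv_measurable[OF \<phi>] D by (intro integrable_mult_bounded) auto
  have "(\<integral>x. (a * u x + b * v x) * dir_deriv w \<phi> x \<partial>lborel)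
      = a * (\<integral>x. u x * dir_deriv w \<phi> x \<partial>lborel) + b * (\<integral>x. v x * dir_deriv w \<phi> x \<partial>lborel)"
    using D'[OF assms(1)] D'[OF assms(3)] by (simp add: distrib_right mult.assoc)
  also have "\<dots> = - (a * (\<integral>x. g x * \<phi> x \<partial>lborel) + b * (\<integral>x. k x * \<phi> x \<partial>lborel))"
    using assms(5,6) \<phi> by (simp add: weak_dir_def)
  also have "\<dots> = - (\<integral>x. (a * g x + b * k x) * \<phi> x \<partial>lborel)"
    using integrable_test_function[OF assms(2) \<phi>] integrable_test_function[OF assms(4) \<phi>]
    by (simp add: distrib_right mult.assoc)
  finally show "(\<integral>x. (a * u x + b * v x) * dir_deriv w \<phi> x \<partial>lborel) = - (\<integral>x. (a * g x + b * k x) * \<phi> x \<partial>lborel)" .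
qed

lemma integrable_mult_squares:
  fixes f g :: "real^3 \<Rightarrow> real"
  assumes [measurable]: "f \<in> borel_measurable borel" "g \<in> borel_measurable borel"
    and "integrable lborel (\<lambda>x. f x * f x)" "integrable lborel (\<lambda>x. g x * g x)"
  shows "integrable lborel (\<lambda>x. f x * g x)"
proof (rule Bochner_Integration.integrable_bound)
  show "integrable lborel (\<lambda>x. f x * f x + g x * g x)" using assms(3,4) by simp
  have "\<bar>a * b\<bar> \<le> a * a + b * b" for a b :: real
  proof -
    have "0 \<le> (\<bar>a\<bar> - \<bar>b\<bar>)\<^sup>2" by simp
    then have "2 * \<bar>a * b\<bar> \<le> a * a + b * b"
      by (simp add: power2_eq_square algebra_simps abs_mult)
    then show ?thesis by linarith
  qed
  then show "AE x in lborel. norm (f x * g x) \<le> norm (f x * f x + g x * g x)"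
    by (intro AE_I2) simp
qed simp

text \<open>Polarization of the rule for squares.\<close>

theorem weak_dir_mult:
  assumes u: "integrable lborel u" and g: "integrable lborel g"
    and v: "integrable lborel v" and k: "integrable lborel k"
    and sq: "integrable lborel (\<lambda>x. u x * u x)" "integrable lborel (\<lambda>x. g x * g x)"
      "integrable lborel (\<lambda>x. v x * v x)" "integrable lborel (\<lambda>x. k x * k x)"
    and wd: "weak_dir \<Omega> w u g" "weak_dir \<Omega> w v k" and \<Omega>: "open \<Omega>"
  shows "weak_dir \<Omega> w (\<lambda>x. u x * v x) (\<lambda>x. g x * v x + u x * k x)"
proof -
  note [measurable] = borel_measurable_integrable[OF u, simplified] borel_measurable_integrable[OF g, simplified]
    borel_measurable_integrable[OF v, simplified] borel_measurable_integrable[OF k, simplified]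
  have i: "integrable lborel (\<lambda>x. u x * v x)" "integrable lborel (\<lambda>x. u x * g x)" "integrable lborel (\<lambda>x. u x * k x)"
    "integrable lborel (\<lambda>x. v x * g x)" "integrable lborel (\<lambda>x. v x * k x)"
    using sq by (auto intro!: integrable_mult_squares)
  have S: "weak_dir \<Omega> w (\<lambda>x. (u x + c * v x) * (u x + c * v x)) (\<lambda>x. 2 * ((u x + c * v x) * (g x + c * k x)))"
    and I: "integrable lborel (\<lambda>x. (u x + c * v x) * (u x + c * v x))"
           "integrable lborel (\<lambda>x. 2 * ((u x + c * v x) * (g x + c * k x)))" for c
  proof -
    show I1: "integrable lborel (\<lambda>x. (u x + c * v x) * (u x + c * v x))"
    proof -
      have "(\<lambda>x. (u x + c * v x) * (u x + c * v x)) = (\<lambda>x. u x * u x + c * c * (v x * v x) + 2 * c * (u x * v x))"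
        by (simp add: fun_eq_iff algebra_simps)
      then show ?thesis using i sq by simp
    qed
    have I2: "integrable lborel (\<lambda>x. (u x + c * v x) * (g x + c * k x))"
    proof -
      have "(\<lambda>x. (u x + c * v x) * (g x + c * k x))
          = (\<lambda>x. u x * g x + c * (u x * k x) + c * (v x * g x) + c * c * (v x * k x))"
        by (simp add: fun_eq_iff algebra_simps)
      then show ?thesis using i by simp
    qed
    then show "integrable lborel (\<lambda>x. 2 * ((u x + c * v x) * (g x + c * k x)))" by simp
    have "weak_dir \<Omega> w (\<lambda>x. u x + c * v x) (\<lambda>x. g x + c * k x)"
      using weak_dir_add[OF u g v k wd, of 1 c] by simp
    then show "weak_dir \<Omega> w (\<lambda>x. (u x + c * v x) * (u x + c * v x)) (\<lambda>x. 2 * ((u x + c * v x) * (g x + c * k x)))"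
      using u v g k by (intro weak_dir_square I1 I2 \<Omega>) auto
  qed
  show ?thesis
    using weak_dir_add[OF I[of 1] I[of "-1"] S[of 1] S[of "-1"], of "1/4" "-1/4"]
    by (simp add: algebra_simps)
qed

section \<open>The cone property of smooth domains\<close>

definition proj2 :: "real^3 \<Rightarrow> real^2" where
  "proj2 y = vector [y $ 1, y $ 2]"

lemma proj2_linear: "proj2 (x + t *\<^sub>R y) = proj2 x + t *\<^sub>R proj2 y" "proj2 (x - y) = proj2 x - proj2 y"
  by (simp_all add: proj2_def vec_eq_iff forall_2)

lemma norm_proj2_le: "norm (proj2 y) \<le> norm y"
  unfolding norm_le by (simp add: proj2_def inner_vec_def sum_2 sum_3)

text \<open>The factor \<open>2\<close> counts the two coordinates; \<open>M\<close> bounds both partial derivatives near \<open>q\<close>.\<close>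

lemma C_infinity_increment_le:
  fixes \<gamma> :: "real^2 \<Rightarrow> real"
  assumes \<gamma>: "C_infinity \<gamma>"
  obtains M where "M \<ge> 0" "\<And>a v t. t \<ge> 0 \<Longrightarrow> (\<And>s. s \<in> {0..t} \<Longrightarrow> a + s *\<^sub>R v \<in> cball q 1) \<Longrightarrow>
    \<gamma> (a + t *\<^sub>R v) - \<gamma> a \<le> t * (2 * M * norm v)"
proof -
  have "\<exists>C. \<forall>x\<in>cball q 1. \<bar>partial_deriv i \<gamma> x\<bar> \<le> C" for i
  proof -
    have "continuous_on (cball q 1) (partial_deriv i \<gamma>)"
      using C_infinity_continuous[OF C_infinity_partial[OF \<gamma>]] continuous_on_subset by blast
    then have "bounded (partial_deriv i \<gamma> ` cball q 1)"
      using compact_continuous_image compact_imp_bounded compact_cball by blast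
    then show ?thesis unfolding bounded_iff by auto
  qed
  then obtain C where C: "\<And>i x. x \<in> cball q 1 \<Longrightarrow> \<bar>partial_deriv i \<gamma> x\<bar> \<le> C i" by metis
  define M where "M = max 0 (max (C 1) (C 2))"
  have M: "\<bar>partial_deriv i \<gamma> x\<bar> \<le> M" if "x \<in> cball q 1" for i x
    using C[OF that, of i] exhaust_2[of i] by (auto simp: M_def)
  show thesis
  proof (rule that)
    show "M \<ge> 0" by (simp add: M_def)
    fix a v :: "real^2" and t :: real
    assume t: "t \<ge> 0" and seg: "\<And>s. s \<in> {0..t} \<Longrightarrow> a + s *\<^sub>R v \<in> cball q 1"
    show "\<gamma> (a + t *\<^sub>R v) - \<gamma> a \<le> t * (2 * M * norm v)"
    proof (cases "t = 0")
      case False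
      then have "t > 0" using t by simp
      have "((\<lambda>s. \<gamma> (a + s *\<^sub>R v)) has_real_derivative dv) (at s)"
        if "dv = (\<Sum>i\<in>UNIV. v $ i * partial_deriv i \<gamma> (a + s *\<^sub>R v))" for s dv
        unfolding that by (intro has_real_derivative_line C_infinity_differentiable \<gamma>)
      then obtain s where s: "0 < s" "s < t" "\<gamma> (a + t *\<^sub>R v) - \<gamma> a = t * (\<Sum>i\<in>UNIV. v $ i * partial_deriv i \<gamma> (a + s *\<^sub>R v))"
        using MVT2[OF \<open>t > 0\<close>, of "\<lambda>s. \<gamma> (a + s *\<^sub>R v)"
          "\<lambda>s. (\<Sum>i\<in>UNIV. v $ i * partial_deriv i \<gamma> (a + s *\<^sub>R v))"] by auto
      have "(\<Sum>i\<in>UNIV. v $ i * partial_deriv i \<gamma> (a + s *\<^sub>R v)) \<le> (\<Sum>i\<in>(UNIV::2 set). norm v * M)"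
      proof (rule sum_mono)
        fix i :: 2
        have "v $ i * partial_deriv i \<gamma> (a + s *\<^sub>R v) \<le> \<bar>v $ i\<bar> * \<bar>partial_deriv i \<gamma> (a + s *\<^sub>R v)\<bar>"
          by (metis abs_ge_self abs_mult)
        also have "\<dots> \<le> norm v * M"
          using M[OF seg, of s i] s by (intro mult_mono component_le_norm_cart) auto
        finally show "v $ i * partial_deriv i \<gamma> (a + s *\<^sub>R v) \<le> norm v * M" .
      qed
      then have "(\<Sum>i\<in>UNIV. v $ i * partial_deriv i \<gamma> (a + s *\<^sub>R v)) \<le> 2 * M * norm v"
        by (simp add: mult_ac)
      then show ?thesis
        unfolding s(3) using t by (rule mult_left_mono)
    qed simp
  qed
qed

text \<open>Above the graph of a function with slope at most \<open>2 M\<close> there is room for a steep vertical cone at each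
  point; the cones at nearby points are translates of each other.\<close>

lemma cone_property:
  assumes \<Omega>: "bounded_smooth_domain \<Omega>" and p: "p \<in> closure \<Omega>"
  shows "\<exists>r w0 \<rho>. r > 0 \<and> \<rho> > 0 \<and>
    (\<forall>x \<in> \<Omega> \<inter> ball p r. \<forall>w \<in> ball w0 \<rho>. \<forall>t \<in> {0..1}. x + t *\<^sub>R w \<in> \<Omega>)"
proof (cases "p \<in> \<Omega>")
  case True
  then obtain e where e: "e > 0" "ball p e \<subseteq> \<Omega>"
    using \<Omega> open_contains_ball unfolding bounded_smooth_domain_def by blast
  have "x + t *\<^sub>R w \<in> \<Omega>" if "x \<in> ball p (e / 2)" "w \<in> ball 0 (e / 2)" "t \<in> {0..1}" for x w and t :: real
  proof -
    have "norm (t *\<^sub>R w) \<le> norm w"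
      using that(3) by (auto simp: mult_left_le_one_le)
    then have "dist p (x + t *\<^sub>R w) < e"
      using that norm_triangle_ineq4[of "p - x" "t *\<^sub>R w"] by (simp add: dist_norm algebra_simps)
    then show ?thesis using e(2) by auto
  qed
  then show ?thesis using e(1)
    by (intro exI[of _ "e / 2"] exI[of _ "0 :: real^3"]) auto
next
  case False
  then have "p \<in> frontier \<Omega>"
    using p \<Omega> by (simp add: frontier_def bounded_smooth_domain_def interior_open)
  then obtain r0 T \<gamma> where r0: "r0 > 0" and T: "orthogonal_transformation T" and \<gamma>: "C_infinity \<gamma>"
    and graph: "\<Omega> \<inter> ball p r0 = {x \<in> ball p r0. T x $ 3 > \<gamma> (proj2 (T x))}"
    using \<Omega>[unfolded bounded_smooth_domain_def, folded proj2_def] by (elim conjE ballE[where x=p] exE) auto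
  obtain M where M: "M \<ge> 0" "\<And>a v t. t \<ge> 0 \<Longrightarrow> (\<And>s. s \<in> {0..t} \<Longrightarrow> a + s *\<^sub>R v \<in> cball (proj2 (T p)) 1) \<Longrightarrow>
    \<gamma> (a + t *\<^sub>R v) - \<gamma> a \<le> t * (2 * M * norm v)"
    using C_infinity_increment_le[OF \<gamma>] by metis
  \<comment> \<open>The axis of the cone is vertical of length \<open>\<eta>\<close>. The radius \<open>\<rho>\<close> of the base is such that the rise of a
    generator, at least \<open>\<eta> - \<rho>\<close>, balances the rise \<open>2 * M * \<rho>\<close> of the graph below it; the size of \<open>\<eta>\<close> keeps
    everything inside the ball of radius \<open>r0\<close> and inside the region where \<open>M\<close> is valid.\<close>
  define \<eta> where "\<eta> = min r0 1 / 4"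
  define \<rho> where "\<rho> = \<eta> / (1 + 2 * M)"
  have \<eta>: "\<eta> > 0" "4 * \<eta> \<le> r0" "4 * \<eta> \<le> 1" using r0 by (auto simp: \<eta>_def)
  have \<rho>: "\<rho> > 0" "\<rho> \<le> \<eta>" "\<rho> + 2 * M * \<rho> = \<eta>"
  proof -
    have "\<rho> * (1 + 2 * M) = \<eta>" using M(1) by (simp add: \<rho>_def)
    then show "\<rho> + 2 * M * \<rho> = \<eta>" by (simp add: algebra_simps)
    show "\<rho> > 0" using \<eta>(1) M(1) by (simp add: \<rho>_def)
    then show "\<rho> \<le> \<eta>"
      using M(1) \<open>\<rho> + 2 * M * \<rho> = \<eta>\<close> mult_nonneg_nonneg[of "2 * M" \<rho>] by linarith
  qed
  have lin: "linear T" and nT: "\<And>v. norm (T v) = norm v"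
    using T by (auto simp: orthogonal_transformation)
  obtain w0 where w0: "T w0 = \<eta> *\<^sub>R axis 3 1"
    using orthogonal_transformation_surj[OF T] by (metis surjD)
  have nw0: "norm w0 = \<eta>"
    using nT[of w0] \<eta>(1) by (simp add: w0)
  have "x + t *\<^sub>R w \<in> \<Omega>" if x: "x \<in> \<Omega> \<inter> ball p \<eta>" and w: "w \<in> ball w0 \<rho>" and t: "t \<in> {0..1}" for x w and t :: real
  proof -
    have nw: "norm w \<le> 2 * \<eta>"
      using w norm_triangle_ineq2[of w w0] \<rho>(2) nw0 by (simp add: dist_norm norm_minus_commute)
    have near: "norm (x + s *\<^sub>R w - p) < 3 * \<eta>" if "s \<in> {0..1}" for s
    proof -
      have "norm (s *\<^sub>R w) \<le> norm w"
        using that by (auto simp: mult_left_le_one_le)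
      then show ?thesis
        using x nw norm_triangle_ineq[of "x - p" "s *\<^sub>R w"] by (simp add: dist_norm norm_minus_commute algebra_simps)
    qed
    have Tl: "T (x + s *\<^sub>R w) = T x + s *\<^sub>R T w" for s
      using lin by (simp add: linear_add linear_scale)
    have cb: "proj2 (T x) + s *\<^sub>R proj2 (T w) \<in> cball (proj2 (T p)) 1" if "s \<in> {0..1}" for s
    proof -
      have "dist (proj2 (T p)) (proj2 (T x) + s *\<^sub>R proj2 (T w)) = norm (proj2 (T (x + s *\<^sub>R w) - T p))"
        by (simp add: Tl proj2_linear dist_norm norm_minus_commute)
      also have "\<dots> \<le> norm (T (x + s *\<^sub>R w - p))"
        using norm_proj2_le lin by (simp add: linear_diff)
      also have "\<dots> \<le> 1"
        using near[OF that] nT \<eta>(3) by simp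
      finally show ?thesis by simp
    qed
    have small: "norm (T w - \<eta> *\<^sub>R axis 3 1) < \<rho>"
    proof -
      have "T w - \<eta> *\<^sub>R axis 3 1 = T (w - w0)"
        using lin by (simp add: linear_diff w0)
      then show ?thesis using w by (simp add: nT dist_norm norm_minus_commute)
    qed
    have "proj2 (T w) = proj2 (T w - \<eta> *\<^sub>R axis 3 1)"
      by (simp add: proj2_def vec_eq_iff forall_2 axis_def)
    then have horizontal: "norm (proj2 (T w)) \<le> \<rho>"
      using le_less_trans[OF norm_proj2_le small] by (simp only: less_imp_le)
    have "\<bar>(T w - \<eta> *\<^sub>R axis 3 1) $ 3\<bar> < \<rho>"
      using component_le_norm_cart small by (rule le_less_trans)
    then have vertical: "T w $ 3 \<ge> \<eta> - \<rho>"
      by (simp add: axis_def)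
    have "\<gamma> (proj2 (T x) + t *\<^sub>R proj2 (T w)) - \<gamma> (proj2 (T x)) \<le> t * (2 * M * norm (proj2 (T w)))"
      using M(2)[of t "proj2 (T x)" "proj2 (T w)"] cb t by auto
    also have "\<dots> \<le> t * (2 * M * \<rho>)"
      using horizontal t M(1) by (intro mult_left_mono) auto
    also have "\<dots> = t * (\<eta> - \<rho>)"
      using \<rho>(3) by simp
    also have "\<dots> \<le> t * T w $ 3"
      using vertical t by (intro mult_left_mono) auto
    finally have "\<gamma> (proj2 (T (x + t *\<^sub>R w))) \<le> \<gamma> (proj2 (T x)) + t * T w $ 3"
      by (simp add: Tl proj2_linear)
    moreover have "T x $ 3 > \<gamma> (proj2 (T x))"
    proof -
      have "x \<in> \<Omega> \<inter> ball p r0" using x \<eta> by auto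
      then show ?thesis unfolding graph by simp
    qed
    ultimately have "T (x + t *\<^sub>R w) $ 3 > \<gamma> (proj2 (T (x + t *\<^sub>R w)))"
      by (simp add: Tl)
    moreover have "x + t *\<^sub>R w \<in> ball p r0"
      using near[OF t] \<eta> by (simp add: dist_norm norm_minus_commute)
    ultimately have "x + t *\<^sub>R w \<in> \<Omega> \<inter> ball p r0"
      unfolding graph by simp
    then show ?thesis by simp
  qed
  then show ?thesis using \<eta>(1) \<rho>(1)
    by (intro exI[of _ \<eta>] exI[of _ w0] exI[of _ \<rho>]) simp
qed

section \<open>Averages over cones\<close>

definition on_ball :: "'a::euclidean_space \<Rightarrow> real \<Rightarrow> 'a measure" where
  "on_ball c \<rho> = density lborel (indicator (ball c \<rho>))"

lemma ball_measurable [measurable]: "ball c \<rho> \<in> sets borel"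
  by simp

lemma sets_on_ball [simp, measurable_cong]: "sets (on_ball c \<rho>) = sets borel"
  by (simp add: on_ball_def)

lemma space_on_ball [simp]: "space (on_ball c \<rho>) = UNIV"
  by (simp add: on_ball_def)

lemma emeasure_on_ball: "emeasure (on_ball c \<rho>) UNIV = emeasure lborel (ball c \<rho>)"
  by (simp add: on_ball_def emeasure_density)

lemma finite_measure_on_ball: "finite_measure (on_ball c \<rho>)"
  using emeasure_lborel_ball_finite[of c \<rho>]
  by (intro finite_measureI) (simp add: emeasure_on_ball)

lemma emeasure_on_ball_finite: "emeasure (on_ball c \<rho>) UNIV < \<infinity>"
  unfolding emeasure_on_ball by (rule emeasure_lborel_ball_finite)

lemma emeasure_on_ball_pos:
  assumes "\<rho> > 0"
  shows "emeasure (on_ball c \<rho>) UNIV > 0"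
proof -
  have "\<not> negligible (ball c \<rho>)"
    by (rule open_not_negligible) (use assms in auto)
  then have "ball c \<rho> \<notin> null_sets lborel"
    using negligible_iff_null_sets null_sets_completionI by blast
  then show ?thesis
    by (simp add: emeasure_on_ball null_sets_def zero_less_iff_neq_zero)
qed

lemma AE_on_ballI: "(\<And>w. w \<in> ball c \<rho> \<Longrightarrow> P w) \<Longrightarrow> AE w in on_ball c \<rho>. P w"
  unfolding on_ball_def by (subst AE_density) (auto simp: indicator_def)

lemma sigma_finite_on_ball: "sigma_finite_measure (on_ball c \<rho>)"
proof -
  interpret finite_measure "on_ball c \<rho>" by (rule finite_measure_on_ball)
  show ?thesis by unfold_locales
qed

lemma pair_on_ball:
  "pair_sigma_finite (lborel :: 'a::euclidean_space measure) (on_ball c \<rho>)"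
  "pair_sigma_finite (on_ball c \<rho>) (seg h)"
  by (simp_all add: pair_sigma_finite_def sigma_finite_lborel sigma_finite_seg sigma_finite_on_ball)

lemma nn_integral_on_ball_le:
  assumes [measurable]: "f \<in> borel_measurable borel"
  shows "(\<integral>\<^sup>+w. f w \<partial>on_ball c \<rho>) \<le> (\<integral>\<^sup>+w. f w \<partial>lborel)"
proof -
  have "(\<integral>\<^sup>+w. f w \<partial>on_ball c \<rho>) = (\<integral>\<^sup>+w. indicator (ball c \<rho>) w * f w \<partial>lborel)"
    unfolding on_ball_def by (subst nn_integral_density) auto
  also have "\<dots> \<le> (\<integral>\<^sup>+w. f w \<partial>lborel)"
    by (intro nn_integral_mono) (auto simp: indicator_def)
  finally show ?thesis .
qed

text \<open>The change of variables \<open>y = x + t w\<close>, in which the dilated base is enlarged to the whole space.\<close>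

lemma nn_integral_on_ball_scaled:
  fixes f :: "real^3 \<Rightarrow> ennreal"
  assumes [measurable]: "f \<in> borel_measurable borel" and t: "t > 0"
  shows "ennreal (t ^ 3) * (\<integral>\<^sup>+w. f (x + t *\<^sub>R w) \<partial>on_ball c \<rho>) \<le> (\<integral>\<^sup>+y. f y \<partial>lborel)"
proof -
  have d: "(lborel :: (real^3) measure) = density (distr lborel borel (\<lambda>w. x + t *\<^sub>R w)) (\<lambda>_. \<bar>t\<bar> ^ DIM(real^3))"
    using t by (intro lborel_affine) simp
  have "(\<integral>\<^sup>+y. f y \<partial>lborel) = (\<integral>\<^sup>+w. ennreal (t ^ 3) * f (x + t *\<^sub>R w) \<partial>lborel)"
    using t by (subst d) (simp add: nn_integral_density nn_integral_distr)
  also have "\<dots> = ennreal (t ^ 3) * (\<integral>\<^sup>+w. f (x + t *\<^sub>R w) \<partial>lborel)"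
    by (rule nn_integral_cmult) measurable
  also have "\<dots> \<ge> ennreal (t ^ 3) * (\<integral>\<^sup>+w. f (x + t *\<^sub>R w) \<partial>on_ball c \<rho>)"
    by (intro mult_left_mono nn_integral_on_ball_le) auto
  finally show ?thesis .
qed

lemma nn_integral_on_ball_square:
  assumes [measurable]: "f \<in> borel_measurable borel"
  shows "(\<integral>\<^sup>+w. f w \<partial>on_ball c \<rho>)\<^sup>2 \<le> emeasure (on_ball c \<rho>) UNIV * (\<integral>\<^sup>+w. (f w)\<^sup>2 \<partial>on_ball c \<rho>)"
  using Cauchy_Schwarz_nn_integral[of "\<lambda>_. 1" "on_ball c \<rho>" f] by simp

lemma nn_integral_seg_weight: "(\<integral>\<^sup>+t. ennreal (t powr (- 3 / 4)) \<partial>seg 1) = 4"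
proof -
  have "((\<lambda>t::real. t powr (- 3 / 4)) has_integral (4::real)) {0..1}"
    using has_integral_powr_from_0[of "- 3 / 4" 1] by simp
  then have "(\<integral>\<^sup>+t. ennreal (t powr (- 3 / 4)) * indicator {0..1} t \<partial>lborel) = ennreal 4"
    by (intro nn_integral_has_integral_lebesgue') (auto)
  then show ?thesis
    unfolding seg_def by (subst nn_integral_density) (auto simp: mult.commute)
qed

lemma AE_seg_pos: "AE t in seg 1. t > 0"
  unfolding AE_seg using AE_lborel_singleton[of 0] by eventually_elim auto

text \<open>The Cauchy--Schwarz inequality, applied twice with the integrable weight \<open>t powr (- 3 / 4)\<close>. The exponent
  is chosen so that the resulting weight \<open>t powr (9 / 4)\<close>, after a loss of \<open>t ^ 3\<close>, is integrable again.\<close>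

lemma nn_integral_seg_power4:
  assumes [measurable]: "k \<in> borel_measurable borel"
  shows "(\<integral>\<^sup>+t. k t \<partial>seg 1) ^ 4 \<le> 64 * (\<integral>\<^sup>+t. ennreal (t powr (9 / 4)) * k t ^ 4 \<partial>seg 1)"
proof -
  have sq: "ennreal (t powr a) ^ 2 = ennreal (t powr (2 * a))" for t a :: real
    by (simp add: ennreal_power powr_mult powr_powr powr_realpow[symmetric] power2_eq_square flip: powr_add ennreal_mult')
  \<comment> \<open>\<open>- 3 / 8\<close> is half of the exponent of the weight.\<close>
  have split: "ennreal (t powr (- 3 / 8)) * (ennreal (t powr (a + 3 / 8)) * c) = ennreal (t powr a) * c"
    if "t > 0" for t a c
    using that by (simp add: mult.assoc[symmetric] flip: ennreal_mult' powr_add)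
  have CS: "(\<integral>\<^sup>+t. ennreal (t powr a) * f t \<partial>seg 1)\<^sup>2 \<le> 4 * (\<integral>\<^sup>+t. ennreal (t powr (2 * a + 3 / 4)) * (f t)\<^sup>2 \<partial>seg 1)"
    if [measurable]: "f \<in> borel_measurable borel" for f a
  proof -
    have "(\<integral>\<^sup>+t. ennreal (t powr a) * f t \<partial>seg 1)
        = (\<integral>\<^sup>+t. ennreal (t powr (- 3 / 8)) * (ennreal (t powr (a + 3 / 8)) * f t) \<partial>seg 1)"
      by (rule nn_integral_cong_AE, rule eventually_mono[OF AE_seg_pos]) (simp only: split)
    also have "\<dots>\<^sup>2 \<le> (\<integral>\<^sup>+t. (ennreal (t powr (- 3 / 8)))\<^sup>2 \<partial>seg 1) * (\<integral>\<^sup>+t. (ennreal (t powr (a + 3 / 8)) * f t)\<^sup>2 \<partial>seg 1)"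
      by (rule Cauchy_Schwarz_nn_integral) auto
    also have "\<dots> = 4 * (\<integral>\<^sup>+t. ennreal (t powr (2 * a + 3 / 4)) * (f t)\<^sup>2 \<partial>seg 1)"
      using nn_integral_seg_weight by (simp add: sq power_mult_distrib algebra_simps)
    finally show ?thesis .
  qed
  have "(\<integral>\<^sup>+t. k t \<partial>seg 1) = (\<integral>\<^sup>+t. ennreal (t powr 0) * k t \<partial>seg 1)"
    by (rule nn_integral_cong_AE, rule eventually_mono[OF AE_seg_pos]) simp
  then have 1: "(\<integral>\<^sup>+t. k t \<partial>seg 1)\<^sup>2 \<le> 4 * (\<integral>\<^sup>+t. ennreal (t powr (3 / 4)) * (k t)\<^sup>2 \<partial>seg 1)"
    using CS[of k 0] by simp
  have "(\<integral>\<^sup>+t. k t \<partial>seg 1) ^ 4 = ((\<integral>\<^sup>+t. k t \<partial>seg 1)\<^sup>2)\<^sup>2"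
    by (simp flip: power_mult)
  also have "\<dots> \<le> (4 * (\<integral>\<^sup>+t. ennreal (t powr (3 / 4)) * (k t)\<^sup>2 \<partial>seg 1))\<^sup>2"
    by (rule power_mono[OF 1]) simp
  also have "\<dots> = 16 * (\<integral>\<^sup>+t. ennreal (t powr (3 / 4)) * (k t)\<^sup>2 \<partial>seg 1)\<^sup>2"
    by (simp add: power_mult_distrib)
  also have "\<dots> \<le> 16 * (4 * (\<integral>\<^sup>+t. ennreal (t powr (9 / 4)) * ((k t)\<^sup>2)\<^sup>2 \<partial>seg 1))"
    using CS[of "\<lambda>t. (k t)\<^sup>2" "3 / 4"] by (intro mult_left_mono) simp_all
  finally show ?thesis
    by (simp add: mult.assoc[symmetric] flip: power_mult)
qed

lemma nn_integral_cone_weighted: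
  assumes "b \<in> borel_measurable borel" and b: "\<And>t. t > 0 \<Longrightarrow> ennreal (t ^ 3) * b t \<le> c"
  shows "(\<integral>\<^sup>+t. ennreal (t powr (9 / 4)) * b t \<partial>seg 1) \<le> 4 * c"
proof -
  have "(\<integral>\<^sup>+t. ennreal (t powr (9 / 4)) * b t \<partial>seg 1) \<le> (\<integral>\<^sup>+t. ennreal (t powr (- 3 / 4)) * c \<partial>seg 1)"
  proof (rule nn_integral_mono_AE, rule eventually_mono[OF AE_seg_pos])
    fix t :: real assume t: "t > 0"
    have "t powr (9 / 4) = t powr (- 3 / 4 + 3)"
      by simp
    also have "\<dots> = t powr (- 3 / 4) * t ^ 3"
      using t unfolding powr_add by simp
    finally have "t powr (9 / 4) = t powr (- 3 / 4) * t ^ 3" .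
    then have "ennreal (t powr (9 / 4)) * b t = ennreal (t powr (- 3 / 4)) * (ennreal (t ^ 3) * b t)"
      using t by (simp add: ennreal_mult mult.assoc)
    also have "\<dots> \<le> ennreal (t powr (- 3 / 4)) * c"
      by (intro mult_left_mono b t) simp
    finally show "ennreal (t powr (9 / 4)) * b t \<le> ennreal (t powr (- 3 / 4)) * c" .
  qed
  also have "\<dots> = 4 * c"
    by (subst nn_integral_multc) (use nn_integral_seg_weight in auto)
  finally show ?thesis .
qed

text \<open>The total mass of \<open>G\<close> in the cone with vertex \<open>x\<close>, base \<open>x + ball w0 \<rho>\<close>, taken with respect to the
  measure \<open>dw dt\<close> in the coordinates \<open>x + t w\<close>. In Cartesian coordinates the kernel is of the order
  \<open>\<bar>z\<bar> ^ (- 2)\<close>, as in a Riesz potential.\<close>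

definition cone_potential :: "real^3 \<Rightarrow> real \<Rightarrow> (real^3 \<Rightarrow> ennreal) \<Rightarrow> real^3 \<Rightarrow> ennreal" where
  "cone_potential w0 \<rho> G x = (\<integral>\<^sup>+t. (\<integral>\<^sup>+w. G (x + t *\<^sub>R w) \<partial>on_ball w0 \<rho>) \<partial>seg 1)"

lemma measurable_cone_slice [measurable]:
  assumes [measurable]: "G \<in> borel_measurable borel"
  shows "(\<lambda>(x, t). \<integral>\<^sup>+w. G (x + t *\<^sub>R w) \<partial>on_ball w0 \<rho>) \<in> borel_measurable (borel \<Otimes>\<^sub>M borel)"
proof -
  interpret sigma_finite_measure "on_ball w0 \<rho>" by (rule sigma_finite_on_ball)
  show ?thesis by measurable
qed

lemma measurable_cone_potential [measurable]:
  assumes [measurable]: "G \<in> borel_measurable borel"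
  shows "cone_potential w0 \<rho> G \<in> borel_measurable borel"
proof -
  interpret sigma_finite_measure "seg 1" by (rule sigma_finite_seg)
  show ?thesis unfolding cone_potential_def[abs_def] by measurable
qed

lemma cone_potential_power4:
  assumes [measurable]: "G \<in> borel_measurable borel"
  shows "cone_potential w0 \<rho> G x ^ 4
    \<le> 64 * (\<integral>\<^sup>+t. ennreal (t powr (9 / 4)) * (\<integral>\<^sup>+w. G (x + t *\<^sub>R w) \<partial>on_ball w0 \<rho>) ^ 4 \<partial>seg 1)"
  unfolding cone_potential_def by (rule nn_integral_seg_power4) measurable

text \<open>Potentials of \<open>L^4\<close> functions are bounded: at scale \<open>t\<close> the average over the base loses \<open>t ^ (- 3)\<close>,
  which the weight \<open>t powr (9 / 4)\<close> makes integrable.\<close>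

lemma cone_potential_bounded:
  assumes [measurable]: "G \<in> borel_measurable borel"
  shows "cone_potential w0 \<rho> G x ^ 4 \<le> 256 * emeasure (on_ball w0 \<rho>) UNIV ^ 3 * (\<integral>\<^sup>+y. G y ^ 4 \<partial>lborel)"
proof -
  let ?c = "emeasure (on_ball w0 \<rho>) UNIV"
  let ?g = "\<lambda>t. \<integral>\<^sup>+w. G (x + t *\<^sub>R w) \<partial>on_ball w0 \<rho>"
  have "ennreal (t ^ 3) * ?g t ^ 4 \<le> ?c ^ 3 * (\<integral>\<^sup>+y. G y ^ 4 \<partial>lborel)" if t: "t > 0" for t
  proof -
    have "?g t ^ 4 = ((?g t)\<^sup>2)\<^sup>2"
      by (simp flip: power_mult)
    also have "\<dots> \<le> (?c * (\<integral>\<^sup>+w. (G (x + t *\<^sub>R w))\<^sup>2 \<partial>on_ball w0 \<rho>))\<^sup>2"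
      by (intro power_mono nn_integral_on_ball_square) auto
    also have "\<dots> = ?c\<^sup>2 * (\<integral>\<^sup>+w. (G (x + t *\<^sub>R w))\<^sup>2 \<partial>on_ball w0 \<rho>)\<^sup>2"
      by (simp add: power_mult_distrib)
    also have "\<dots> \<le> ?c\<^sup>2 * (?c * (\<integral>\<^sup>+w. ((G (x + t *\<^sub>R w))\<^sup>2)\<^sup>2 \<partial>on_ball w0 \<rho>))"
      by (intro mult_left_mono nn_integral_on_ball_square) auto
    also have "\<dots> = ?c ^ 3 * (\<integral>\<^sup>+w. G (x + t *\<^sub>R w) ^ 4 \<partial>on_ball w0 \<rho>)"
      by (simp add: power2_eq_square power3_eq_cube power4_eq_xxxx mult.assoc)
    finally have "ennreal (t ^ 3) * ?g t ^ 4
        \<le> ennreal (t ^ 3) * (?c ^ 3 * (\<integral>\<^sup>+w. G (x + t *\<^sub>R w) ^ 4 \<partial>on_ball w0 \<rho>))"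
      by (rule mult_left_mono) simp
    also have "\<dots> = ?c ^ 3 * (ennreal (t ^ 3) * (\<integral>\<^sup>+w. G (x + t *\<^sub>R w) ^ 4 \<partial>on_ball w0 \<rho>))"
      by (simp add: mult_ac)
    also have "\<dots> \<le> ?c ^ 3 * (\<integral>\<^sup>+y. G y ^ 4 \<partial>lborel)"
      by (intro mult_left_mono nn_integral_on_ball_scaled[OF _ t]) auto
    finally show ?thesis .
  qed
  then have "(\<integral>\<^sup>+t. ennreal (t powr (9 / 4)) * ?g t ^ 4 \<partial>seg 1) \<le> 4 * (?c ^ 3 * (\<integral>\<^sup>+y. G y ^ 4 \<partial>lborel))"
    by (intro nn_integral_cone_weighted) auto
  then have "64 * (\<integral>\<^sup>+t. ennreal (t powr (9 / 4)) * ?g t ^ 4 \<partial>seg 1) \<le> 64 * (4 * (?c ^ 3 * (\<integral>\<^sup>+y. G y ^ 4 \<partial>lborel)))"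
    by (intro mult_left_mono) auto
  with cone_potential_power4[of G w0 \<rho> x] show ?thesis
    by (simp add: mult.assoc[symmetric])
qed

text \<open>Potentials of square integrable functions lie in \<open>L^4\<close>. Of the four factors at scale \<open>t\<close>, two are
  estimated pointwise by the \<open>L^2\<close> norm at the cost of \<open>t ^ (- 3)\<close>; the other two are integrated in \<open>x\<close>.\<close>

lemma cone_potential_L4:
  assumes [measurable]: "G \<in> borel_measurable borel"
  shows "(\<integral>\<^sup>+x. cone_potential w0 \<rho> G x ^ 4 \<partial>lborel)
    \<le> 256 * emeasure (on_ball w0 \<rho>) UNIV ^ 3 * (\<integral>\<^sup>+y. (G y)\<^sup>2 \<partial>lborel)\<^sup>2"
proof -
  let ?c = "emeasure (on_ball w0 \<rho>) UNIV"
  let ?S = "\<integral>\<^sup>+y. (G y)\<^sup>2 \<partial>lborel"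
  let ?g = "\<lambda>x t. \<integral>\<^sup>+w. G (x + t *\<^sub>R w) \<partial>on_ball w0 \<rho>"
  interpret LW: pair_sigma_finite "lborel :: (real^3) measure" "on_ball w0 \<rho>" by (rule pair_on_ball)
  interpret LS: pair_sigma_finite "lborel :: (real^3) measure" "seg 1" by (rule pair_lborel_seg)
  have "ennreal (t ^ 3) * (\<integral>\<^sup>+x. ?g x t ^ 4 \<partial>lborel) \<le> ?c ^ 3 * ?S\<^sup>2" if t: "t > 0" for t
  proof -
    let ?q = "\<lambda>x. \<integral>\<^sup>+w. (G (x + t *\<^sub>R w))\<^sup>2 \<partial>on_ball w0 \<rho>"
    have "ennreal (t ^ 3) * ?g x t ^ 4 \<le> ?c\<^sup>2 * ?S * ?q x" for x
    proof -
      have "?g x t ^ 4 = (?g x t)\<^sup>2 * (?g x t)\<^sup>2"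
        by (simp flip: power_add)
      also have "\<dots> \<le> (?c * ?q x) * (?c * ?q x)"
        by (intro mult_mono nn_integral_on_ball_square) auto
      finally have "ennreal (t ^ 3) * ?g x t ^ 4 \<le> ennreal (t ^ 3) * ((?c * ?q x) * (?c * ?q x))"
        by (rule mult_left_mono) simp
      also have "\<dots> = ?c\<^sup>2 * (ennreal (t ^ 3) * ?q x) * ?q x"
        by (simp add: power2_eq_square mult_ac)
      also have "\<dots> \<le> ?c\<^sup>2 * ?S * ?q x"
        by (intro mult_right_mono mult_left_mono nn_integral_on_ball_scaled[OF _ t]) auto
      finally show ?thesis .
    qed
    then have "(\<integral>\<^sup>+x. ennreal (t ^ 3) * ?g x t ^ 4 \<partial>lborel) \<le> (\<integral>\<^sup>+x. ?c\<^sup>2 * ?S * ?q x \<partial>lborel)"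
      by (intro nn_integral_mono)
    also have "\<dots> = ?c\<^sup>2 * ?S * (\<integral>\<^sup>+x. ?q x \<partial>lborel)"
      by (rule nn_integral_cmult) measurable
    also have "(\<integral>\<^sup>+x. ?q x \<partial>lborel) = (\<integral>\<^sup>+w. (\<integral>\<^sup>+x. (G (x + t *\<^sub>R w))\<^sup>2 \<partial>lborel) \<partial>on_ball w0 \<rho>)"
      by (rule LW.Fubini'[symmetric]) measurable
    also have "\<dots> = ?c * ?S"
      using lborel_translate(3)[of "\<lambda>_. 0" "\<lambda>y. (G y)\<^sup>2"] by (simp add: mult.commute)
    finally show ?thesis
      by (subst nn_integral_cmult[symmetric]) (measurable, simp add: power2_eq_square power3_eq_cube mult_ac)
  qed
  then have *: "(\<integral>\<^sup>+t. ennreal (t powr (9 / 4)) * (\<integral>\<^sup>+x. ?g x t ^ 4 \<partial>lborel) \<partial>seg 1) \<le> 4 * (?c ^ 3 * ?S\<^sup>2)"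
    by (intro nn_integral_cone_weighted) measurable
  have "(\<integral>\<^sup>+x. cone_potential w0 \<rho> G x ^ 4 \<partial>lborel)
      \<le> (\<integral>\<^sup>+x. 64 * (\<integral>\<^sup>+t. ennreal (t powr (9 / 4)) * ?g x t ^ 4 \<partial>seg 1) \<partial>lborel)"
    by (intro nn_integral_mono cone_potential_power4) measurable
  also have "\<dots> = 64 * (\<integral>\<^sup>+x. (\<integral>\<^sup>+t. ennreal (t powr (9 / 4)) * ?g x t ^ 4 \<partial>seg 1) \<partial>lborel)"
    by (rule nn_integral_cmult) measurable
  also have "(\<integral>\<^sup>+x. (\<integral>\<^sup>+t. ennreal (t powr (9 / 4)) * ?g x t ^ 4 \<partial>seg 1) \<partial>lborel)
      = (\<integral>\<^sup>+t. (\<integral>\<^sup>+x. ennreal (t powr (9 / 4)) * ?g x t ^ 4 \<partial>lborel) \<partial>seg 1)"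
    by (rule LS.Fubini'[symmetric]) measurable
  also have "\<dots> = (\<integral>\<^sup>+t. ennreal (t powr (9 / 4)) * (\<integral>\<^sup>+x. ?g x t ^ 4 \<partial>lborel) \<partial>seg 1)"
    by (intro nn_integral_cong nn_integral_cmult) measurable
  also have "64 * \<dots> \<le> 64 * (4 * (?c ^ 3 * ?S\<^sup>2))"
    by (intro mult_left_mono *) simp
  finally show ?thesis
    by (simp add: mult.assoc[symmetric])
qed

section \<open>Sobolev embeddings\<close>

text \<open>Values in \<open>ennreal\<close>, and the \<open>l^1\<close> norm of the gradient, keep all later estimates free of integrability
  conditions and square roots.\<close>

definition grad_size :: "(3 \<Rightarrow> real^3 \<Rightarrow> real) \<Rightarrow> real^3 \<Rightarrow> ennreal" where
  "grad_size g y = (\<Sum>i\<in>UNIV. ennreal \<bar>g i y\<bar>)"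

lemma measurable_grad_size [measurable]:
  "(\<And>i. g i \<in> borel_measurable borel) \<Longrightarrow> grad_size g \<in> borel_measurable borel"
  unfolding grad_size_def[abs_def] by measurable

lemma weak_dir_combine:
  assumes u: "integrable lborel u" and g: "\<And>i. integrable lborel (g i)"
    and wd: "\<And>i. weak_dir \<Omega> (axis i 1) u (g i)"
  shows "weak_dir \<Omega> w u (\<lambda>x. \<Sum>i\<in>UNIV. w $ i * g i x)"
  unfolding weak_dir_def
proof (intro allI impI)
  fix \<phi> assume \<phi>: "test_function \<Omega> \<phi>"
  have "(\<integral>x. u x * dir_deriv w \<phi> x \<partial>lborel) = (\<integral>x. (\<Sum>i\<in>UNIV. w $ i * (u x * partial_deriv i \<phi> x)) \<partial>lborel)"
    by (simp add: dir_deriv_def sum_distrib_left mult_ac)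
  also have "\<dots> = (\<Sum>i\<in>UNIV. w $ i * (\<integral>x. u x * partial_deriv i \<phi> x \<partial>lborel))"
    using integrable_test_function[OF u test_function_partial[OF \<phi>]] by simp
  also have "\<dots> = - (\<Sum>i\<in>UNIV. w $ i * (\<integral>x. g i x * \<phi> x \<partial>lborel))"
    using wd \<phi> by (simp add: weak_dir_def dir_deriv_axis sum_negf)
  also have "(\<Sum>i\<in>UNIV. w $ i * (\<integral>x. g i x * \<phi> x \<partial>lborel)) = (\<integral>x. (\<Sum>i\<in>UNIV. w $ i * (g i x * \<phi> x)) \<partial>lborel)"
    using integrable_test_function[OF g \<phi>] by simp
  finally show "(\<integral>x. u x * dir_deriv w \<phi> x \<partial>lborel) = - (\<integral>x. (\<Sum>i\<in>UNIV. w $ i * g i x) * \<phi> x \<partial>lborel)"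
    by (simp add: sum_distrib_right mult.assoc)
qed

lemma nn_integral_abs_ge:
  fixes f :: "'a \<Rightarrow> real"
  shows "ennreal \<bar>\<integral>x. f x \<partial>M\<bar> \<le> (\<integral>\<^sup>+x. ennreal \<bar>f x\<bar> \<partial>M)"
  using integral_norm_bound_ennreal[of M f] not_integrable_integral_eq[of M f]
  by (cases "integrable M f") auto

text \<open>Averaging \<open>\<bar>u x\<bar> \<le> \<bar>u (x + w)\<bar> + \<integral> \<bar>w\<bar> \<bar>grad u (x + t w)\<bar> dt\<close> over all \<open>w\<close> in the base of the cone.\<close>

lemma cone_representation:
  assumes u: "integrable lborel u" and g: "\<And>i. integrable lborel (g i)"
    and wd: "\<And>i. weak_dir \<Omega> (axis i 1) u (g i)" and U: "open U" "U \<subseteq> \<Omega>"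
    and cone: "\<And>x w t. x \<in> U \<Longrightarrow> w \<in> ball w0 \<rho> \<Longrightarrow> t \<in> {0..1} \<Longrightarrow> x + t *\<^sub>R w \<in> \<Omega>"
  shows "AE x in lborel. x \<in> U \<longrightarrow> emeasure (on_ball w0 \<rho>) UNIV * ennreal \<bar>u x\<bar>
    \<le> (\<integral>\<^sup>+y. ennreal \<bar>u y\<bar> \<partial>lborel) + ennreal (norm w0 + \<bar>\<rho>\<bar>) * cone_potential w0 \<rho> (grad_size g) x"
proof -
  note [measurable] = borel_measurable_integrable[OF u, simplified] borel_measurable_integrable[OF g, simplified]
  have [measurable]: "U \<in> sets borel" using U by simp
  interpret LW: pair_sigma_finite "lborel :: (real^3) measure" "on_ball w0 \<rho>" by (rule pair_on_ball)
  interpret WS: pair_sigma_finite "on_ball w0 \<rho>" "seg 1" by (rule pair_on_ball)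
  let ?R = "ennreal (norm w0 + \<bar>\<rho>\<bar>)"
  let ?G = "grad_size g"
  have point: "AE x in lborel. x \<in> U \<longrightarrow>
      ennreal \<bar>u x\<bar> \<le> ennreal \<bar>u (x + w)\<bar> + ?R * (\<integral>\<^sup>+t. ?G (x + t *\<^sub>R w) \<partial>seg 1)"
    if w: "w \<in> ball w0 \<rho>" for w
  proof -
    have nw: "norm w \<le> norm w0 + \<bar>\<rho>\<bar>"
      using w norm_triangle_ineq2[of w w0] by (simp add: dist_norm norm_minus_commute)
    have "AE x in lborel. x \<in> U \<longrightarrow> u (x + 1 *\<^sub>R w) - u x = (\<integral>t. (\<Sum>i\<in>UNIV. w $ i * g i (x + t *\<^sub>R w)) \<partial>seg 1)"
      by (rule weak_dir_difference[OF u _ weak_dir_combine[OF u g wd] U(1)]) (use g cone w in auto)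
    then show ?thesis
    proof eventually_elim
      fix x
      assume eq: "x \<in> U \<longrightarrow> u (x + 1 *\<^sub>R w) - u x = (\<integral>t. (\<Sum>i\<in>UNIV. w $ i * g i (x + t *\<^sub>R w)) \<partial>seg 1)"
      have "ennreal \<bar>\<Sum>i\<in>UNIV. w $ i * g i y\<bar> \<le> ?R * ?G y" for y
      proof -
        have "\<bar>\<Sum>i\<in>UNIV. w $ i * g i y\<bar> \<le> (\<Sum>i\<in>UNIV. (norm w0 + \<bar>\<rho>\<bar>) * \<bar>g i y\<bar>)"
          using order_trans[OF component_le_norm_cart nw]
          by (intro order_trans[OF sum_abs] sum_mono) (simp add: abs_mult mult_right_mono)
        then have "ennreal \<bar>\<Sum>i\<in>UNIV. w $ i * g i y\<bar> \<le> ennreal ((norm w0 + \<bar>\<rho>\<bar>) * (\<Sum>i\<in>UNIV. \<bar>g i y\<bar>))"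
          by (intro ennreal_leI) (simp add: sum_distrib_left)
        then show ?thesis
          by (simp add: grad_size_def ennreal_mult sum_nonneg)
      qed
      then have "(\<integral>\<^sup>+t. ennreal \<bar>\<Sum>i\<in>UNIV. w $ i * g i (x + t *\<^sub>R w)\<bar> \<partial>seg 1)
          \<le> (\<integral>\<^sup>+t. ?R * ?G (x + t *\<^sub>R w) \<partial>seg 1)"
        by (intro nn_integral_mono)
      also have "\<dots> = ?R * (\<integral>\<^sup>+t. ?G (x + t *\<^sub>R w) \<partial>seg 1)"
        by (rule nn_integral_cmult) measurable
      finally have *: "ennreal \<bar>\<integral>t. (\<Sum>i\<in>UNIV. w $ i * g i (x + t *\<^sub>R w)) \<partial>seg 1\<bar> \<le> ?R * (\<integral>\<^sup>+t. ?G (x + t *\<^sub>R w) \<partial>seg 1)"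
        by (rule order_trans[OF nn_integral_abs_ge])
      show "x \<in> U \<longrightarrow> ennreal \<bar>u x\<bar> \<le> ennreal \<bar>u (x + w)\<bar> + ?R * (\<integral>\<^sup>+t. ?G (x + t *\<^sub>R w) \<partial>seg 1)"
      proof
        assume "x \<in> U"
        let ?I = "\<integral>t. (\<Sum>i\<in>UNIV. w $ i * g i (x + t *\<^sub>R w)) \<partial>seg 1"
        have "\<bar>u x\<bar> \<le> \<bar>u (x + w)\<bar> + \<bar>?I\<bar>"
          using eq \<open>x \<in> U\<close> by auto
        then have "ennreal \<bar>u x\<bar> \<le> ennreal \<bar>u (x + w)\<bar> + ennreal \<bar>?I\<bar>"
          by (simp flip: ennreal_plus)
        also have "\<dots> \<le> ennreal \<bar>u (x + w)\<bar> + ?R * (\<integral>\<^sup>+t. ?G (x + t *\<^sub>R w) \<partial>seg 1)"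
          by (intro add_left_mono *)
        finally show "ennreal \<bar>u x\<bar> \<le> ennreal \<bar>u (x + w)\<bar> + ?R * (\<integral>\<^sup>+t. ?G (x + t *\<^sub>R w) \<partial>seg 1)" .
      qed
    qed
  qed
  then have "AE w in on_ball w0 \<rho>. AE x in lborel. x \<in> U \<longrightarrow>
      ennreal \<bar>u x\<bar> \<le> ennreal \<bar>u (x + w)\<bar> + ?R * (\<integral>\<^sup>+t. ?G (x + t *\<^sub>R w) \<partial>seg 1)"
    by (rule AE_on_ballI)
  moreover have "{z \<in> space (lborel \<Otimes>\<^sub>M on_ball w0 \<rho>). fst z \<in> U \<longrightarrow> ennreal \<bar>u (fst z)\<bar>
      \<le> ennreal \<bar>u (fst z + snd z)\<bar> + ?R * (\<integral>\<^sup>+t. ?G (fst z + t *\<^sub>R snd z) \<partial>seg 1)} \<in> sets (lborel \<Otimes>\<^sub>M on_ball w0 \<rho>)"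
    by measurable
  ultimately have "AE x in lborel. AE w in on_ball w0 \<rho>. x \<in> U \<longrightarrow>
      ennreal \<bar>u x\<bar> \<le> ennreal \<bar>u (x + w)\<bar> + ?R * (\<integral>\<^sup>+t. ?G (x + t *\<^sub>R w) \<partial>seg 1)"
    by (rule LW.AE_commute[THEN iffD2, rotated])
  then show ?thesis
  proof eventually_elim
    fix x
    assume ae: "AE w in on_ball w0 \<rho>. x \<in> U \<longrightarrow>
      ennreal \<bar>u x\<bar> \<le> ennreal \<bar>u (x + w)\<bar> + ?R * (\<integral>\<^sup>+t. ?G (x + t *\<^sub>R w) \<partial>seg 1)"
    show "x \<in> U \<longrightarrow> emeasure (on_ball w0 \<rho>) UNIV * ennreal \<bar>u x\<bar>
      \<le> (\<integral>\<^sup>+y. ennreal \<bar>u y\<bar> \<partial>lborel) + ?R * cone_potential w0 \<rho> ?G x"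
    proof
      assume "x \<in> U"
      have "emeasure (on_ball w0 \<rho>) UNIV * ennreal \<bar>u x\<bar> = (\<integral>\<^sup>+w. ennreal \<bar>u x\<bar> \<partial>on_ball w0 \<rho>)"
        by (simp add: mult.commute)
      also have "\<dots> \<le> (\<integral>\<^sup>+w. ennreal \<bar>u (x + w)\<bar> + ?R * (\<integral>\<^sup>+t. ?G (x + t *\<^sub>R w) \<partial>seg 1) \<partial>on_ball w0 \<rho>)"
        using ae \<open>x \<in> U\<close> by (intro nn_integral_mono_AE) simp
      also have "\<dots> = (\<integral>\<^sup>+w. ennreal \<bar>u (x + w)\<bar> \<partial>on_ball w0 \<rho>) + ?R * (\<integral>\<^sup>+w. (\<integral>\<^sup>+t. ?G (x + t *\<^sub>R w) \<partial>seg 1) \<partial>on_ball w0 \<rho>)"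
        by (subst nn_integral_add) (auto simp: nn_integral_cmult)
      also have "(\<integral>\<^sup>+w. (\<integral>\<^sup>+t. ?G (x + t *\<^sub>R w) \<partial>seg 1) \<partial>on_ball w0 \<rho>) = cone_potential w0 \<rho> ?G x"
        unfolding cone_potential_def by (rule WS.Fubini'[symmetric]) measurable
      also have "(\<integral>\<^sup>+w. ennreal \<bar>u (x + w)\<bar> \<partial>on_ball w0 \<rho>) \<le> (\<integral>\<^sup>+w. ennreal \<bar>u (x + w)\<bar> \<partial>lborel)"
        by (rule nn_integral_on_ball_le) measurable
      also have "\<dots> = (\<integral>\<^sup>+y. ennreal \<bar>u y\<bar> \<partial>lborel)"
        using lborel_translate(3)[of "\<lambda>_. 0" "\<lambda>y. ennreal \<bar>u y\<bar>" x] by (simp add: add.commute)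
      finally show "emeasure (on_ball w0 \<rho>) UNIV * ennreal \<bar>u x\<bar>
        \<le> (\<integral>\<^sup>+y. ennreal \<bar>u y\<bar> \<partial>lborel) + ?R * cone_potential w0 \<rho> ?G x"
        by (simp add: add_right_mono)
    qed
  qed
qed

lemma sum_power_le:
  fixes a :: "'i::finite \<Rightarrow> ennreal"
  shows "(\<Sum>i\<in>UNIV. a i) ^ n \<le> of_nat CARD('i) ^ n * (\<Sum>i\<in>UNIV. a i ^ n)"
proof -
  have "Max (range a) \<in> range a"
    by (rule Max_in) auto
  then obtain j where "Max (range a) = a j" by blast
  then have j: "a i \<le> a j" for i
    using Max_ge[of "range a" "a i"] by simp
  have "(\<Sum>i\<in>UNIV. a i) \<le> of_nat CARD('i) * a j"
    using sum_bounded_above[of UNIV a "a j"] j by simp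
  then have "(\<Sum>i\<in>UNIV. a i) ^ n \<le> (of_nat CARD('i) * a j) ^ n"
    by (rule power_mono) simp
  also have "\<dots> \<le> of_nat CARD('i) ^ n * (\<Sum>i\<in>UNIV. a i ^ n)"
    unfolding power_mult_distrib by (intro mult_left_mono member_le_sum) auto
  finally show ?thesis .
qed

lemma power4_add_le:
  fixes a b :: ennreal
  shows "(a + b) ^ 4 \<le> 16 * (a ^ 4 + b ^ 4)"
  using sum_power_le[of "\<lambda>i::bool. if i then a else b" 4] by (simp add: UNIV_bool add.commute)

lemma grad_size_power_finite:
  assumes [measurable]: "\<And>i. g i \<in> borel_measurable borel"
    and fin: "\<And>i. (\<integral>\<^sup>+x. ennreal \<bar>g i x\<bar> ^ n \<partial>lborel) < \<infinity>"
  shows "(\<integral>\<^sup>+x. grad_size g x ^ n \<partial>lborel) < \<infinity>"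
proof -
  have "(\<integral>\<^sup>+x. grad_size g x ^ n \<partial>lborel) \<le> (\<integral>\<^sup>+x. of_nat CARD(3) ^ n * (\<Sum>i\<in>UNIV. ennreal \<bar>g i x\<bar> ^ n) \<partial>lborel)"
    unfolding grad_size_def by (intro nn_integral_mono sum_power_le)
  also have "\<dots> = of_nat CARD(3) ^ n * (\<Sum>i\<in>UNIV. \<integral>\<^sup>+x. ennreal \<bar>g i x\<bar> ^ n \<partial>lborel)"
    by (subst nn_integral_cmult) (auto intro!: nn_integral_sum arg_cong2[where f="(*)"])
  also have "\<dots> < \<infinity>"
    using fin by (auto simp: ennreal_mult_less_top power_less_top_ennreal)
  finally show ?thesis .
qed

lemma finite_cover_closure:
  fixes \<Omega> :: "'a::euclidean_space set"
  assumes "bounded \<Omega>" and loc: "\<And>p. p \<in> closure \<Omega> \<Longrightarrow> \<exists>r>0. P (\<Omega> \<inter> ball p r)"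
  obtains \<U> where "finite \<U>" "\<And>U. U \<in> \<U> \<Longrightarrow> P U" "\<Omega> \<subseteq> \<Union>\<U>"
proof -
  obtain r where r: "\<And>p. p \<in> closure \<Omega> \<Longrightarrow> r p > 0 \<and> P (\<Omega> \<inter> ball p (r p))"
    using loc by metis
  have "compact (closure \<Omega>)"
    using \<open>bounded \<Omega>\<close> by (simp add: compact_eq_bounded_closed bounded_closure)
  moreover have "closure \<Omega> \<subseteq> (\<Union>p\<in>closure \<Omega>. ball p (r p))"
    using r by auto
  ultimately obtain C where C: "C \<subseteq> closure \<Omega>" "finite C" "closure \<Omega> \<subseteq> (\<Union>p\<in>C. ball p (r p))"
    using compactE_image[of "closure \<Omega>" "closure \<Omega>" "\<lambda>p. ball p (r p)"] by auto
  show ?thesis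
  proof (rule that[of "(\<lambda>p. \<Omega> \<inter> ball p (r p)) ` C"])
    show "\<Omega> \<subseteq> \<Union> ((\<lambda>p. \<Omega> \<inter> ball p (r p)) ` C)"
      using C(3) subset_trans[OF closure_subset C(3)] by auto
  qed (use C r in auto)
qed

text \<open>The form in which the estimate by cones is used: only the finiteness of the constants matters.\<close>

definition cone_bound :: "(real^3 \<Rightarrow> real) \<Rightarrow> (3 \<Rightarrow> real^3 \<Rightarrow> real) \<Rightarrow> (real^3) set \<Rightarrow> bool" where
  "cone_bound u g U \<longleftrightarrow> open U \<and> (\<exists>c w0 \<rho> I R. 0 < c \<and> c < \<infinity> \<and> I < \<infinity> \<and> R < \<infinity> \<and>
     (AE x in lborel. x \<in> U \<longrightarrow> c * ennreal \<bar>u x\<bar> \<le> I + R * cone_potential w0 \<rho> (grad_size g) x))"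

lemma cone_representation_cover:
  assumes \<Omega>: "bounded_smooth_domain \<Omega>"
    and u: "integrable lborel u" and g: "\<And>i. integrable lborel (g i)"
    and wd: "\<And>i. weak_dir \<Omega> (axis i 1) u (g i)"
  obtains \<U> where "finite \<U>" "\<Omega> \<subseteq> \<Union>\<U>"
    "\<And>U. U \<in> \<U> \<Longrightarrow> U \<subseteq> \<Omega> \<and> cone_bound u g U"
proof -
  have \<Omega>': "bounded \<Omega>" "open \<Omega>" using \<Omega> by (simp_all add: bounded_smooth_domain_def)
  have I: "(\<integral>\<^sup>+y. ennreal \<bar>u y\<bar> \<partial>lborel) < \<infinity>"
    using u by (simp add: integrable_iff_bounded)
  have "\<exists>r>0. \<Omega> \<inter> ball p r \<subseteq> \<Omega> \<and> cone_bound u g (\<Omega> \<inter> ball p r)" if "p \<in> closure \<Omega>" for p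
  proof -
    from cone_property[OF \<Omega> that] obtain r w0 \<rho> where r: "r > 0" "\<rho> > 0" and cone:
      "\<And>x w t. x \<in> \<Omega> \<inter> ball p r \<Longrightarrow> w \<in> ball w0 \<rho> \<Longrightarrow> t \<in> {0..1} \<Longrightarrow> x + t *\<^sub>R w \<in> \<Omega>"
      by meson
    have op: "open (\<Omega> \<inter> ball p r)" using \<Omega>' by auto
    have "AE x in lborel. x \<in> \<Omega> \<inter> ball p r \<longrightarrow> emeasure (on_ball w0 \<rho>) UNIV * ennreal \<bar>u x\<bar>
      \<le> (\<integral>\<^sup>+y. ennreal \<bar>u y\<bar> \<partial>lborel) + ennreal (norm w0 + \<bar>\<rho>\<bar>) * cone_potential w0 \<rho> (grad_size g) x"
      by (rule cone_representation[OF u g wd op _ cone]) auto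
    moreover have "ennreal (norm w0 + \<bar>\<rho>\<bar>) < \<infinity>"
      by simp
    ultimately have "cone_bound u g (\<Omega> \<inter> ball p r)"
      unfolding cone_bound_def using op emeasure_on_ball_pos[OF r(2)] emeasure_on_ball_finite I by blast
    then show ?thesis using r(1) by blast
  qed
  then show thesis
    using finite_cover_closure[OF \<Omega>'(1), of "\<lambda>U. U \<subseteq> \<Omega> \<and> cone_bound u g U" thesis] that by simp
qed

text \<open>On each of finitely many pieces of \<open>\<Omega>\<close>, \<open>u\<close> is bounded by a constant plus a potential of its gradient, and
  the potential lies in \<open>L^4\<close>. Boundedness of \<open>\<Omega>\<close> takes care of the constant.\<close>

theorem Sobolev_embedding_L4:
  assumes \<Omega>: "bounded_smooth_domain \<Omega>"
    and u: "integrable lborel u" "\<And>x. x \<notin> \<Omega> \<Longrightarrow> u x = 0" and g: "\<And>i. integrable lborel (g i)"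
    and wd: "\<And>i. weak_dir \<Omega> (axis i 1) u (g i)"
    and fin: "\<And>i. (\<integral>\<^sup>+x. ennreal \<bar>g i x\<bar> ^ 2 \<partial>lborel) < \<infinity>"
  shows "(\<integral>\<^sup>+x. ennreal \<bar>u x\<bar> ^ 4 \<partial>lborel) < \<infinity>"
proof -
  note [measurable] = borel_measurable_integrable[OF u(1), simplified] borel_measurable_integrable[OF g, simplified]
  obtain \<U> where \<U>: "finite \<U>" "\<Omega> \<subseteq> \<Union>\<U>" and
    rep: "\<And>U. U \<in> \<U> \<Longrightarrow> U \<subseteq> \<Omega> \<and> cone_bound u g U"
    using cone_representation_cover[OF \<Omega> u(1) g wd] by blast
  have loc: "(\<integral>\<^sup>+x. ennreal \<bar>u x\<bar> ^ 4 * indicator U x \<partial>lborel) < \<infinity>" if "U \<in> \<U>" for U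
  proof -
    from rep[OF that, unfolded cone_bound_def] obtain c w0 \<rho> I R where U: "U \<subseteq> \<Omega>" "open U" and c: "0 < c" "c < \<infinity>" "I < \<infinity>" "R < \<infinity>" and
      le: "AE x in lborel. x \<in> U \<longrightarrow> c * ennreal \<bar>u x\<bar> \<le> I + R * cone_potential w0 \<rho> (grad_size g) x"
      by blast
    have [measurable]: "U \<in> sets borel" using U by simp
    let ?A = "cone_potential w0 \<rho> (grad_size g)"
    have Ufin: "emeasure lborel U < \<infinity>"
      using \<Omega> U bounded_subset emeasure_bounded_finite unfolding bounded_smooth_domain_def by blast
    have "c ^ 4 * (\<integral>\<^sup>+x. ennreal \<bar>u x\<bar> ^ 4 * indicator U x \<partial>lborel)
        = (\<integral>\<^sup>+x. (c * ennreal \<bar>u x\<bar>) ^ 4 * indicator U x \<partial>lborel)"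
      by (subst nn_integral_cmult[symmetric]) (auto simp: power_mult_distrib mult.assoc)
    also have "\<dots> \<le> (\<integral>\<^sup>+x. 16 * I ^ 4 * indicator U x + 16 * R ^ 4 * ?A x ^ 4 \<partial>lborel)"
    proof (rule nn_integral_mono_AE)
      show "AE x in lborel. (c * ennreal \<bar>u x\<bar>) ^ 4 * indicator U x \<le> 16 * I ^ 4 * indicator U x + 16 * R ^ 4 * ?A x ^ 4"
        using le
      proof eventually_elim
        fix x assume le: "x \<in> U \<longrightarrow> c * ennreal \<bar>u x\<bar> \<le> I + R * ?A x"
        show "(c * ennreal \<bar>u x\<bar>) ^ 4 * indicator U x \<le> 16 * I ^ 4 * indicator U x + 16 * R ^ 4 * ?A x ^ 4"
        proof (cases "x \<in> U")
          case True
          then have "(c * ennreal \<bar>u x\<bar>) ^ 4 \<le> (I + R * ?A x) ^ 4"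
            using le by (intro power_mono) auto
          also have "\<dots> \<le> 16 * (I ^ 4 + (R * ?A x) ^ 4)"
            by (rule power4_add_le)
          finally show ?thesis using True by (simp add: power_mult_distrib distrib_left mult.assoc)
        qed simp
      qed
    qed
    also have "\<dots> = 16 * I ^ 4 * emeasure lborel U + 16 * R ^ 4 * (\<integral>\<^sup>+x. ?A x ^ 4 \<partial>lborel)"
      by (subst nn_integral_add) (auto simp: nn_integral_cmult)
    also have "\<dots> < \<infinity>"
    proof -
      have "(\<integral>\<^sup>+x. ?A x ^ 4 \<partial>lborel) \<le> 256 * emeasure (on_ball w0 \<rho>) UNIV ^ 3 * (\<integral>\<^sup>+y. (grad_size g y)\<^sup>2 \<partial>lborel)\<^sup>2"
        by (rule cone_potential_L4) measurable
      also have "\<dots> < \<infinity>"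
        using grad_size_power_finite[of g 2, OF _ fin] emeasure_on_ball_finite[of w0 \<rho>]
        by (simp add: ennreal_mult_less_top power_less_top_ennreal)
      finally show ?thesis
        using c Ufin by (simp add: ennreal_mult_less_top power_less_top_ennreal)
    qed
    finally show ?thesis
      using c by (auto simp: ennreal_mult_less_top)
  qed
  have "(\<integral>\<^sup>+x. ennreal \<bar>u x\<bar> ^ 4 \<partial>lborel) \<le> (\<integral>\<^sup>+x. (\<Sum>U\<in>\<U>. ennreal \<bar>u x\<bar> ^ 4 * indicator U x) \<partial>lborel)"
  proof (rule nn_integral_mono)
    fix x
    show "ennreal \<bar>u x\<bar> ^ 4 \<le> (\<Sum>U\<in>\<U>. ennreal \<bar>u x\<bar> ^ 4 * indicator U x)"
    proof (cases "x \<in> \<Omega>")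
      case True
      then obtain U where "U \<in> \<U>" "x \<in> U" using \<U>(2) by blast
      then show ?thesis
        using member_le_sum[of U \<U> "\<lambda>U. ennreal \<bar>u x\<bar> ^ 4 * indicator U x"] \<U>(1) by simp
    qed (simp add: u(2))
  qed
  also have "\<dots> = (\<Sum>U\<in>\<U>. \<integral>\<^sup>+x. ennreal \<bar>u x\<bar> ^ 4 * indicator U x \<partial>lborel)"
    using rep by (intro nn_integral_sum) (auto simp: cone_bound_def intro!: borel_measurable_times_ennreal borel_measurable_indicator)
  also have "\<dots> < \<infinity>"
    using loc \<U>(1) by simp
  finally show ?thesis .
qed

text \<open>The same estimate, with the boundedness of potentials of \<open>L^4\<close> functions.\<close>

theorem Sobolev_embedding_bounded:
  assumes \<Omega>: "bounded_smooth_domain \<Omega>"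
    and u: "integrable lborel u" "\<And>x. x \<notin> \<Omega> \<Longrightarrow> u x = 0" and g: "\<And>i. integrable lborel (g i)"
    and wd: "\<And>i. weak_dir \<Omega> (axis i 1) u (g i)"
    and fin: "\<And>i. (\<integral>\<^sup>+x. ennreal \<bar>g i x\<bar> ^ 4 \<partial>lborel) < \<infinity>"
  shows "\<exists>C. AE x in lborel. \<bar>u x\<bar> \<le> C"
proof -
  note [measurable] = borel_measurable_integrable[OF u(1), simplified] borel_measurable_integrable[OF g, simplified]
  obtain \<U> where \<U>: "finite \<U>" "\<Omega> \<subseteq> \<Union>\<U>" and
    rep: "\<And>U. U \<in> \<U> \<Longrightarrow> U \<subseteq> \<Omega> \<and> cone_bound u g U"
    using cone_representation_cover[OF \<Omega> u(1) g wd] by blast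
  have "\<exists>K. K < \<infinity> \<and> (AE x in lborel. x \<in> U \<longrightarrow> ennreal \<bar>u x\<bar> \<le> K)" if "U \<in> \<U>" for U
  proof -
    from rep[OF that, unfolded cone_bound_def] obtain c w0 \<rho> I R where c: "0 < c" "c < \<infinity>" "I < \<infinity>" "R < \<infinity>" and
      le: "AE x in lborel. x \<in> U \<longrightarrow> c * ennreal \<bar>u x\<bar> \<le> I + R * cone_potential w0 \<rho> (grad_size g) x"
      by blast
    let ?A = "cone_potential w0 \<rho> (grad_size g)"
    define L where "L = 256 * emeasure (on_ball w0 \<rho>) UNIV ^ 3 * (\<integral>\<^sup>+y. grad_size g y ^ 4 \<partial>lborel)"
    have L: "L < \<infinity>"
      unfolding L_def using grad_size_power_finite[of g 4, OF _ fin] emeasure_on_ball_finite[of w0 \<rho>]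
      by (simp add: ennreal_mult_less_top power_less_top_ennreal)
    \<comment> \<open>A crude substitute for the fourth root: a number above \<open>1\<close> is at most its fourth power.\<close>
    have A: "?A x \<le> 1 + L" for x
    proof (cases "?A x \<le> 1")
      case False
      then have "?A x ^ 1 \<le> ?A x ^ 4" by (intro power_increasing) auto
      also have "\<dots> \<le> L" unfolding L_def by (rule cone_potential_bounded) measurable
      finally show ?thesis by (simp add: add_increasing)
    qed (simp add: add_increasing2)
    have "AE x in lborel. x \<in> U \<longrightarrow> ennreal \<bar>u x\<bar> \<le> (I + R * (1 + L)) / c"
      using le
    proof eventually_elim
      fix x assume le: "x \<in> U \<longrightarrow> c * ennreal \<bar>u x\<bar> \<le> I + R * ?A x"
      have "I + R * ?A x \<le> I + R * (1 + L)"
        by (intro add_left_mono mult_left_mono A) simp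
      with le have "x \<in> U \<longrightarrow> ennreal \<bar>u x\<bar> * c \<le> I + R * (1 + L)"
        unfolding mult.commute[of _ c] by (blast intro: order_trans)
      then show "x \<in> U \<longrightarrow> ennreal \<bar>u x\<bar> \<le> (I + R * (1 + L)) / c"
        using c divide_right_mono_ennreal[of "ennreal \<bar>u x\<bar> * c" _ c] mult_divide_eq_ennreal[of c "ennreal \<bar>u x\<bar>"]
        by auto
    qed
    moreover have "(I + R * (1 + L)) / c < \<infinity>"
      using c L by (simp add: ennreal_divide_eq_top_iff ennreal_mult_less_top less_top[symmetric] ennreal_mult_eq_top_iff zero_less_iff_neq_zero)
    ultimately show ?thesis by blast
  qed
  then obtain K where K: "\<And>U. U \<in> \<U> \<Longrightarrow> K U < \<infinity> \<and> (AE x in lborel. x \<in> U \<longrightarrow> ennreal \<bar>u x\<bar> \<le> K U)"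
    by metis
  have fin: "(\<Sum>U\<in>\<U>. K U) < \<infinity>"
    using K \<U>(1) by simp
  have "AE x in lborel. \<forall>U\<in>\<U>. x \<in> U \<longrightarrow> ennreal \<bar>u x\<bar> \<le> K U"
    using K \<U>(1) by (intro AE_finite_allI) auto
  then have "AE x in lborel. \<bar>u x\<bar> \<le> enn2real (\<Sum>U\<in>\<U>. K U)"
  proof eventually_elim
    fix x assume *: "\<forall>U\<in>\<U>. x \<in> U \<longrightarrow> ennreal \<bar>u x\<bar> \<le> K U"
    show "\<bar>u x\<bar> \<le> enn2real (\<Sum>U\<in>\<U>. K U)"
    proof (cases "x \<in> \<Omega>")
      case True
      then obtain U where U: "U \<in> \<U>" "x \<in> U" using \<U>(2) by blast
      have "ennreal \<bar>u x\<bar> \<le> K U" using * U by blast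
      also have "K U \<le> (\<Sum>U\<in>\<U>. K U)"
        using U(1) \<U>(1) by (intro member_le_sum) auto
      finally have "enn2real (ennreal \<bar>u x\<bar>) \<le> enn2real (\<Sum>U\<in>\<U>. K U)"
        using fin by (intro enn2real_mono) auto
      then show ?thesis by simp
    qed (simp add: u(2))
  qed
  then show ?thesis by blast
qed

section \<open>The algebra property\<close>

text \<open>Square integrable Borel functions on \<open>\<Omega>\<close>, extended by zero, and the corresponding Sobolev spaces. The
  recursion on the order, by first derivatives only, is the form in which Leibniz' rule can be iterated.\<close>

definition L2_zero :: "(real^3) set \<Rightarrow> (real^3 \<Rightarrow> real) \<Rightarrow> bool" where
  "L2_zero \<Omega> u \<longleftrightarrow> u \<in> borel_measurable borel \<and> (\<forall>x. x \<notin> \<Omega> \<longrightarrow> u x = 0) \<and> integrable lborel (\<lambda>x. u x * u x)"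

fun H_zero :: "nat \<Rightarrow> (real^3) set \<Rightarrow> (real^3 \<Rightarrow> real) \<Rightarrow> bool" where
  "H_zero 0 \<Omega> u \<longleftrightarrow> L2_zero \<Omega> u"
| "H_zero (Suc m) \<Omega> u \<longleftrightarrow> L2_zero \<Omega> u \<and>
     (\<forall>i. \<exists>g. H_zero m \<Omega> g \<and> weak_dir \<Omega> (axis i 1) u g)"

lemma L2_zero_integrable:
  assumes "bounded_smooth_domain \<Omega>" and u: "L2_zero \<Omega> u"
  shows "integrable lborel u"
proof -
  have \<Omega>: "open \<Omega>" "bounded \<Omega>" using assms(1) by (simp_all add: bounded_smooth_domain_def)
  then have [measurable]: "\<Omega> \<in> sets borel" by simp
  have [measurable]: "u \<in> borel_measurable borel" using u by (simp add: L2_zero_def)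
  have "emeasure lborel \<Omega> < \<infinity>" using \<Omega>(2) emeasure_bounded_finite by blast
  then have "integrable lborel (indicator \<Omega> :: real^3 \<Rightarrow> real)"
    by (simp add: integrable_indicator_iff)
  moreover have "(\<lambda>x. indicator \<Omega> x * indicator \<Omega> x :: real) = indicator \<Omega>"
    by (auto simp: indicator_def)
  ultimately have "integrable lborel (\<lambda>x. indicator \<Omega> x * indicator \<Omega> x :: real)"
    by simp
  then have "integrable lborel (\<lambda>x. u x * indicator \<Omega> x)"
    by (rule integrable_mult_squares[rotated 3]) (use u in \<open>simp_all add: L2_zero_def\<close>)
  moreover have "(\<lambda>x. u x * indicator \<Omega> x) = u"
    using u by (auto simp: fun_eq_iff L2_zero_def indicator_def)
  ultimately show ?thesis by simp
qed

lemma L2_zero_lincomb: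
  assumes "L2_zero \<Omega> u" "L2_zero \<Omega> v"
  shows "L2_zero \<Omega> (\<lambda>x. a * u x + b * v x)"
proof -
  have [measurable]: "u \<in> borel_measurable borel" "v \<in> borel_measurable borel"
    using assms by (simp_all add: L2_zero_def)
  have "integrable lborel (\<lambda>x. u x * v x)"
    by (rule integrable_mult_squares) (use assms in \<open>simp_all add: L2_zero_def\<close>)
  moreover have "(\<lambda>x. (a * u x + b * v x) * (a * u x + b * v x))
      = (\<lambda>x. a * a * (u x * u x) + b * b * (v x * v x) + 2 * a * b * (u x * v x))"
    by (simp add: fun_eq_iff algebra_simps)
  ultimately show ?thesis
    using assms by (simp add: L2_zero_def)
qed

lemma L2_zero_mult_bounded:
  assumes u: "L2_zero \<Omega> u" and [measurable]: "v \<in> borel_measurable borel" and v: "AE x in lborel. \<bar>v x\<bar> \<le> C"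
  shows "L2_zero \<Omega> (\<lambda>x. u x * v x)"
proof -
  have [measurable]: "u \<in> borel_measurable borel" using u by (simp add: L2_zero_def)
  have "integrable lborel (\<lambda>x. u x * v x * (u x * v x))"
  proof (rule Bochner_Integration.integrable_bound)
    show "integrable lborel (\<lambda>x. C\<^sup>2 * (u x * u x))" using u by (simp add: L2_zero_def)
    show "AE x in lborel. norm (u x * v x * (u x * v x)) \<le> norm (C\<^sup>2 * (u x * u x))"
      using v
    proof eventually_elim
      fix x assume "\<bar>v x\<bar> \<le> C"
      then have "(v x)\<^sup>2 \<le> C\<^sup>2"
        using abs_le_square_iff[of "v x" C] by auto
      then have "(v x)\<^sup>2 * (u x * u x) \<le> C\<^sup>2 * (u x * u x)"
        by (rule mult_right_mono) simp
      then show "norm (u x * v x * (u x * v x)) \<le> norm (C\<^sup>2 * (u x * u x))"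
        by (simp add: abs_mult power2_eq_square mult_ac)
    qed
  qed simp
  then show ?thesis using u by (simp add: L2_zero_def)
qed

lemma L2_zero_mult_L4:
  assumes u: "L2_zero \<Omega> u" "(\<integral>\<^sup>+x. ennreal \<bar>u x\<bar> ^ 4 \<partial>lborel) < \<infinity>"
    and v: "L2_zero \<Omega> v" "(\<integral>\<^sup>+x. ennreal \<bar>v x\<bar> ^ 4 \<partial>lborel) < \<infinity>"
  shows "L2_zero \<Omega> (\<lambda>x. u x * v x)"
proof -
  have [measurable]: "u \<in> borel_measurable borel" "v \<in> borel_measurable borel"
    using u v by (simp_all add: L2_zero_def)
  have 4: "integrable lborel (\<lambda>x. (f x * f x) * (f x * f x))"
    if [measurable]: "f \<in> borel_measurable borel" and "(\<integral>\<^sup>+x. ennreal \<bar>f x\<bar> ^ 4 \<partial>lborel) < \<infinity>" for f :: "real^3 \<Rightarrow> real"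
  proof (rule integrableI_bounded)
    have "norm (f x * f x * (f x * f x)) = \<bar>f x\<bar> ^ 4" for x
      by (simp add: power4_eq_xxxx abs_mult mult.assoc)
    then have "ennreal (norm (f x * f x * (f x * f x))) = ennreal \<bar>f x\<bar> ^ 4" for x
      by (simp add: ennreal_power)
    then show "(\<integral>\<^sup>+x. ennreal (norm (f x * f x * (f x * f x))) \<partial>lborel) < \<infinity>"
      using that(2) by simp
  qed simp
  have "integrable lborel (\<lambda>x. (u x * u x) * (v x * v x))"
    by (rule integrable_mult_squares) (use 4[of u] 4[of v] u v in auto)
  then have "integrable lborel (\<lambda>x. u x * v x * (u x * v x))"
    by (simp add: mult_ac)
  then show ?thesis using u by (simp add: L2_zero_def)
qed

lemma H_zero_L2_zero: "H_zero m \<Omega> u \<Longrightarrow> L2_zero \<Omega> u"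
  by (cases m) simp_all

lemma H_zero_Suc_imp: "H_zero (Suc m) \<Omega> u \<Longrightarrow> H_zero m \<Omega> u"
proof (induction m arbitrary: u)
  case (Suc m)
  then show ?case by (metis H_zero.simps(2))
qed simp

lemma H_zero_mono: "H_zero n \<Omega> u \<Longrightarrow> m \<le> n \<Longrightarrow> H_zero m \<Omega> u"
  by (induction n) (auto simp: le_Suc_eq H_zero_Suc_imp simp del: H_zero.simps(2))

lemma H_zero_lincomb:
  assumes "bounded_smooth_domain \<Omega>" "H_zero m \<Omega> u" "H_zero m \<Omega> v"
  shows "H_zero m \<Omega> (\<lambda>x. a * u x + b * v x)"
  using assms(2,3)
proof (induction m arbitrary: u v)
  case 0
  then show ?case by (simp add: L2_zero_lincomb)
next
  case (Suc m)
  have "\<exists>g. H_zero m \<Omega> g \<and> weak_dir \<Omega> (axis i 1) (\<lambda>x. a * u x + b * v x) g" for i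
  proof -
    obtain g k where "H_zero m \<Omega> g" "weak_dir \<Omega> (axis i 1) u g" "H_zero m \<Omega> k" "weak_dir \<Omega> (axis i 1) v k"
      using Suc.prems by fastforce
    then show ?thesis
      using weak_dir_add[of u g v k \<Omega> "axis i 1" a b] Suc.IH[of g k] L2_zero_integrable[OF assms(1)]
        Suc.prems H_zero_L2_zero by blast
  qed
  then show ?case
    using Suc.prems by (simp add: L2_zero_lincomb)
qed

lemma L2_zero_nn_integral:
  assumes "L2_zero \<Omega> u"
  shows "(\<integral>\<^sup>+x. ennreal \<bar>u x\<bar> ^ 2 \<partial>lborel) < \<infinity>"
proof -
  have "(\<integral>\<^sup>+x. ennreal (norm (u x * u x)) \<partial>lborel) < \<infinity>"
    using assms by (simp add: L2_zero_def integrable_iff_bounded)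
  moreover have "ennreal (norm (u x * u x)) = ennreal \<bar>u x\<bar> ^ 2" for x
    by (simp add: ennreal_power) (simp add: power2_eq_square)
  ultimately show ?thesis by simp
qed

lemma H_zero_1_L4:
  assumes \<Omega>: "bounded_smooth_domain \<Omega>" and u: "H_zero (Suc 0) \<Omega> u"
  shows "(\<integral>\<^sup>+x. ennreal \<bar>u x\<bar> ^ 4 \<partial>lborel) < \<infinity>"
proof -
  obtain g where g: "\<And>i. L2_zero \<Omega> (g i)" "\<And>i. weak_dir \<Omega> (axis i 1) u (g i)"
    using u by (simp, metis)
  show ?thesis
    by (rule Sobolev_embedding_L4[OF \<Omega> L2_zero_integrable[OF \<Omega>] _ L2_zero_integrable[OF \<Omega> g(1)] g(2) L2_zero_nn_integral[OF g(1)]])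
      (use u in \<open>auto simp: L2_zero_def\<close>)
qed

lemma H_zero_2_bounded:
  assumes \<Omega>: "bounded_smooth_domain \<Omega>" and u: "H_zero (Suc (Suc 0)) \<Omega> u"
  shows "\<exists>C. AE x in lborel. \<bar>u x\<bar> \<le> C"
proof -
  obtain g where g: "\<And>i. H_zero (Suc 0) \<Omega> (g i)" "\<And>i. weak_dir \<Omega> (axis i 1) u (g i)"
    using u unfolding H_zero.simps(2)[of "Suc 0"] by metis
  show ?thesis
    by (rule Sobolev_embedding_bounded[OF \<Omega> L2_zero_integrable[OF \<Omega>] _ L2_zero_integrable[OF \<Omega> H_zero_L2_zero[OF g(1)]]
          g(2) H_zero_1_L4[OF \<Omega> g(1)]])
      (use u in \<open>auto simp: L2_zero_def\<close>)
qed

text \<open>Leibniz' rule reduces the claim for \<open>Suc m\<close> to the products \<open>(\<partial>u) v\<close> and \<open>u (\<partial>v)\<close> of order \<open>m\<close>. For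
  \<open>m \<ge> 1\<close> the undifferentiated factor still has two derivatives, so that the induction hypothesis applies;
  for \<open>m = 0\<close> the second product is handled by the embedding into \<open>L^4\<close>. The base case is the boundedness of
  \<open>v\<close>.\<close>

theorem H_zero_mult:
  assumes \<Omega>: "bounded_smooth_domain \<Omega>"
    and "H_zero m \<Omega> u" "H_zero (max m 2) \<Omega> v"
  shows "H_zero m \<Omega> (\<lambda>x. u x * v x)"
  using assms(2,3)
proof (induction m arbitrary: u v)
  case 0
  then have "H_zero (Suc (Suc 0)) \<Omega> v" by (simp add: numeral_2_eq_2)
  then obtain C where "AE x in lborel. \<bar>v x\<bar> \<le> C" using H_zero_2_bounded[OF \<Omega>] by blast
  moreover have "v \<in> borel_measurable borel"
    using H_zero_L2_zero[OF 0(2)] by (simp add: L2_zero_def)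
  ultimately show ?case
    using 0(1) by (simp add: L2_zero_mult_bounded)
next
  case (Suc m)
  have v2: "H_zero (Suc (Suc 0)) \<Omega> v"
    using Suc.prems(2) by (rule H_zero_mono) simp
  then obtain C where C: "AE x in lborel. \<bar>v x\<bar> \<le> C" using H_zero_2_bounded[OF \<Omega>] by blast
  have vm: "v \<in> borel_measurable borel" using H_zero_L2_zero[OF v2] by (simp add: L2_zero_def)
  have "\<exists>q. H_zero m \<Omega> q \<and> weak_dir \<Omega> (axis i 1) (\<lambda>x. u x * v x) q" for i
  proof -
    obtain g where g: "H_zero m \<Omega> g" "weak_dir \<Omega> (axis i 1) u g"
      using Suc.prems(1) by auto
    have "H_zero (Suc (max m 1)) \<Omega> v"
      using Suc.prems(2) by (rule H_zero_mono) auto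
    then obtain k where k: "H_zero (max m 1) \<Omega> k" "weak_dir \<Omega> (axis i 1) v k"
      by auto
    have L: "L2_zero \<Omega> u" "L2_zero \<Omega> g" "L2_zero \<Omega> v" "L2_zero \<Omega> k"
      using Suc.prems g k v2 H_zero_L2_zero by blast+
    have "weak_dir \<Omega> (axis i 1) (\<lambda>x. u x * v x) (\<lambda>x. g x * v x + u x * k x)"
      by (rule weak_dir_mult[OF L2_zero_integrable[OF \<Omega> L(1)] L2_zero_integrable[OF \<Omega> L(2)]
            L2_zero_integrable[OF \<Omega> L(3)] L2_zero_integrable[OF \<Omega> L(4)]])
        (use L g(2) k(2) \<Omega> in \<open>simp_all add: L2_zero_def bounded_smooth_domain_def\<close>)
    moreover have "H_zero (max m 2) \<Omega> v"
      using Suc.prems(2) by (rule H_zero_mono) auto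
    then have gv: "H_zero m \<Omega> (\<lambda>x. g x * v x)"
      by (rule Suc.IH[OF g(1)])
    moreover have "H_zero m \<Omega> (\<lambda>x. u x * k x)"
    proof (cases m)
      case 0
      have "H_zero (Suc 0) \<Omega> u" "H_zero (Suc 0) \<Omega> k"
        using Suc.prems(1) k(1) 0 by simp_all
      then show ?thesis
        using 0 L2_zero_mult_L4[OF L(1) _ L(4)] H_zero_1_L4[OF \<Omega>] by simp
    next
      case (Suc m')
      have "H_zero m \<Omega> k"
        using k(1) by (rule H_zero_mono) simp
      moreover have "H_zero (max m 2) \<Omega> u"
        using Suc.prems(1) by (rule H_zero_mono) (use Suc in simp)
      ultimately have "H_zero m \<Omega> (\<lambda>x. k x * u x)"
        by (rule Suc.IH)
      then show ?thesis by (simp add: mult.commute)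
    qed
    ultimately show ?thesis
      using H_zero_lincomb[OF \<Omega> gv, of "\<lambda>x. u x * k x" 1 1] by auto
  qed
  then show ?case
    using L2_zero_mult_bounded[OF _ vm C] H_zero_L2_zero[OF Suc.prems(1)] by simp
qed

section \<open>Borel representatives\<close>

text \<open>A Lebesgue measurable function on \<open>\<Omega>\<close> is replaced by a Borel function on the whole space that vanishes
  outside \<open>\<Omega>\<close>. Translations and Fubini's theorem then stay within Borel measurability.\<close>

definition Borel_rep :: "(real^3) set \<Rightarrow> (real^3 \<Rightarrow> real) \<Rightarrow> (real^3 \<Rightarrow> real) \<Rightarrow> bool" where
  "Borel_rep \<Omega> u u' \<longleftrightarrow> u' \<in> borel_measurable borel \<and> (\<forall>x. x \<notin> \<Omega> \<longrightarrow> u' x = 0) \<and>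
     (AE x in lebesgue. x \<in> \<Omega> \<longrightarrow> u x = u' x)"

lemma Borel_rep_exists:
  assumes \<Omega>: "open \<Omega>" and u: "u \<in> borel_measurable (lebesgue_on \<Omega>)"
  shows "\<exists>u'. Borel_rep \<Omega> u u'"
proof -
  have [measurable]: "\<Omega> \<in> sets borel" using \<Omega> by simp
  have "(\<lambda>x. indicator \<Omega> x *\<^sub>R u x) \<in> borel_measurable lebesgue"
    using u by (subst (asm) borel_measurable_restrict_space_iff) (use \<Omega> in auto)
  then obtain v where v [measurable]: "v \<in> borel_measurable lborel" and ae: "AE x in lborel. indicator \<Omega> x *\<^sub>R u x = v x"
    using completion_ex_borel_measurable_real by blast
  have "AE x in lebesgue. indicator \<Omega> x *\<^sub>R u x = v x"
    using ae by (rule AE_completion)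
  then have "AE x in lebesgue. x \<in> \<Omega> \<longrightarrow> u x = indicator \<Omega> x * v x"
    by eventually_elim (auto simp: indicator_def)
  moreover have "(\<lambda>x. indicator \<Omega> x * v x) \<in> borel_measurable borel"
    using v by (simp only: measurable_lborel2) measurable
  ultimately show ?thesis
    unfolding Borel_rep_def by (intro exI[of _ "\<lambda>x. indicator \<Omega> x * v x"]) auto
qed

lemma Borel_rep_AE:
  assumes \<Omega>: "open \<Omega>" and r: "Borel_rep \<Omega> u u'"
  shows "AE x in lebesgue. indicator \<Omega> x *\<^sub>R u x = u' x"
    and "u' \<in> borel_measurable lebesgue"
    and "(\<lambda>x. indicator \<Omega> x *\<^sub>R u x) \<in> borel_measurable lebesgue"
proof -
  have "AE x in lebesgue. x \<in> \<Omega> \<longrightarrow> u x = u' x"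
    using r by (simp add: Borel_rep_def)
  then show ae: "AE x in lebesgue. indicator \<Omega> x *\<^sub>R u x = u' x"
    by eventually_elim (use r in \<open>auto simp: indicator_def Borel_rep_def\<close>)
  show m: "u' \<in> borel_measurable lebesgue"
    using r by (intro measurable_completion) (simp add: Borel_rep_def)
  have "AE x in lebesgue. u' x = indicator \<Omega> x *\<^sub>R u x"
    using ae by eventually_elim simp
  then show "(\<lambda>x. indicator \<Omega> x *\<^sub>R u x) \<in> borel_measurable lebesgue"
    by (rule borel_measurable_AE[OF m])
qed

lemma Borel_rep_integral:
  assumes \<Omega>: "open \<Omega>" and r: "Borel_rep \<Omega> u u'"
  shows "u \<in> borel_measurable (lebesgue_on \<Omega>)"
    and "(LINT x|lebesgue_on \<Omega>. u x) = (\<integral>x. u' x \<partial>lborel)"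
    and "integrable (lebesgue_on \<Omega>) u \<longleftrightarrow> integrable lborel u'"
proof -
  have \<Omega>l: "\<Omega> \<inter> space lebesgue \<in> sets lebesgue" using \<Omega> by auto
  note ae = Borel_rep_AE[OF \<Omega> r]
  have u': "u' \<in> borel_measurable lborel" using r by (simp add: Borel_rep_def)
  show "u \<in> borel_measurable (lebesgue_on \<Omega>)"
    unfolding borel_measurable_restrict_space_iff[OF \<Omega>l] by (rule ae(3))
  show "(LINT x|lebesgue_on \<Omega>. u x) = (\<integral>x. u' x \<partial>lborel)"
    unfolding integral_restrict_space[OF \<Omega>l] integral_cong_AE[OF ae(3,2,1)] by (rule integral_completion[OF u'])
  show "integrable (lebesgue_on \<Omega>) u \<longleftrightarrow> integrable lborel u'"
    unfolding integrable_restrict_space[OF \<Omega>l] integrable_cong_AE[OF ae(3,2,1)] by (rule integrable_completion[OF u'])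
qed

lemma Borel_rep_self: "L2_zero \<Omega> u \<Longrightarrow> Borel_rep \<Omega> u u"
  by (simp add: Borel_rep_def L2_zero_def)

lemma Borel_rep_mult:
  assumes "Borel_rep \<Omega> u u'" "Borel_rep \<Omega> v v'"
  shows "Borel_rep \<Omega> (\<lambda>x. u x * v x) (\<lambda>x. u' x * v' x)"
proof -
  have "AE x in lebesgue. x \<in> \<Omega> \<longrightarrow> u x = u' x" "AE x in lebesgue. x \<in> \<Omega> \<longrightarrow> v x = v' x"
    using assms by (simp_all add: Borel_rep_def)
  then have "AE x in lebesgue. x \<in> \<Omega> \<longrightarrow> u x * v x = u' x * v' x"
    by eventually_elim simp
  moreover have [measurable]: "u' \<in> borel_measurable borel" "v' \<in> borel_measurable borel"
    using assms by (simp_all add: Borel_rep_def)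
  ultimately show ?thesis using assms by (simp add: Borel_rep_def)
qed

lemma Borel_rep_lincomb:
  assumes "Borel_rep \<Omega> u u'" "Borel_rep \<Omega> v v'"
  shows "Borel_rep \<Omega> (\<lambda>x. a * u x + b * v x) (\<lambda>x. a * u' x + b * v' x)"
proof -
  have "AE x in lebesgue. x \<in> \<Omega> \<longrightarrow> u x = u' x" "AE x in lebesgue. x \<in> \<Omega> \<longrightarrow> v x = v' x"
    using assms by (simp_all add: Borel_rep_def)
  then have "AE x in lebesgue. x \<in> \<Omega> \<longrightarrow> a * u x + b * v x = a * u' x + b * v' x"
    by eventually_elim simp
  moreover have [measurable]: "u' \<in> borel_measurable borel" "v' \<in> borel_measurable borel"
    using assms by (simp_all add: Borel_rep_def)
  ultimately show ?thesis using assms by (simp add: Borel_rep_def)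
qed

lemma Borel_rep_mult_test:
  assumes r: "Borel_rep \<Omega> u u'" and \<phi>: "test_function \<Omega> \<phi>"
  shows "Borel_rep \<Omega> (\<lambda>x. u x * \<phi> x) (\<lambda>x. u' x * \<phi> x)"
proof (rule Borel_rep_mult[OF r])
  show "Borel_rep \<Omega> \<phi> \<phi>"
    using test_function_measurable[OF \<phi>] test_function_zero[OF \<phi>] by (simp add: Borel_rep_def)
qed

lemma Borel_rep_AE_cong:
  assumes \<Omega>: "open \<Omega>" and r: "Borel_rep \<Omega> u u'" and ae: "AE x in lebesgue_on \<Omega>. u x = v x"
  shows "Borel_rep \<Omega> v u'"
proof -
  have "AE x in lebesgue. x \<in> \<Omega> \<longrightarrow> u x = v x"
    using ae \<Omega> by (simp add: AE_restrict_space_iff)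
  moreover have "AE x in lebesgue. x \<in> \<Omega> \<longrightarrow> u x = u' x"
    using r by (simp add: Borel_rep_def)
  ultimately have "AE x in lebesgue. x \<in> \<Omega> \<longrightarrow> v x = u' x"
    by eventually_elim simp
  then show ?thesis using r by (simp add: Borel_rep_def)
qed

lemma Lp_space_2_iff:
  assumes \<Omega>: "open \<Omega>" and r: "Borel_rep \<Omega> u u'"
  shows "u \<in> Lp_space 2 \<Omega> \<longleftrightarrow> L2_zero \<Omega> u'"
proof -
  have "\<bar>t\<bar> powr 2 = t * t" for t :: real
    by (cases "t = 0") (simp_all add: power2_eq_square)
  then have "u \<in> Lp_space 2 \<Omega> \<longleftrightarrow> integrable (lebesgue_on \<Omega>) (\<lambda>x. u x * u x)"
    using Borel_rep_integral(1)[OF \<Omega> r] by (simp add: Lp_space_def)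
  also have "\<dots> \<longleftrightarrow> integrable lborel (\<lambda>x. u' x * u' x)"
    by (rule Borel_rep_integral(3)[OF \<Omega> Borel_rep_mult[OF r r]])
  also have "\<dots> \<longleftrightarrow> L2_zero \<Omega> u'"
    using r by (simp add: L2_zero_def Borel_rep_def)
  finally show ?thesis .
qed

text \<open>The relation \<open>weak_deriv\<close> for Borel representatives.\<close>

definition weak_multi :: "(real^3) set \<Rightarrow> nat^3 \<Rightarrow> (real^3 \<Rightarrow> real) \<Rightarrow> (real^3 \<Rightarrow> real) \<Rightarrow> bool" where
  "weak_multi \<Omega> \<alpha> u g \<longleftrightarrow> (\<forall>\<phi>. test_function \<Omega> \<phi> \<longrightarrow>
     (\<integral>x. u x * multi_deriv \<alpha> \<phi> x \<partial>lborel) = (-1) ^ multi_order \<alpha> * (\<integral>x. g x * \<phi> x \<partial>lborel))"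

lemma locally_integrable_if_integrable:
  assumes \<Omega>: "open \<Omega>" and u: "integrable (lebesgue_on \<Omega>) u"
  shows "locally_integrable \<Omega> u"
  unfolding locally_integrable_def
proof (intro allI impI, elim conjE)
  fix K assume K: "compact K" "K \<subseteq> \<Omega>"
  have Kl: "K \<in> sets lebesgue" using K(1) by (simp add: borel_compact)
  have "integrable lebesgue (\<lambda>x. indicator \<Omega> x *\<^sub>R u x)"
    using u \<Omega> by (subst (asm) integrable_restrict_space) auto
  from integrable_mult_indicator[OF Kl this]
  have "integrable lebesgue (\<lambda>x. indicator K x *\<^sub>R (indicator \<Omega> x *\<^sub>R u x))" .
  moreover have "indicator K x *\<^sub>R (indicator \<Omega> x *\<^sub>R u x) = indicator K x *\<^sub>R u x" for x
    using K(2) by (auto simp: indicator_def)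
  ultimately have "integrable lebesgue (\<lambda>x. indicator K x *\<^sub>R u x)"
    by (simp only:)
  then show "integrable (lebesgue_on K) u"
    using Kl by (subst integrable_restrict_space) simp_all
qed

lemma weak_deriv_iff:
  assumes \<Omega>: "bounded_smooth_domain \<Omega>"
    and u: "Borel_rep \<Omega> u u'" "L2_zero \<Omega> u'" and v: "Borel_rep \<Omega> v v'" "L2_zero \<Omega> v'"
  shows "weak_deriv \<Omega> \<alpha> u v \<longleftrightarrow> weak_multi \<Omega> \<alpha> u' v'"
proof -
  have op: "open \<Omega>" using \<Omega> by (simp add: bounded_smooth_domain_def)
  have "locally_integrable \<Omega> u" "locally_integrable \<Omega> v"
    using u v L2_zero_integrable[OF \<Omega>] Borel_rep_integral(3)[OF op] locally_integrable_if_integrable[OF op] by blast+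
  moreover have "(LINT x|lebesgue_on \<Omega>. u x * multi_deriv \<alpha> \<phi> x) = (\<integral>x. u' x * multi_deriv \<alpha> \<phi> x \<partial>lborel)"
    "(LINT x|lebesgue_on \<Omega>. v x * \<phi> x) = (\<integral>x. v' x * \<phi> x \<partial>lborel)" if \<phi>: "test_function \<Omega> \<phi>" for \<phi>
    by (rule Borel_rep_integral(2)[OF op Borel_rep_mult_test[OF u(1) test_function_multi_deriv[OF \<phi>]]]
        Borel_rep_integral(2)[OF op Borel_rep_mult_test[OF v(1) \<phi>]])+
  ultimately show ?thesis
    unfolding weak_deriv_def weak_multi_def by auto
qed

lemma weak_multi_zero: "weak_multi \<Omega> 0 u u"
  by (simp add: weak_multi_def multi_deriv_zero multi_order_def)

lemma weak_multi_axis: "weak_multi \<Omega> (axis i 1) u g \<longleftrightarrow> weak_dir \<Omega> (axis i 1) u g"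
proof -
  have "multi_order (axis i 1) = 1"
    using multi_order_add_axis[of 0 i] multi_order_eq_0[of 0] by simp
  then show ?thesis
    unfolding weak_multi_def weak_dir_def multi_deriv_axis dir_deriv_axis by simp
qed

text \<open>Apply the definition of \<open>g\<close> to the test function \<open>multi_deriv \<alpha> \<phi>\<close>; here it matters that partial
  derivatives of smooth functions commute, since \<open>multi_deriv\<close> fixes their order.\<close>

lemma weak_multi_add_axis:
  assumes wd: "weak_dir \<Omega> (axis i 1) u g"
  shows "weak_multi \<Omega> (\<alpha> + axis i 1) u h \<longleftrightarrow> weak_multi \<Omega> \<alpha> g h"
proof -
  have "(\<integral>x. u x * multi_deriv (\<alpha> + axis i 1) \<phi> x \<partial>lborel) = - (\<integral>x. g x * multi_deriv \<alpha> \<phi> x \<partial>lborel)"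
    if \<phi>: "test_function \<Omega> \<phi>" for \<phi>
  proof -
    have "C_infinity \<phi>" using \<phi> by (simp add: test_function_def)
    then show ?thesis
      using wd test_function_multi_deriv[OF \<phi>, of \<alpha>]
      unfolding multi_deriv_add_axis(2)[OF \<open>C_infinity \<phi>\<close>] weak_dir_def dir_deriv_axis by blast
  qed
  then show ?thesis
    unfolding weak_multi_def multi_order_add_axis by simp
qed

text \<open>The recursive description agrees with the one by multi-indices: split off one first derivative.\<close>

lemma H_zero_iff_weak_multi:
  "H_zero m \<Omega> u \<longleftrightarrow> L2_zero \<Omega> u \<and> (\<forall>\<alpha>. multi_order \<alpha> \<le> m \<longrightarrow> (\<exists>g. L2_zero \<Omega> g \<and> weak_multi \<Omega> \<alpha> u g))"
proof (induction m arbitrary: u)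
  case 0
  then show ?case by (auto simp: multi_order_eq_0 intro: weak_multi_zero)
next
  case (Suc m)
  show ?case
  proof (intro iffI conjI allI impI)
    assume H: "H_zero (Suc m) \<Omega> u"
    then show "L2_zero \<Omega> u" by simp
    fix \<alpha> assume \<alpha>: "multi_order \<alpha> \<le> Suc m"
    show "\<exists>g. L2_zero \<Omega> g \<and> weak_multi \<Omega> \<alpha> u g"
    proof (cases "\<alpha> = 0")
      case True
      then show ?thesis using \<open>L2_zero \<Omega> u\<close> weak_multi_zero by blast
    next
      case False
      then obtain \<beta> i where \<beta>: "\<alpha> = \<beta> + axis i 1" by (rule multi_order_Suc_decomp)
      obtain g where g: "H_zero m \<Omega> g" "weak_dir \<Omega> (axis i 1) u g" using H by auto
      have "multi_order \<beta> \<le> m" using \<alpha> unfolding \<beta> multi_order_add_axis by simp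
      then obtain h where "L2_zero \<Omega> h" "weak_multi \<Omega> \<beta> g h" using g(1) Suc.IH by blast
      then show ?thesis unfolding \<beta> using weak_multi_add_axis[OF g(2)] by blast
    qed
  next
    assume H: "L2_zero \<Omega> u \<and> (\<forall>\<alpha>. multi_order \<alpha> \<le> Suc m \<longrightarrow> (\<exists>g. L2_zero \<Omega> g \<and> weak_multi \<Omega> \<alpha> u g))"
    have "\<exists>g. H_zero m \<Omega> g \<and> weak_dir \<Omega> (axis i 1) u g" for i
    proof -
      have "multi_order (axis i 1) \<le> Suc m"
        using multi_order_add_axis[of 0 i] multi_order_eq_0[of 0] by simp
      then obtain g where g: "L2_zero \<Omega> g" "weak_dir \<Omega> (axis i 1) u g"
        using H unfolding weak_multi_axis[symmetric] by blast
      have "\<exists>h. L2_zero \<Omega> h \<and> weak_multi \<Omega> \<beta> g h" if "multi_order \<beta> \<le> m" for \<beta>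
      proof -
        have "multi_order (\<beta> + axis i 1) \<le> Suc m" using that unfolding multi_order_add_axis by simp
        then show ?thesis using H weak_multi_add_axis[OF g(2)] by blast
      qed
      then show ?thesis using g Suc.IH by blast
    qed
    then show "H_zero (Suc m) \<Omega> u" using H by simp
  qed
qed

lemma H_space_iff:
  assumes \<Omega>: "bounded_smooth_domain \<Omega>" and r: "Borel_rep \<Omega> u u'"
  shows "u \<in> H_space m \<Omega> \<longleftrightarrow> H_zero m \<Omega> u'"
proof -
  have op: "open \<Omega>" using \<Omega> by (simp add: bounded_smooth_domain_def)
  have "(\<exists>v\<in>Lp_space 2 \<Omega>. weak_deriv \<Omega> \<alpha> u v) \<longleftrightarrow> (\<exists>g. L2_zero \<Omega> g \<and> weak_multi \<Omega> \<alpha> u' g)"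
    if u': "L2_zero \<Omega> u'" for \<alpha>
  proof
    assume "\<exists>v\<in>Lp_space 2 \<Omega>. weak_deriv \<Omega> \<alpha> u v"
    then obtain v where v: "v \<in> Lp_space 2 \<Omega>" "weak_deriv \<Omega> \<alpha> u v" by blast
    then obtain v' where v': "Borel_rep \<Omega> v v'"
      using Borel_rep_exists[OF op] by (auto simp: Lp_space_def)
    then have "L2_zero \<Omega> v'" using v(1) Lp_space_2_iff[OF op] by blast
    then show "\<exists>g. L2_zero \<Omega> g \<and> weak_multi \<Omega> \<alpha> u' g"
      using weak_deriv_iff[OF \<Omega> r u' v'] v(2) by blast
  next
    assume "\<exists>g. L2_zero \<Omega> g \<and> weak_multi \<Omega> \<alpha> u' g"
    then obtain g where g: "L2_zero \<Omega> g" "weak_multi \<Omega> \<alpha> u' g" by blast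
    have "g \<in> Lp_space 2 \<Omega>" using Lp_space_2_iff[OF op Borel_rep_self[OF g(1)]] g(1) by blast
    then show "\<exists>v\<in>Lp_space 2 \<Omega>. weak_deriv \<Omega> \<alpha> u v"
      using weak_deriv_iff[OF \<Omega> r u' Borel_rep_self[OF g(1)] g(1)] g(2) by blast
  qed
  then show ?thesis
    unfolding H_space_def Sobolev_def H_zero_iff_weak_multi using Lp_space_2_iff[OF op r] by auto
qed

lemma H_space_rep:
  assumes \<Omega>: "bounded_smooth_domain \<Omega>" and u: "u \<in> H_space m \<Omega>"
  obtains u' where "Borel_rep \<Omega> u u'" "H_zero m \<Omega> u'"
proof -
  have "u \<in> borel_measurable (lebesgue_on \<Omega>)"
    using u by (simp add: H_space_def Sobolev_def Lp_space_def)
  moreover have "open \<Omega>" using \<Omega> by (simp add: bounded_smooth_domain_def)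
  ultimately obtain u' where "Borel_rep \<Omega> u u'"
    using Borel_rep_exists by blast
  then show ?thesis using that H_space_iff[OF \<Omega>] u by blast
qed

theorem H_space_mult:
  assumes \<Omega>: "bounded_smooth_domain \<Omega>" and "m \<ge> 2" and "u \<in> H_space m \<Omega>" "v \<in> H_space m \<Omega>"
  shows "(\<lambda>x. u x * v x) \<in> H_space m \<Omega>"
proof -
  obtain u' where u': "Borel_rep \<Omega> u u'" "H_zero m \<Omega> u'" using H_space_rep[OF \<Omega> assms(3)] .
  obtain v' where v': "Borel_rep \<Omega> v v'" "H_zero m \<Omega> v'" using H_space_rep[OF \<Omega> assms(4)] .
  have "H_zero m \<Omega> (\<lambda>x. u' x * v' x)"
    using H_zero_mult[OF \<Omega> u'(2)] v'(2) \<open>m \<ge> 2\<close> by (simp add: max_absorb1)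
  then show ?thesis
    using H_space_iff[OF \<Omega> Borel_rep_mult[OF u'(1) v'(1)]] by blast
qed

lemma H_space_lincomb:
  assumes \<Omega>: "bounded_smooth_domain \<Omega>" and "u \<in> H_space m \<Omega>" "v \<in> H_space m \<Omega>"
  shows "(\<lambda>x. a * u x + b * v x) \<in> H_space m \<Omega>"
proof -
  obtain u' where u': "Borel_rep \<Omega> u u'" "H_zero m \<Omega> u'" using H_space_rep[OF \<Omega> assms(2)] .
  obtain v' where v': "Borel_rep \<Omega> v v'" "H_zero m \<Omega> v'" using H_space_rep[OF \<Omega> assms(3)] .
  show ?thesis
    using H_space_iff[OF \<Omega> Borel_rep_lincomb[OF u'(1) v'(1)]] H_zero_lincomb[OF \<Omega> u'(2) v'(2)] by blast
qed

lemma H_space_AE_cong: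
  assumes \<Omega>: "bounded_smooth_domain \<Omega>" and u: "u \<in> H_space m \<Omega>" and ae: "AE x in lebesgue_on \<Omega>. u x = v x"
  shows "v \<in> H_space m \<Omega>"
proof -
  have op: "open \<Omega>" using \<Omega> by (simp add: bounded_smooth_domain_def)
  obtain u' where u': "Borel_rep \<Omega> u u'" "H_zero m \<Omega> u'" using H_space_rep[OF \<Omega> u] .
  show ?thesis
    using H_space_iff[OF \<Omega> Borel_rep_AE_cong[OF op u'(1) ae]] u'(2) by blast
qed

section \<open>Inverse matrix fields\<close>

text \<open>All entries are differences of two products of two entries of \<open>A\<close>, so that the algebra property applies.\<close>

definition adjugate3 :: "real^3^3 \<Rightarrow> real^3^3" where
  "adjugate3 A = vector
    [vector [A$2$2 * A$3$3 - A$2$3 * A$3$2, A$1$3 * A$3$2 - A$1$2 * A$3$3, A$1$2 * A$2$3 - A$1$3 * A$2$2],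
     vector [A$2$3 * A$3$1 - A$2$1 * A$3$3, A$1$1 * A$3$3 - A$1$3 * A$3$1, A$1$3 * A$2$1 - A$1$1 * A$2$3],
     vector [A$2$1 * A$3$2 - A$2$2 * A$3$1, A$1$2 * A$3$1 - A$1$1 * A$3$2, A$1$1 * A$2$2 - A$1$2 * A$2$1]]"

lemma matrix_inv_eq_adjugate3:
  assumes "det A = 1"
  shows "matrix_inv A = adjugate3 A"
proof -
  have "A ** adjugate3 A = mat 1"
    using assms unfolding det_3
    by (simp add: vec_eq_iff forall_3 matrix_matrix_mult_def sum_3 adjugate3_def mat_def algebra_simps)
  moreover from this have "adjugate3 A ** A = mat 1"
    by (simp add: matrix_left_right_inverse)
  ultimately have "A ** matrix_inv A = mat 1"
    unfolding matrix_inv_def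
    using someI[of "\<lambda>A'. A ** A' = mat 1 \<and> A' ** A = mat 1" "adjugate3 A"] by blast
  then have "adjugate3 A ** A ** matrix_inv A = adjugate3 A"
    by (simp add: matrix_mul_assoc[symmetric])
  with \<open>adjugate3 A ** A = mat 1\<close> show ?thesis by simp
qed

lemma adjugate3_H_matrix:
  assumes \<Omega>: "bounded_smooth_domain \<Omega>" and m: "m \<ge> 2" and B: "B \<in> H_matrix m \<Omega>"
  shows "(\<lambda>x. adjugate3 (B x)) \<in> H_matrix m \<Omega>"
proof -
  have "(\<lambda>x. B x $ i $ j * B x $ k $ l - B x $ p $ q * B x $ r $ s) \<in> H_space m \<Omega>" for i j k l p q r s
    using H_space_lincomb[OF \<Omega> H_space_mult[OF \<Omega> m] H_space_mult[OF \<Omega> m], of _ _ _ _ 1 "-1"] B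
    by (simp add: H_matrix_def)
  then show ?thesis
    by (simp add: H_matrix_def forall_3 adjugate3_def)
qed

lemma H_matrix_response:
  assumes \<Omega>: "bounded_smooth_domain \<Omega>" and m: "m \<ge> 2"
    and B: "B \<in> H_matrix m \<Omega>" "matrix_field_inv B \<in> H_matrix m \<Omega>"
    and \<mu>: "\<mu>1 \<in> H_space m \<Omega>" "\<mu>2 \<in> H_space m \<Omega>" "\<mu>3 \<in> H_space m \<Omega>"
  shows "response \<mu>1 \<mu>2 \<mu>3 B \<in> H_matrix m \<Omega>"
  unfolding H_matrix_def
proof (intro CollectI allI)
  fix i j
  have 2: "(\<lambda>x. \<mu>2 x * B x $ i $ j) \<in> H_space m \<Omega>"
    using H_space_mult[OF \<Omega> m \<mu>(2)] B(1) by (simp add: H_matrix_def)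
  have 3: "(\<lambda>x. \<mu>3 x * matrix_field_inv B x $ i $ j) \<in> H_space m \<Omega>"
    using H_space_mult[OF \<Omega> m \<mu>(3)] B(2) by (simp add: H_matrix_def)
  show "(\<lambda>x. response \<mu>1 \<mu>2 \<mu>3 B x $ i $ j) \<in> H_space m \<Omega>"
    using H_space_lincomb[OF \<Omega> H_space_lincomb[OF \<Omega> \<mu>(1) 2, of "mat 1 $ i $ j" 1] 3, of 1 1]
    by (simp add: response_def mult.commute)
qed

theorem proposition5p6:
  fixes \<Omega> :: "(real^3) set" and m :: nat and B :: "real^3 \<Rightarrow> real^3^3"
  assumes "bounded_smooth_domain \<Omega>"
    and "m \<ge> 2"
    and "B \<in> H_matrix m \<Omega>"
    and "AE x in lebesgue_on \<Omega>. det (B x) = 1"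
  shows "matrix_field_inv B \<in> H_matrix m \<Omega> \<and>
    (\<forall>\<mu>1 \<mu>2 \<mu>3. \<mu>1 \<in> Sobolev 1 \<infinity> \<Omega> \<inter> H_space m \<Omega> \<longrightarrow>
       \<mu>2 \<in> Sobolev 1 \<infinity> \<Omega> \<inter> H_space m \<Omega> \<longrightarrow>
       \<mu>3 \<in> Sobolev 1 \<infinity> \<Omega> \<inter> H_space m \<Omega> \<longrightarrow>
       response \<mu>1 \<mu>2 \<mu>3 B \<in> H_matrix m \<Omega>)"
proof -
  have "AE x in lebesgue_on \<Omega>. adjugate3 (B x) $ i $ j = matrix_field_inv B x $ i $ j" for i j
    using assms(4) by eventually_elim (simp add: matrix_inv_eq_adjugate3 matrix_field_inv_def)
  moreover have "(\<lambda>x. adjugate3 (B x) $ i $ j) \<in> H_space m \<Omega>" for i j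
    using adjugate3_H_matrix[OF assms(1-3)] by (simp add: H_matrix_def)
  ultimately have "(\<lambda>x. matrix_field_inv B x $ i $ j) \<in> H_space m \<Omega>" for i j
    by (rule H_space_AE_cong[OF assms(1), rotated])
  then have "matrix_field_inv B \<in> H_matrix m \<Omega>"
    by (simp add: H_matrix_def)
  then show ?thesis
    using H_matrix_response[OF assms(1-3)] by blast
qed

end
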